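(* Let $E$ be a discrete group having a central element $a$ of infinite order. Let $p$ and $q$ be non-zero integers with $|p|\neq |q|$. Define $\Gamma$ as the group with the presentation \[\Gamma =\langle \, E,\ t\mid ta^pt^{-1}=a^q\, \rangle.\] Then $\Gamma$ is ICC, and the von Neumann algebra of $\Gamma$ has property Gamma.
   Context: Discrete groups are assumed to be countable. The group $\Gamma=\langle E, t\mid ta^pt^{-1}=a^q\rangle$ is the HNN extension of $E$ relative to the isomorphism $\langle a^p\rangle\to\langle a^q\rangle$ sending $a^p$ to $a^q$, i.e. the quotient of the free product of $E$ with the infinite cyclic group generated by $t$ by the normal closure of $ta^pt^{-1}a^{-q}$. A discrete group is ICC if the conjugacy class of every non-neutral element is infinite. The von Neumann algebra $L\Gamma$ of $\Gamma$ is the group von Neumann algebra, generated by the canonical unitaries $u_\gamma$ ($\gamma\in\Gamma$), with its canonical trace $\tau$; put $\Vert x\Vert_2=\tau(x^*x)^{1/2}$ for $x\in L\Gamma$. $L\Gamma$ has property Gamma if there exists a sequence $(x_n)_{n\in\mathbb{N}}$ of unitary elements of $L\Gamma$ such that $\tau(x_n)=0$ for every $n$, and $\Vert x_ny-yx_n\Vert_2\to 0$ as $n\to\infty$ for every $y\in L\Gamma$. *)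

theory Defs
  imports
    "HOL-Analysis.Infinite_Sum"
    "HOL-Library.Countable_Set"
    "HOL-Library.FuncSet"
    "HOL-Algebra.Elementary_Groups"
    "HOL-Algebra.Generated_Groups"
    "HOL-Algebra.Multiplicative_Group"
begin

section \<open>Free products of groups\<close>

text \<open>
  The free product is the monoid of words over the disjoint union of the two carriers,
  modulo the least congruence that contracts adjacent letters of the same factor and
  deletes the two neutral letters.
\<close>

inductive_set free_product_rel ::
  "('a, 'm) monoid_scheme \<Rightarrow> ('b, 'n) monoid_scheme \<Rightarrow> (('a + 'b) list \<times> ('a + 'b) list) set"
  for G :: "('a, 'm) monoid_scheme" and H :: "('b, 'n) monoid_scheme"
where
  fp_refl: "u \<in> lists (carrier G <+> carrier H) \<Longrightarrow> (u, u) \<in> free_product_rel G H"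
| fp_sym: "(u, v) \<in> free_product_rel G H \<Longrightarrow> (v, u) \<in> free_product_rel G H"
| fp_trans: "(u, v) \<in> free_product_rel G H \<Longrightarrow> (v, w) \<in> free_product_rel G H
    \<Longrightarrow> (u, w) \<in> free_product_rel G H"
| fp_cong: "(u, u') \<in> free_product_rel G H \<Longrightarrow> (v, v') \<in> free_product_rel G H
    \<Longrightarrow> (u @ v, u' @ v') \<in> free_product_rel G H"
| fp_one_left: "([Inl \<one>\<^bsub>G\<^esub>], []) \<in> free_product_rel G H"
| fp_one_right: "([Inr \<one>\<^bsub>H\<^esub>], []) \<in> free_product_rel G H"
| fp_mult_left: "x \<in> carrier G \<Longrightarrow> y \<in> carrier G
    \<Longrightarrow> ([Inl x, Inl y], [Inl (x \<otimes>\<^bsub>G\<^esub> y)]) \<in> free_product_rel G H"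
| fp_mult_right: "x \<in> carrier H \<Longrightarrow> y \<in> carrier H
    \<Longrightarrow> ([Inr x, Inr y], [Inr (x \<otimes>\<^bsub>H\<^esub> y)]) \<in> free_product_rel G H"

definition free_product ::
  "('a, 'm) monoid_scheme \<Rightarrow> ('b, 'n) monoid_scheme \<Rightarrow> ('a + 'b) list set monoid" where
  "free_product G H =
     \<lparr>carrier = lists (carrier G <+> carrier H) // free_product_rel G H,
      monoid.mult = (\<lambda>A B. \<Union>u\<in>A. \<Union>v\<in>B. free_product_rel G H `` {u @ v}),
      one = free_product_rel G H `` {[]}\<rparr>"

definition fp_inl ::
  "('a, 'm) monoid_scheme \<Rightarrow> ('b, 'n) monoid_scheme \<Rightarrow> 'a \<Rightarrow> ('a + 'b) list set" where
  "fp_inl G H x = free_product_rel G H `` {[Inl x]}"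

definition fp_inr ::
  "('a, 'm) monoid_scheme \<Rightarrow> ('b, 'n) monoid_scheme \<Rightarrow> 'b \<Rightarrow> ('a + 'b) list set" where
  "fp_inr G H y = free_product_rel G H `` {[Inr y]}"

lemma free_product_rel_words:
  assumes "group G" "group H" "(u, v) \<in> free_product_rel G H"
  shows "u \<in> lists (carrier G <+> carrier H) \<and> v \<in> lists (carrier G <+> carrier H)"
proof -
  interpret G: group G by fact
  interpret H: group H by fact
  show ?thesis
    using assms(3) by induction auto
qed

lemma free_product_rel_equiv:
  assumes "group G" "group H"
  shows "equiv (lists (carrier G <+> carrier H)) (free_product_rel G H)"
proof (rule equivI)
  show "free_product_rel G H \<subseteq> lists (carrier G <+> carrier H) \<times> lists (carrier G <+> carrier H)"
    using free_product_rel_words[OF assms] by auto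
  show "refl_on (lists (carrier G <+> carrier H)) (free_product_rel G H)"
    by (auto simp: refl_on_def intro: fp_refl)
  show "sym (free_product_rel G H)"
    by (auto simp: sym_def intro: fp_sym)
  show "trans (free_product_rel G H)"
    by (auto simp: trans_def intro: fp_trans)
qed

lemma free_product_mult_class:
  assumes "group G" "group H"
    and "u \<in> lists (carrier G <+> carrier H)" "v \<in> lists (carrier G <+> carrier H)"
  shows "(free_product_rel G H `` {u}) \<otimes>\<^bsub>free_product G H\<^esub> (free_product_rel G H `` {v})
           = free_product_rel G H `` {u @ v}"
proof -
  let ?r = "free_product_rel G H"
  have eq: "?r `` {u' @ v'} = ?r `` {u @ v}" if "(u, u') \<in> ?r" "(v, v') \<in> ?r" for u' v'
    using equiv_class_eq[OF free_product_rel_equiv[OF assms(1,2)] fp_cong[OF that]] by simp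
  have self: "u \<in> ?r `` {u}" "v \<in> ?r `` {v}"
    using fp_refl[OF assms(3)] fp_refl[OF assms(4)] by simp_all
  have "(\<Union>u'\<in>?r `` {u}. \<Union>v'\<in>?r `` {v}. ?r `` {u' @ v'}) = ?r `` {u @ v}" (is "?L = _")
  proof
    show "?L \<subseteq> ?r `` {u @ v}"
      by (intro UN_least) (use eq in \<open>simp only: Image_singleton_iff order_refl\<close>)
    show "?r `` {u @ v} \<subseteq> ?L"
      using self by blast
  qed
  then show ?thesis
    by (simp add: free_product_def)
qed

lemma free_product_group:
  assumes "group G" "group H"
  shows "group (free_product G H)"
proof -
  interpret G: group G by fact
  interpret H: group H by fact
  let ?W = "lists (carrier G <+> carrier H)"
  let ?r = "free_product_rel G H"
  let ?P = "free_product G H"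
  note mult = free_product_mult_class[OF assms]
  have carrier: "carrier ?P = ?W // ?r" and one: "\<one>\<^bsub>?P\<^esub> = ?r `` {[]}"
    by (simp_all add: free_product_def)
  have inv_word: "\<exists>v\<in>?W. (v @ u, []) \<in> ?r" if "u \<in> ?W" for u
    using that
  proof induction
    case Nil
    then show ?case by (auto intro!: bexI[of _ "[]"] fp_refl)
  next
    case (Cons c u)
    then obtain v where v: "v \<in> ?W" "(v @ u, []) \<in> ?r" by blast
    have "\<exists>d\<in>carrier G <+> carrier H. ([d, c], []) \<in> ?r"
    proof (cases c)
      case (Inl x)
      then have "x \<in> carrier G" using Cons by auto
      then show ?thesis
        using Inl fp_trans[OF fp_mult_left[of "inv\<^bsub>G\<^esub> x" G x H], of "[]"] fp_one_left[of G H]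
        by (intro bexI[of _ "Inl (inv\<^bsub>G\<^esub> x)"]) auto
    next
      case (Inr x)
      then have "x \<in> carrier H" using Cons by auto
      then show ?thesis
        using Inr fp_trans[OF fp_mult_right[of "inv\<^bsub>H\<^esub> x" H x G], of "[]"] fp_one_right[of H G]
        by (intro bexI[of _ "Inr (inv\<^bsub>H\<^esub> x)"]) auto
    qed
    then obtain d where d: "d \<in> carrier G <+> carrier H" "([d, c], []) \<in> ?r" by blast
    have "(v @ ([d, c] @ u), v @ ([] @ u)) \<in> ?r"
      using v Cons.hyps d by (intro fp_cong fp_refl) auto
    then have "((v @ [d]) @ c # u, v @ u) \<in> ?r"
      by simp
    then have "((v @ [d]) @ c # u, []) \<in> ?r"
      using v(2) by (rule fp_trans)
    then show ?case
      using v d by (intro bexI[of _ "v @ [d]"]) auto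
  qed
  show ?thesis
  proof (rule groupI)
    show "\<one>\<^bsub>?P\<^esub> \<in> carrier ?P"
      by (simp add: carrier one quotientI)
  next
    fix A B assume "A \<in> carrier ?P" "B \<in> carrier ?P"
    then obtain u v where "u \<in> ?W" "v \<in> ?W" and "A = ?r `` {u}" "B = ?r `` {v}"
      unfolding carrier by (metis quotientE)
    then show "A \<otimes>\<^bsub>?P\<^esub> B \<in> carrier ?P"
      using mult by (simp add: carrier quotientI)
  next
    fix A B C assume "A \<in> carrier ?P" "B \<in> carrier ?P" "C \<in> carrier ?P"
    then obtain u v w where "u \<in> ?W" "v \<in> ?W" "w \<in> ?W"
      and "A = ?r `` {u}" "B = ?r `` {v}" "C = ?r `` {w}"
      unfolding carrier by (metis quotientE)
    then show "A \<otimes>\<^bsub>?P\<^esub> B \<otimes>\<^bsub>?P\<^esub> C = A \<otimes>\<^bsub>?P\<^esub> (B \<otimes>\<^bsub>?P\<^esub> C)"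
      using mult by simp
  next
    fix A assume "A \<in> carrier ?P"
    then obtain u where u: "u \<in> ?W" "A = ?r `` {u}"
      unfolding carrier by (metis quotientE)
    then show "\<one>\<^bsub>?P\<^esub> \<otimes>\<^bsub>?P\<^esub> A = A"
      using mult one by simp
    obtain v where v: "v \<in> ?W" "(v @ u, []) \<in> ?r"
      using inv_word u by blast
    then have "?r `` {v} \<otimes>\<^bsub>?P\<^esub> A = \<one>\<^bsub>?P\<^esub>"
      using u mult one equiv_class_eq[OF free_product_rel_equiv[OF assms] v(2)] by simp
    then show "\<exists>B\<in>carrier ?P. B \<otimes>\<^bsub>?P\<^esub> A = \<one>\<^bsub>?P\<^esub>"
      using v unfolding carrier by (metis quotientI)
  qed
qed

section \<open>The HNN extension\<close>

definition normal_closure :: "('a, 'm) monoid_scheme \<Rightarrow> 'a set \<Rightarrow> 'a set" where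
  "normal_closure G S = generate G {g \<otimes>\<^bsub>G\<^esub> s \<otimes>\<^bsub>G\<^esub> inv\<^bsub>G\<^esub> g | g s. g \<in> carrier G \<and> s \<in> S}"

definition hnn_relator ::
  "('a, 'm) monoid_scheme \<Rightarrow> 'a \<Rightarrow> int \<Rightarrow> int \<Rightarrow> ('a + int) list set" where
  "hnn_relator E a p q =
     (let F = free_product E integer_group;
          \<alpha> = fp_inl E integer_group a;
          t = fp_inr E integer_group 1
      in t \<otimes>\<^bsub>F\<^esub> (\<alpha> [^]\<^bsub>F\<^esub> p) \<otimes>\<^bsub>F\<^esub> inv\<^bsub>F\<^esub> t \<otimes>\<^bsub>F\<^esub> (\<alpha> [^]\<^bsub>F\<^esub> (- q)))"

definition hnn_group ::
  "('a, 'm) monoid_scheme \<Rightarrow> 'a \<Rightarrow> int \<Rightarrow> int \<Rightarrow> ('a + int) list set set monoid" where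
  "hnn_group E a p q =
     free_product E integer_group
       Mod normal_closure (free_product E integer_group) {hnn_relator E a p q}"

lemma normal_closure_normal:
  fixes G (structure)
  assumes "group G" "S \<subseteq> carrier G"
  shows "normal_closure G S \<lhd> G"
proof -
  interpret group G by fact
  show ?thesis
    unfolding normal_closure_def
  proof (rule normal_generateI)
    show "{g \<otimes> s \<otimes> inv g | g s. g \<in> carrier G \<and> s \<in> S} \<subseteq> carrier G"
      using assms(2) by auto
    fix h g assume "h \<in> {g \<otimes> s \<otimes> inv g | g s. g \<in> carrier G \<and> s \<in> S}" "g \<in> carrier G"
    then obtain k s where h: "h = k \<otimes> s \<otimes> inv k" and ks: "k \<in> carrier G" "s \<in> S"
      by blast
    then have "g \<otimes> h \<otimes> inv g = (g \<otimes> k) \<otimes> s \<otimes> inv (g \<otimes> k)"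
      using \<open>g \<in> carrier G\<close> assms(2) by (auto simp: m_assoc inv_mult_group subset_iff)
    then show "g \<otimes> h \<otimes> inv g \<in> {g \<otimes> s \<otimes> inv g | g s. g \<in> carrier G \<and> s \<in> S}"
      using \<open>g \<in> carrier G\<close> ks by blast
  qed
qed

lemma hnn_group_group:
  assumes "group E" "a \<in> carrier E"
  shows "group (hnn_group E a p q)"
proof -
  let ?F = "free_product E integer_group"
  interpret F: group ?F
    using assms(1) by (simp add: free_product_group)
  have "fp_inl E integer_group a \<in> carrier ?F" "fp_inr E integer_group 1 \<in> carrier ?F"
    using assms(2) by (auto simp: fp_inl_def fp_inr_def free_product_def intro!: quotientI)
  then have "hnn_relator E a p q \<in> carrier ?F"
    by (simp add: hnn_relator_def Let_def)
  then show ?thesis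
    unfolding hnn_group_def
    by (intro normal.factorgroup_is_group normal_closure_normal F.is_group) auto
qed

section \<open>Infinite conjugacy classes\<close>

definition conjugacy_class :: "('a, 'm) monoid_scheme \<Rightarrow> 'a \<Rightarrow> 'a set" where
  "conjugacy_class G x = {g \<otimes>\<^bsub>G\<^esub> x \<otimes>\<^bsub>G\<^esub> inv\<^bsub>G\<^esub> g | g. g \<in> carrier G}"

definition icc_group :: "('a, 'm) monoid_scheme \<Rightarrow> bool" where
  "icc_group G \<longleftrightarrow>
     group G \<and> (\<forall>x\<in>carrier G. x \<noteq> \<one>\<^bsub>G\<^esub> \<longrightarrow> infinite (conjugacy_class G x))"

section \<open>Bounded operators on the Hilbert space of square-summable functions\<close>

text \<open>
  Square-summable functions on a set vanish off that set, and operators are undefined off the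
  space, so that equality in HOL is equality of vectors and of operators respectively.
\<close>

definition ell2 :: "'a set \<Rightarrow> ('a \<Rightarrow> complex) set" where
  "ell2 X = {f. (\<forall>x. x \<notin> X \<longrightarrow> f x = 0) \<and> (\<lambda>x. (cmod (f x))\<^sup>2) summable_on X}"

definition ell2_inner :: "'a set \<Rightarrow> ('a \<Rightarrow> complex) \<Rightarrow> ('a \<Rightarrow> complex) \<Rightarrow> complex" where
  "ell2_inner X f g = (\<Sum>\<^sub>\<infinity>x\<in>X. f x * cnj (g x))"

definition ell2_norm :: "'a set \<Rightarrow> ('a \<Rightarrow> complex) \<Rightarrow> real" where
  "ell2_norm X f = sqrt (\<Sum>\<^sub>\<infinity>x\<in>X. (cmod (f x))\<^sup>2)"

type_synonym 'a ell2_op = "('a \<Rightarrow> complex) \<Rightarrow> ('a \<Rightarrow> complex)"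

definition bounded_ops :: "'a set \<Rightarrow> 'a ell2_op set" where
  "bounded_ops X = {T \<in> ell2 X \<rightarrow>\<^sub>E ell2 X.
     (\<forall>f\<in>ell2 X. \<forall>g\<in>ell2 X. T (\<lambda>x. f x + g x) = (\<lambda>x. T f x + T g x)) \<and>
     (\<forall>c. \<forall>f\<in>ell2 X. T (\<lambda>x. c * f x) = (\<lambda>x. c * T f x)) \<and>
     (\<exists>C. \<forall>f\<in>ell2 X. ell2_norm X (T f) \<le> C * ell2_norm X f)}"

definition op_one :: "'a set \<Rightarrow> 'a ell2_op" where
  "op_one X = (\<lambda>f\<in>ell2 X. f)"

definition op_mult :: "'a set \<Rightarrow> 'a ell2_op \<Rightarrow> 'a ell2_op \<Rightarrow> 'a ell2_op" where
  "op_mult X S T = compose (ell2 X) S T"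

definition op_minus :: "'a set \<Rightarrow> 'a ell2_op \<Rightarrow> 'a ell2_op \<Rightarrow> 'a ell2_op" where
  "op_minus X S T = (\<lambda>f\<in>ell2 X. \<lambda>x. S f x - T f x)"

definition op_adjoint :: "'a set \<Rightarrow> 'a ell2_op \<Rightarrow> 'a ell2_op" where
  "op_adjoint X T = (THE S. S \<in> bounded_ops X \<and>
     (\<forall>f\<in>ell2 X. \<forall>g\<in>ell2 X. ell2_inner X (T f) g = ell2_inner X f (S g)))"

definition unitary_op :: "'a set \<Rightarrow> 'a ell2_op \<Rightarrow> bool" where
  "unitary_op X U \<longleftrightarrow> U \<in> bounded_ops X \<and>
     op_mult X (op_adjoint X U) U = op_one X \<and> op_mult X U (op_adjoint X U) = op_one X"

definition commutant :: "'a set \<Rightarrow> 'a ell2_op set \<Rightarrow> 'a ell2_op set" where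
  "commutant X A = {T \<in> bounded_ops X. \<forall>S\<in>A. op_mult X T S = op_mult X S T}"

section \<open>The group von Neumann algebra\<close>

definition canonical_unitary :: "('a, 'm) monoid_scheme \<Rightarrow> 'a \<Rightarrow> 'a ell2_op" where
  "canonical_unitary G g = (\<lambda>f\<in>ell2 (carrier G).
     \<lambda>x. if x \<in> carrier G then f (inv\<^bsub>G\<^esub> g \<otimes>\<^bsub>G\<^esub> x) else 0)"

text \<open>
  The canonical unitaries form a set closed under adjoints, so the von Neumann algebra they
  generate is their bicommutant.
\<close>

definition group_vN_algebra :: "('a, 'm) monoid_scheme \<Rightarrow> 'a ell2_op set" where
  "group_vN_algebra G =
     commutant (carrier G) (commutant (carrier G) (canonical_unitary G ` carrier G))"

definition canonical_trace :: "('a, 'm) monoid_scheme \<Rightarrow> 'a ell2_op \<Rightarrow> complex" where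
  "canonical_trace G T =
     (let \<delta> = (\<lambda>x. if x = \<one>\<^bsub>G\<^esub> then 1 else 0) in ell2_inner (carrier G) (T \<delta>) \<delta>)"

text \<open>The trace of a positive operator is a nonnegative real, so taking the real part loses nothing.\<close>

definition trace_norm2 :: "('a, 'm) monoid_scheme \<Rightarrow> 'a ell2_op \<Rightarrow> real" where
  "trace_norm2 G T =
     sqrt (Re (canonical_trace G (op_mult (carrier G) (op_adjoint (carrier G) T) T)))"

definition vN_property_Gamma :: "('a, 'm) monoid_scheme \<Rightarrow> bool" where
  "vN_property_Gamma G \<longleftrightarrow>
     (\<exists>x :: nat \<Rightarrow> 'a ell2_op.
        (\<forall>n. x n \<in> group_vN_algebra G \<and> unitary_op (carrier G) (x n) \<and>
             canonical_trace G (x n) = 0) \<and>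
        (\<forall>y\<in>group_vN_algebra G.
           (\<lambda>n. trace_norm2 G
              (op_minus (carrier G) (op_mult (carrier G) (x n) y) (op_mult (carrier G) y (x n))))
             \<longlonglongrightarrow> 0))"

end

theory Submission
  imports Defs "HOL-Analysis.Elementary_Normed_Spaces" "HOL-Analysis.Summation_Tests"
begin

text \<open>
  Write \<open>\<Gamma>\<close> for the HNN extension, with stable letter \<open>t\<close>. The two halves of the theorem have
  different reasons.

  \<^emph>\<open>Property Gamma.\<close> Every function of \<open>a\<close> commutes with \<open>E\<close>, so a unitary of \<open>L\<langle>a\<rangle>\<close> only has to be
  made almost invariant under conjugation by \<open>t\<close>. Since \<open>t a\<^sup>p t\<^sup>-\<^sup>1 = a\<^sup>q\<close>, conjugation by \<open>t\<close> carries
  \<open>a\<^bsup>\<kappa> (i + 1)\<^esup>\<close> to \<open>a\<^bsup>\<kappa> i\<^esup>\<close> for \<open>\<kappa> i = p\<^sup>i q\<^bsup>n - i\<^esup>\<close>. Hence it moves a product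
  \<open>V\<^sub>0(a\<^bsup>\<kappa> 0\<^esup>) V\<^sub>1(a\<^bsup>\<kappa> 1\<^esup>) \<dots>\<close> of unitaries to the product in which the \<open>V\<^sub>i\<close> are shifted by one place, and
  changes it little if \<open>V\<^sub>i\<close> varies slowly with \<open>i\<close>. The sequence \<open>V\<^sub>i\<close> starts and ends at \<open>1\<close> and passes
  through a unitary of trace zero on the way.

  This works because the factors can be made stochastically independent. Let \<open>P = \<bar>p / gcd p q\<bar>\<close>; after
  exchanging \<open>p\<close> with \<open>q\<close> and \<open>t\<close> with its inverse if necessary, \<open>P \<ge> 2\<close>. A power of \<open>a\<^bsup>\<kappa> i\<^esup>\<close> lies in the
  group generated by a suitable power of \<open>a\<close> that contains the \<open>a\<^bsup>\<kappa> j\<^esup>\<close> with \<open>j > i\<close> only if the exponent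
  is divisible by \<open>P\<close> (\<open>independent_powers\<close>). If the Fourier coefficients of \<open>V\<^sub>i V'\<^sub>i\<^sup>*\<close> vanish at the
  non-zero multiples of \<open>P\<close>, the inner product of two such products is therefore the product of the
  inner products of the factors (\<open>product_vector_inner\<close>). Then one factor of trace zero makes the trace
  of the whole product vanish exactly, and the distance to the shifted product is governed by numbers
  close to \<open>1\<close>.

  A suitable path comes from a unitary \<open>\<phi>\<close> of \<open>L\<int>\<close> with \<open>\<phi>\<^sup>P = 1\<close> such that the coefficients of \<open>\<phi>\<^sup>j\<close>
  are supported on \<open>j + P\<int>\<close>; on the circle this is the step function with the \<open>P\<close>-th roots of unity as
  values. Its coefficients are proportional to \<open>1 / m\<close> on \<open>1 + P\<int>\<close>, and all that is needed of it follows
  from partial fractions and a telescoping sum (\<open>cyclic_family_exists\<close>). If \<open>\<phi>\<close> has the spectral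
  projections \<open>e\<^sub>l\<close>, then \<open>V\<^sub>s = \<Sum>\<^sub>l exp (2\<pi>\<i> s l / P) e\<^sub>l\<close> is a path from \<open>1\<close> to \<open>\<phi>\<close>, and the
  trace \<open>\<tau>(V\<^sub>s V\<^sub>s\<^sub>'\<^sup>*)\<close> is the average of \<open>exp (2\<pi>\<i> (s - s') l / P)\<close> over \<open>l < P\<close> (\<open>unitary_path_exists\<close>). Going
  up to \<open>\<phi>\<close> and back in \<open>2N\<close> steps costs \<open>O(1 / N)\<close> in the square of the 2-norm.

  Almost commutation with generators gives almost commutation with all of \<open>L\<Gamma>\<close>
  (\<open>vN_property_GammaI\<close>), because for a unitary \<open>x\<close> of \<open>L\<Gamma>\<close> the map \<open>y \<mapsto> x y - y x\<close> extends to an operator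
  of norm at most \<open>2\<close> on the Hilbert space.

  \<^emph>\<open>Infinite conjugacy classes.\<close> An element \<open>g\<close> with a finite class commutes with a positive power of
  every element. Normal forms show that commuting with a power of \<open>t\<close> forces \<open>g = t\<^sup>i e\<close> with \<open>i\<close> an
  integer and \<open>e\<close> in \<open>E\<close>: in the Bass-Serre tree, \<open>g\<close> must preserve the axis of \<open>t\<close>. Commuting with a power
  of \<open>a\<close> forces \<open>i = 0\<close>, since \<open>t\<^sup>i\<close> scales exponents of \<open>a\<close> by \<open>(q / p)\<^sup>i\<close>. Finally \<open>e\<close> commutes with
  a power of \<open>t\<close>, so it is a power of \<open>a\<close>, and the same scaling shows that it is trivial
  (\<open>icc_hnn_group\<close>).
\<close>


section \<open>Square-summable functions\<close>

definition delta :: "'a \<Rightarrow> 'a \<Rightarrow> complex" where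
  "delta x = (\<lambda>y. if y = x then 1 else 0)"

lemma ell2_outside: "f \<in> ell2 X \<Longrightarrow> x \<notin> X \<Longrightarrow> f x = 0"
  by (auto simp: ell2_def)

lemma ell2_summable: "f \<in> ell2 X \<Longrightarrow> (\<lambda>x. (cmod (f x))\<^sup>2) summable_on X"
  by (auto simp: ell2_def)

lemma ell2_add:
  assumes "f \<in> ell2 X" "g \<in> ell2 X"
  shows "(\<lambda>x. f x + g x) \<in> ell2 X"
proof -
  have le: "(cmod (u + v))\<^sup>2 \<le> 2 * (cmod u)\<^sup>2 + 2 * (cmod v)\<^sup>2" for u v :: complex
  proof -
    have "(cmod (u + v))\<^sup>2 \<le> (cmod u + cmod v)\<^sup>2"
      by (intro power_mono norm_triangle_ineq) auto
    also have "\<dots> \<le> 2 * (cmod u)\<^sup>2 + 2 * (cmod v)\<^sup>2"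
      using zero_le_power2[of "cmod u - cmod v"] by (simp add: power2_sum power2_diff)
    finally show ?thesis .
  qed
  have "(\<lambda>x. 2 * (cmod (f x))\<^sup>2 + 2 * (cmod (g x))\<^sup>2) summable_on X"
    by (intro summable_on_add summable_on_cmult_right ell2_summable assms)
  then have "(\<lambda>x. (cmod (f x + g x))\<^sup>2) summable_on X"
    by (rule summable_on_comparison_test) (auto intro: le)
  then show ?thesis
    using assms by (auto simp: ell2_def)
qed

lemma ell2_scale: "f \<in> ell2 X \<Longrightarrow> (\<lambda>x. c * f x) \<in> ell2 X"
  by (auto simp: ell2_def norm_mult power_mult_distrib intro: summable_on_cmult_right)

lemma ell2_zero: "(\<lambda>x. 0) \<in> ell2 X"
  by (auto simp: ell2_def)

lemma ell2_diff:
  assumes "f \<in> ell2 X" "g \<in> ell2 X"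
  shows "(\<lambda>x. f x - g x) \<in> ell2 X"
  using ell2_add[OF assms(1) ell2_scale[OF assms(2), of "-1"]] by simp

lemma ell2_sum:
  assumes "finite J" "\<And>j. j \<in> J \<Longrightarrow> f j \<in> ell2 X"
  shows "(\<lambda>x. \<Sum>j\<in>J. f j x) \<in> ell2 X"
  using assms by (induction J) (auto intro: ell2_add ell2_zero)

lemma ell2_finite_support:
  assumes "finite F" "F \<subseteq> X" "\<And>x. x \<notin> F \<Longrightarrow> f x = 0"
  shows "f \<in> ell2 X"
proof -
  have "(\<lambda>x. (cmod (f x))\<^sup>2) summable_on X \<longleftrightarrow> (\<lambda>x. (cmod (f x))\<^sup>2) summable_on F"
    by (rule summable_on_cong_neutral) (use assms in auto)
  then show ?thesis
    using assms by (auto simp: ell2_def)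
qed

lemma delta_ell2: "x \<in> X \<Longrightarrow> delta x \<in> ell2 X"
  by (rule ell2_finite_support[of "{x}"]) (auto simp: delta_def)

lemma ell2_restrict: "f \<in> ell2 X \<Longrightarrow> (\<lambda>x. if x \<in> Y then f x else 0) \<in> ell2 X"
  unfolding ell2_def
  by (auto elim!: summable_on_comparison_test)

lemma ell2_product_summable:
  assumes "f \<in> ell2 X" "g \<in> ell2 X"
  shows "(\<lambda>x. cmod (f x) * cmod (g x)) summable_on X"
proof -
  have "(\<lambda>x. (cmod (f x))\<^sup>2 + (cmod (g x))\<^sup>2) summable_on X"
    by (intro summable_on_add ell2_summable assms)
  then show ?thesis
  proof (rule summable_on_comparison_test)
    fix x show "cmod (f x) * cmod (g x) \<le> (cmod (f x))\<^sup>2 + (cmod (g x))\<^sup>2"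
      using sum_squares_bound[of "cmod (f x)" "cmod (g x)"]
        mult_nonneg_nonneg[OF norm_ge_zero norm_ge_zero, of "f x" "g x"]
      by (simp only: mult.assoc)
  qed auto
qed

lemma ell2_inner_abs_summable:
  assumes "f \<in> ell2 X" "g \<in> ell2 X"
  shows "(\<lambda>x. f x * cnj (g x)) abs_summable_on X"
  using ell2_product_summable[OF assms] by (simp add: norm_mult)

lemma ell2_inner_summable:
  assumes "f \<in> ell2 X" "g \<in> ell2 X"
  shows "(\<lambda>x. f x * cnj (g x)) summable_on X"
  using ell2_inner_abs_summable[OF assms] by (rule abs_summable_summable)

lemma ell2_norm_nonneg: "ell2_norm X f \<ge> 0"
  by (simp add: ell2_norm_def infsum_nonneg)

lemma ell2_norm_square: "(ell2_norm X f)\<^sup>2 = (\<Sum>\<^sub>\<infinity>x\<in>X. (cmod (f x))\<^sup>2)"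
  by (simp add: ell2_norm_def infsum_nonneg)

lemma ell2_inner_self:
  assumes "f \<in> ell2 X"
  shows "ell2_inner X f f = of_real ((ell2_norm X f)\<^sup>2)"
proof -
  have "((\<lambda>x. of_real ((cmod (f x))\<^sup>2) :: complex) has_sum of_real ((ell2_norm X f)\<^sup>2)) X"
    unfolding ell2_norm_square by (intro has_sum_of_real has_sum_infsum ell2_summable assms)
  then show ?thesis
    unfolding ell2_inner_def by (simp only: complex_norm_square[symmetric] infsumI)
qed

lemma ell2_inner_add_left:
  assumes "f \<in> ell2 X" "g \<in> ell2 X" "h \<in> ell2 X"
  shows "ell2_inner X (\<lambda>x. f x + g x) h = ell2_inner X f h + ell2_inner X g h"
  using infsum_add[OF ell2_inner_summable[OF assms(1,3)] ell2_inner_summable[OF assms(2,3)]]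
  by (simp add: ell2_inner_def distrib_right)

lemma ell2_inner_scale_left: "ell2_inner X (\<lambda>x. c * f x) h = c * ell2_inner X f h"
  by (simp add: ell2_inner_def mult.assoc infsum_cmult_right')

lemma ell2_inner_commute: "ell2_inner X g f = cnj (ell2_inner X f g)"
  unfolding ell2_inner_def infsum_cnj[symmetric] by (simp add: mult.commute)

lemma ell2_inner_sum_left:
  assumes "finite J" "\<And>j. j \<in> J \<Longrightarrow> f j \<in> ell2 X" "h \<in> ell2 X"
  shows "ell2_inner X (\<lambda>x. \<Sum>j\<in>J. f j x) h = (\<Sum>j\<in>J. ell2_inner X (f j) h)"
  using assms
proof (induction J)
  case empty
  then show ?case by (simp add: ell2_inner_def)
next
  case (insert j J)
  then have "ell2_inner X (\<lambda>x. f j x + (\<Sum>j\<in>J. f j x)) h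
     = ell2_inner X (f j) h + ell2_inner X (\<lambda>x. \<Sum>j\<in>J. f j x) h"
    by (intro ell2_inner_add_left ell2_sum) auto
  then show ?case
    using insert by simp
qed

lemma ell2_inner_delta:
  assumes "f \<in> ell2 X" "x \<in> X"
  shows "ell2_inner X f (delta x) = f x"
proof -
  have "ell2_inner X f (delta x) = (\<Sum>\<^sub>\<infinity>y\<in>{x}. f y * cnj (delta x y))"
    unfolding ell2_inner_def
    by (rule infsum_cong_neutral) (use assms in \<open>auto simp: delta_def\<close>)
  then show ?thesis by (simp add: delta_def)
qed

lemma ell2_norm_delta:
  assumes "x \<in> X"
  shows "ell2_norm X (delta x) = 1"
proof -
  have "complex_of_real ((ell2_norm X (delta x))\<^sup>2) = delta x x"
    using ell2_inner_self[OF delta_ell2] ell2_inner_delta[OF delta_ell2] assms by metis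
  then have "(ell2_norm X (delta x))\<^sup>2 = 1"
    by (simp only: delta_def of_real_eq_1_iff simp_thms if_True)
  then show ?thesis
    using ell2_norm_nonneg[of X "delta x"] by (simp add: power2_eq_1_iff)
qed

lemma cmod_le_ell2_norm:
  assumes "f \<in> ell2 X" shows "cmod (f x) \<le> ell2_norm X f"
proof (cases "x \<in> X")
  case True
  have "(\<Sum>y\<in>{x}. (cmod (f y))\<^sup>2) \<le> (\<Sum>\<^sub>\<infinity>y\<in>X. (cmod (f y))\<^sup>2)"
    by (rule finite_sum_le_infsum) (use assms True in \<open>auto simp: ell2_summable\<close>)
  then have "(cmod (f x))\<^sup>2 \<le> (ell2_norm X f)\<^sup>2"
    by (simp add: ell2_norm_square)
  then show ?thesis
    using ell2_norm_nonneg by (rule power2_le_imp_le)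
next
  case False
  then show ?thesis using assms by (simp add: ell2_outside ell2_norm_nonneg)
qed

lemma ell2_norm_eq_0:
  assumes "f \<in> ell2 X" "ell2_norm X f = 0" shows "f = (\<lambda>x. 0)"
  using cmod_le_ell2_norm[OF assms(1)] assms(2) by fastforce

lemma ell2_norm_scale: "ell2_norm X (\<lambda>x. c * f x) = cmod c * ell2_norm X f"
  by (simp add: ell2_norm_def norm_mult power_mult_distrib infsum_cmult_right' real_sqrt_mult)

lemma ell2_Cauchy_Schwarz:
  assumes f: "f \<in> ell2 X" and g: "g \<in> ell2 X"
  shows "cmod (ell2_inner X f g) \<le> ell2_norm X f * ell2_norm X g"
proof (cases "ell2_norm X f = 0 \<or> ell2_norm X g = 0")
  case True
  then have "f = (\<lambda>x. 0) \<or> g = (\<lambda>x. 0)"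
    using ell2_norm_eq_0 assms by blast
  then show ?thesis
    by (auto simp: ell2_inner_def ell2_norm_nonneg)
next
  case False
  define a b where "a = ell2_norm X f" and "b = ell2_norm X g"
  have ab: "a > 0" "b > 0"
    using False ell2_norm_nonneg[of X f] ell2_norm_nonneg[of X g] by (auto simp: a_def b_def)
  have "cmod (ell2_inner X f g) \<le> (\<Sum>\<^sub>\<infinity>x\<in>X. cmod (f x * cnj (g x)))"
    unfolding ell2_inner_def by (rule norm_infsum_bound[OF ell2_inner_abs_summable[OF assms]])
  also have "\<dots> = (\<Sum>\<^sub>\<infinity>x\<in>X. cmod (f x) * cmod (g x))"
    by (simp add: norm_mult)
  \<comment> \<open>the weights in the arithmetic-geometric mean are chosen such that both halves contribute \<open>a b / 2\<close>\<close>
  also have "\<dots> \<le> (\<Sum>\<^sub>\<infinity>x\<in>X. (b / a / 2) * (cmod (f x))\<^sup>2 + (a / b / 2) * (cmod (g x))\<^sup>2)"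
  proof (rule infsum_mono)
    show "(\<lambda>x. (b / a / 2) * (cmod (f x))\<^sup>2 + (a / b / 2) * (cmod (g x))\<^sup>2) summable_on X"
      by (intro summable_on_add summable_on_cmult_right ell2_summable assms)
    fix x
    have "0 \<le> (b * cmod (f x) - a * cmod (g x))\<^sup>2 / (a * b)"
      using ab by simp
    then show "cmod (f x) * cmod (g x)
        \<le> (b / a / 2) * (cmod (f x))\<^sup>2 + (a / b / 2) * (cmod (g x))\<^sup>2"
      using ab by (simp add: power2_diff field_simps power2_eq_square)
  qed (rule ell2_product_summable[OF assms])
  also have "\<dots> = (b / a / 2) * a\<^sup>2 + (a / b / 2) * b\<^sup>2"
    unfolding a_def b_def ell2_norm_square
    by (subst infsum_add)
       (intro summable_on_cmult_right ell2_summable assms, intro summable_on_cmult_right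
         ell2_summable assms, simp only: infsum_cmult_right')
  also have "\<dots> = a * b"
    using ab by (simp add: field_simps power2_eq_square)
  finally show ?thesis by (simp add: a_def b_def)
qed

lemma ell2_norm_add_square:
  assumes f: "f \<in> ell2 X" and g: "g \<in> ell2 X"
  shows "(ell2_norm X (\<lambda>x. f x + g x))\<^sup>2
    = (ell2_norm X f)\<^sup>2 + 2 * Re (ell2_inner X f g) + (ell2_norm X g)\<^sup>2"
proof -
  have eq: "(cmod (u + v))\<^sup>2 = (cmod u)\<^sup>2 + (2 * Re (u * cnj v) + (cmod v)\<^sup>2)" for u v
    by (simp add: cmod_power2 power2_sum)
  have s: "(\<lambda>x. Re (f x * cnj (g x))) summable_on X"
    by (rule summable_on_Re[OF ell2_inner_summable[OF assms]])
  have "(ell2_norm X (\<lambda>x. f x + g x))\<^sup>2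
    = (\<Sum>\<^sub>\<infinity>x\<in>X. (cmod (f x))\<^sup>2) + (\<Sum>\<^sub>\<infinity>x\<in>X. 2 * Re (f x * cnj (g x)) + (cmod (g x))\<^sup>2)"
    unfolding ell2_norm_square eq
    by (rule infsum_add) (intro ell2_summable summable_on_add summable_on_cmult_right s f g)+
  also have "(\<Sum>\<^sub>\<infinity>x\<in>X. 2 * Re (f x * cnj (g x)) + (cmod (g x))\<^sup>2)
    = (\<Sum>\<^sub>\<infinity>x\<in>X. 2 * Re (f x * cnj (g x))) + (\<Sum>\<^sub>\<infinity>x\<in>X. (cmod (g x))\<^sup>2)"
    by (rule infsum_add) (intro ell2_summable summable_on_cmult_right s g)+
  also have "(\<Sum>\<^sub>\<infinity>x\<in>X. 2 * Re (f x * cnj (g x))) = 2 * (\<Sum>\<^sub>\<infinity>x\<in>X. Re (f x * cnj (g x)))"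
    by (rule infsum_cmult_right')
  also have "(\<Sum>\<^sub>\<infinity>x\<in>X. Re (f x * cnj (g x))) = Re (ell2_inner X f g)"
    unfolding ell2_inner_def by (rule infsum_Re[OF ell2_inner_summable[OF assms]])
  finally show ?thesis by (simp add: ell2_norm_square)
qed

lemma ell2_norm_triangle:
  assumes f: "f \<in> ell2 X" and g: "g \<in> ell2 X"
  shows "ell2_norm X (\<lambda>x. f x + g x) \<le> ell2_norm X f + ell2_norm X g"
proof (rule power2_le_imp_le)
  have "Re (ell2_inner X f g) \<le> ell2_norm X f * ell2_norm X g"
    using ell2_Cauchy_Schwarz[OF assms] complex_Re_le_cmod order_trans by blast
  then show "(ell2_norm X (\<lambda>x. f x + g x))\<^sup>2 \<le> (ell2_norm X f + ell2_norm X g)\<^sup>2"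
    by (simp add: ell2_norm_add_square[OF assms] power2_sum)
qed (simp add: ell2_norm_nonneg)

lemma ell2_norm_diff_triangle:
  assumes f: "f \<in> ell2 X" and g: "g \<in> ell2 X"
  shows "ell2_norm X (\<lambda>x. f x - g x) \<le> ell2_norm X f + ell2_norm X g"
  using ell2_norm_triangle[OF f ell2_scale[OF g, of "-1"]] ell2_norm_scale[of X "-1" g]
  by simp

lemma ell2_norm_diff_square:
  assumes f: "f \<in> ell2 X" and g: "g \<in> ell2 X"
  shows "(ell2_norm X (\<lambda>x. f x - g x))\<^sup>2
    = (ell2_norm X f)\<^sup>2 - 2 * Re (ell2_inner X f g) + (ell2_norm X g)\<^sup>2"
proof -
  have "ell2_inner X f (\<lambda>x. (-1) * g x) = - ell2_inner X f g"
    by (simp add: ell2_inner_def infsum_uminus)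
  then show ?thesis
    using ell2_norm_add_square[OF f ell2_scale[OF g, of "-1"]] ell2_norm_scale[of X "-1" g]
    by simp
qed

lemma ell2_truncation_tendsto:
  assumes f: "f \<in> ell2 X"
  shows "((\<lambda>F. ell2_norm X (\<lambda>x. f x - (if x \<in> F then f x else 0))) \<longlongrightarrow> 0)
    (finite_subsets_at_top X)"
proof -
  let ?q = "\<lambda>x. (cmod (f x))\<^sup>2"
  have "((\<lambda>F. infsum ?q X - sum ?q F) \<longlongrightarrow> infsum ?q X - infsum ?q X) (finite_subsets_at_top X)"
    by (intro tendsto_intros) (use ell2_summable[OF f] in \<open>auto simp: has_sum_def[symmetric]\<close>)
  then have "((\<lambda>F. sqrt (infsum ?q X - sum ?q F)) \<longlongrightarrow> sqrt 0) (finite_subsets_at_top X)"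
    by (intro tendsto_real_sqrt) simp
  moreover have "\<forall>\<^sub>F F in finite_subsets_at_top X. sqrt (infsum ?q X - sum ?q F) =
     ell2_norm X (\<lambda>x. f x - (if x \<in> F then f x else 0))"
  proof (rule eventually_finite_subsets_at_top_weakI)
    fix F assume F: "finite F" "F \<subseteq> X"
    have "infsum ?q X = infsum ?q (F \<union> (X - F))"
      using F by (simp add: Un_absorb1)
    also have "\<dots> = infsum ?q F + infsum ?q (X - F)"
      by (intro infsum_Un_disjoint summable_on_subset_banach[OF ell2_summable[OF f]]) (use F in auto)
    finally have "infsum ?q X - sum ?q F = infsum ?q (X - F)"
      using F by simp
    also have "\<dots> = (\<Sum>\<^sub>\<infinity>x\<in>X. (cmod (f x - (if x \<in> F then f x else 0)))\<^sup>2)"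
      by (rule infsum_cong_neutral) auto
    finally show "sqrt (infsum ?q X - sum ?q F) =
       ell2_norm X (\<lambda>x. f x - (if x \<in> F then f x else 0))"
      by (simp add: ell2_norm_def)
  qed
  ultimately show ?thesis
    by (simp add: tendsto_cong)
qed

lemma ell2_truncation_eq_sum:
  assumes "finite F"
  shows "(\<lambda>y. if y \<in> F then f y else 0) = (\<lambda>y. \<Sum>x\<in>F. f x * delta x y)"
  using assms by (auto simp: delta_def sum.delta' if_distrib cong: if_cong)

lemma ell2_functional_finite_sum:
  fixes L :: "('a \<Rightarrow> complex) \<Rightarrow> complex"
  assumes add: "\<And>f g. f \<in> ell2 X \<Longrightarrow> g \<in> ell2 X \<Longrightarrow> L (\<lambda>x. f x + g x) = L f + L g"
    and scale: "\<And>c f. f \<in> ell2 X \<Longrightarrow> L (\<lambda>x. c * f x) = c * L f"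
    and "finite J" "\<And>j. j \<in> J \<Longrightarrow> v j \<in> ell2 X"
  shows "L (\<lambda>x. \<Sum>j\<in>J. c j * v j x) = (\<Sum>j\<in>J. c j * L (v j))"
  using assms(3,4)
proof (induction J)
  case empty
  then show ?case using scale[OF ell2_zero, of 0] by simp
next
  case (insert j J)
  have "L (\<lambda>x. c j * v j x + (\<Sum>j\<in>J. c j * v j x))
     = L (\<lambda>x. c j * v j x) + L (\<lambda>x. \<Sum>j\<in>J. c j * v j x)"
    by (intro add ell2_sum ell2_scale) (use insert in auto)
  then show ?case
    using insert scale by simp
qed

text \<open>
  A bounded linear functional is determined by its values on the basis vectors, since finite
  truncations converge in norm. Matrix entries and inner products of the image under a bounded
  operator are such functionals.
\<close>

lemma ell2_functional_has_sum:
  fixes L :: "('a \<Rightarrow> complex) \<Rightarrow> complex"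
  assumes add: "\<And>f g. f \<in> ell2 X \<Longrightarrow> g \<in> ell2 X \<Longrightarrow> L (\<lambda>x. f x + g x) = L f + L g"
    and scale: "\<And>c f. f \<in> ell2 X \<Longrightarrow> L (\<lambda>x. c * f x) = c * L f"
    and bound: "\<And>f. f \<in> ell2 X \<Longrightarrow> cmod (L f) \<le> C * ell2_norm X f"
    and f: "f \<in> ell2 X"
  shows "((\<lambda>x. f x * L (delta x)) has_sum L f) X"
proof -
  let ?t = "\<lambda>F x. if x \<in> F then f x else 0"
  have "((\<lambda>F. C * ell2_norm X (\<lambda>x. f x - ?t F x)) \<longlongrightarrow> 0) (finite_subsets_at_top X)"
    using tendsto_mult_right_zero[OF ell2_truncation_tendsto[OF f]] by blast
  moreover have "\<forall>\<^sub>F F in finite_subsets_at_top X.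
      norm ((\<Sum>x\<in>F. f x * L (delta x)) - L f) \<le> C * ell2_norm X (\<lambda>x. f x - ?t F x)"
  proof (rule eventually_finite_subsets_at_top_weakI)
    fix F assume F: "finite F" "F \<subseteq> X"
    have tF: "?t F \<in> ell2 X"
      by (rule ell2_restrict[OF f])
    have "L (?t F) = (\<Sum>x\<in>F. f x * L (delta x))"
      unfolding ell2_truncation_eq_sum[OF F(1)]
      by (rule ell2_functional_finite_sum[where X = X])
         (use F in \<open>auto simp: add scale intro: delta_ell2\<close>)
    moreover have "L f = L (\<lambda>x. f x - ?t F x) + L (?t F)"
      using add[OF ell2_diff[OF f tF] tF] by simp
    ultimately have "(\<Sum>x\<in>F. f x * L (delta x)) - L f = - L (\<lambda>x. f x - ?t F x)"
      by simp
    then show "norm ((\<Sum>x\<in>F. f x * L (delta x)) - L f) \<le> C * ell2_norm X (\<lambda>x. f x - ?t F x)"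
      using bound[OF ell2_diff[OF f tF]] by simp
  qed
  ultimately have "((\<lambda>F. (\<Sum>x\<in>F. f x * L (delta x)) - L f) \<longlongrightarrow> 0) (finite_subsets_at_top X)"
    by (rule Lim_null_comparison[rotated])
  then show ?thesis
    by (simp add: has_sum_def LIM_zero_iff)
qed


section \<open>Bounded operators and their adjoints\<close>

lemma bounded_opsI:
  assumes "\<And>f. f \<in> ell2 X \<Longrightarrow> t f \<in> ell2 X"
    and "\<And>f g. f \<in> ell2 X \<Longrightarrow> g \<in> ell2 X \<Longrightarrow> t (\<lambda>x. f x + g x) = (\<lambda>x. t f x + t g x)"
    and "\<And>c f. f \<in> ell2 X \<Longrightarrow> t (\<lambda>x. c * f x) = (\<lambda>x. c * t f x)"
    and "\<And>f. f \<in> ell2 X \<Longrightarrow> ell2_norm X (t f) \<le> C * ell2_norm X f"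
  shows "(\<lambda>f\<in>ell2 X. t f) \<in> bounded_ops X"
  using assms(1-3) exI[of "\<lambda>C. \<forall>f\<in>ell2 X. ell2_norm X (t f) \<le> C * ell2_norm X f" C] assms(4)
  unfolding bounded_ops_def by (simp add: ell2_add ell2_scale)

lemma bounded_ops_ell2: "T \<in> bounded_ops X \<Longrightarrow> f \<in> ell2 X \<Longrightarrow> T f \<in> ell2 X"
  by (auto simp: bounded_ops_def)

lemma bounded_ops_extensional: "T \<in> bounded_ops X \<Longrightarrow> T \<in> extensional (ell2 X)"
  by (auto simp: bounded_ops_def PiE_def)

lemma bounded_ops_add:
  "T \<in> bounded_ops X \<Longrightarrow> f \<in> ell2 X \<Longrightarrow> g \<in> ell2 X
    \<Longrightarrow> T (\<lambda>x. f x + g x) = (\<lambda>x. T f x + T g x)"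
  by (auto simp: bounded_ops_def)

lemma bounded_ops_scale:
  "T \<in> bounded_ops X \<Longrightarrow> f \<in> ell2 X \<Longrightarrow> T (\<lambda>x. c * f x) = (\<lambda>x. c * T f x)"
  by (auto simp: bounded_ops_def)

lemma bounded_ops_bound:
  assumes "T \<in> bounded_ops X"
  obtains C where "C \<ge> 0" "\<And>f. f \<in> ell2 X \<Longrightarrow> ell2_norm X (T f) \<le> C * ell2_norm X f"
proof -
  obtain C where C: "\<And>f. f \<in> ell2 X \<Longrightarrow> ell2_norm X (T f) \<le> C * ell2_norm X f"
    using assms unfolding bounded_ops_def by blast
  show ?thesis
  proof
    show "\<bar>C\<bar> \<ge> 0" by simp
    fix f assume "f \<in> ell2 X"
    then have "ell2_norm X (T f) \<le> C * ell2_norm X f" by (rule C)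
    also have "\<dots> \<le> \<bar>C\<bar> * ell2_norm X f"
      by (intro mult_right_mono ell2_norm_nonneg) simp
    finally show "ell2_norm X (T f) \<le> \<bar>C\<bar> * ell2_norm X f" .
  qed
qed

lemma bounded_op_expansion:
  assumes T: "T \<in> bounded_ops X" and f: "f \<in> ell2 X"
  shows "((\<lambda>x. f x * T (delta x) y) has_sum T f y) X"
proof -
  obtain C where C: "\<And>f. f \<in> ell2 X \<Longrightarrow> ell2_norm X (T f) \<le> C * ell2_norm X f"
    using bounded_ops_bound[OF T] by metis
  show ?thesis
  proof (rule ell2_functional_has_sum[where L = "\<lambda>f. T f y", OF _ _ _ f])
    fix f assume "f \<in> ell2 X"
    then show "cmod (T f y) \<le> C * ell2_norm X f"
      using cmod_le_ell2_norm[OF bounded_ops_ell2[OF T]] C order_trans by blast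
  qed (simp_all add: bounded_ops_add[OF T] bounded_ops_scale[OF T])
qed

lemma bounded_op_inner_expansion:
  assumes T: "T \<in> bounded_ops X" and f: "f \<in> ell2 X" and g: "g \<in> ell2 X"
  shows "((\<lambda>x. f x * ell2_inner X (T (delta x)) g) has_sum ell2_inner X (T f) g) X"
proof -
  obtain C where C: "\<And>f. f \<in> ell2 X \<Longrightarrow> ell2_norm X (T f) \<le> C * ell2_norm X f"
    using bounded_ops_bound[OF T] by metis
  show ?thesis
  proof (rule ell2_functional_has_sum[where L = "\<lambda>f. ell2_inner X (T f) g", OF _ _ _ f])
    fix f assume f: "f \<in> ell2 X"
    have "cmod (ell2_inner X (T f) g) \<le> ell2_norm X (T f) * ell2_norm X g"
      by (rule ell2_Cauchy_Schwarz[OF bounded_ops_ell2[OF T f] g])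
    also have "\<dots> \<le> (C * ell2_norm X f) * ell2_norm X g"
      by (intro mult_right_mono ell2_norm_nonneg C f)
    finally show "cmod (ell2_inner X (T f) g) \<le> (C * ell2_norm X g) * ell2_norm X f"
      by (simp add: mult_ac)
  qed (simp_all add: bounded_ops_add[OF T] bounded_ops_scale[OF T] ell2_inner_scale_left
        ell2_inner_add_left bounded_ops_ell2[OF T] g)
qed

lemma bounded_ops_eqI:
  assumes "S \<in> bounded_ops X" "T \<in> bounded_ops X"
    and "\<And>x. x \<in> X \<Longrightarrow> S (delta x) = T (delta x)"
  shows "S = T"
proof (rule extensionalityI[of _ "ell2 X"])
  fix f assume f: "f \<in> ell2 X"
  show "S f = T f"
  proof
    fix y
    have "((\<lambda>x. f x * T (delta x) y) has_sum S f y) X"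
      using bounded_op_expansion[OF assms(1) f, of y]
      by (rule has_sum_cong[THEN iffD1, rotated]) (simp add: assms(3))
    then show "S f y = T f y"
      using bounded_op_expansion[OF assms(2) f, of y] has_sum_unique by blast
  qed
qed (use assms bounded_ops_extensional in blast)+

text \<open>
  The entries of the adjoint are forced. That they are square-summable is seen by pairing \<open>g\<close> with
  the image of a truncation \<open>v\<close> of the candidate: this gives the square of the norm of \<open>v\<close>, which
  the bound on \<open>T\<close> compares with the norm of \<open>v\<close> itself.
\<close>

lemma adjoint_exists:
  assumes T: "T \<in> bounded_ops X"
  shows "\<exists>S\<in>bounded_ops X. \<forall>f\<in>ell2 X. \<forall>g\<in>ell2 X. ell2_inner X (T f) g = ell2_inner X f (S g)"
proof -
  obtain C where C: "C \<ge> 0" "\<And>f. f \<in> ell2 X \<Longrightarrow> ell2_norm X (T f) \<le> C * ell2_norm X f"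
    using bounded_ops_bound[OF T] by metis
  define s where "s g = (\<lambda>x. if x \<in> X then ell2_inner X g (T (delta x)) else 0)" for g
  have Td: "T (delta x) \<in> ell2 X" if "x \<in> X" for x
    using that by (intro bounded_ops_ell2[OF T] delta_ell2)
  have fin: "(\<Sum>x\<in>F. (cmod (s g x))\<^sup>2) \<le> (C * ell2_norm X g)\<^sup>2"
    if g: "g \<in> ell2 X" and F: "finite F" "F \<subseteq> X" for g F
  proof -
    define v where "v = (\<lambda>x. if x \<in> F then s g x else 0)"
    have v: "v \<in> ell2 X"
      by (rule ell2_finite_support[OF F]) (auto simp: v_def)
    have nv: "(ell2_norm X v)\<^sup>2 = (\<Sum>x\<in>F. (cmod (s g x))\<^sup>2)"
    proof -
      have "(\<Sum>\<^sub>\<infinity>x\<in>X. (cmod (v x))\<^sup>2) = (\<Sum>\<^sub>\<infinity>x\<in>F. (cmod (s g x))\<^sup>2)"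
        by (rule infsum_cong_neutral) (use F in \<open>auto simp: v_def\<close>)
      then show ?thesis using F by (simp add: ell2_norm_square)
    qed
    have "ell2_inner X (T v) g = (\<Sum>\<^sub>\<infinity>x\<in>X. v x * ell2_inner X (T (delta x)) g)"
      using bounded_op_inner_expansion[OF T v g] by (simp add: infsumI)
    also have "\<dots> = (\<Sum>\<^sub>\<infinity>x\<in>F. of_real ((cmod (s g x))\<^sup>2))"
    proof (rule infsum_cong_neutral)
      fix x assume x: "x \<in> X \<inter> F"
      then have "ell2_inner X (T (delta x)) g = cnj (s g x)"
        using ell2_inner_commute[of X "T (delta x)" g] by (simp add: s_def)
      then show "v x * ell2_inner X (T (delta x)) g = of_real ((cmod (s g x))\<^sup>2)"
        using x by (simp only: v_def complex_norm_square IntD2 if_True)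
    qed (use F in \<open>auto simp: v_def\<close>)
    finally have "ell2_inner X (T v) g = of_real ((ell2_norm X v)\<^sup>2)"
      using F nv by (simp add: flip: of_real_power)
    then have "(ell2_norm X v)\<^sup>2 = cmod (ell2_inner X (T v) g)"
      by (simp add: flip: of_real_power)
    also have "\<dots> \<le> ell2_norm X (T v) * ell2_norm X g"
      by (rule ell2_Cauchy_Schwarz[OF bounded_ops_ell2[OF T v] g])
    also have "\<dots> \<le> (C * ell2_norm X v) * ell2_norm X g"
      by (intro mult_right_mono ell2_norm_nonneg C v)
    finally have "ell2_norm X v * ell2_norm X v \<le> ell2_norm X v * (C * ell2_norm X g)"
      by (simp add: power2_eq_square mult_ac)
    then have "ell2_norm X v \<le> C * ell2_norm X g"
      using ell2_norm_nonneg[of X v] C(1) ell2_norm_nonneg[of X g]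
      by (cases "ell2_norm X v = 0") (auto simp: mult_le_cancel_left)
    then have "(ell2_norm X v)\<^sup>2 \<le> (C * ell2_norm X g)\<^sup>2"
      by (intro power_mono ell2_norm_nonneg)
    then show ?thesis by (simp add: nv)
  qed
  have s_ell2: "s g \<in> ell2 X" if g: "g \<in> ell2 X" for g
  proof -
    have "(\<lambda>x. (cmod (s g x))\<^sup>2) summable_on X"
      by (rule nonneg_bdd_above_summable_on) (use fin[OF g] in \<open>auto intro!: bdd_aboveI\<close>)
    then show ?thesis by (auto simp: ell2_def s_def)
  qed
  define S where "S = (\<lambda>g\<in>ell2 X. s g)"
  have "S \<in> bounded_ops X"
    unfolding S_def
  proof (rule bounded_opsI[where C = C])
    fix g assume g: "g \<in> ell2 X"
    have "(\<Sum>\<^sub>\<infinity>x\<in>X. (cmod (s g x))\<^sup>2) \<le> (C * ell2_norm X g)\<^sup>2"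
      by (rule infsum_le_finite_sums[OF ell2_summable[OF s_ell2[OF g]]]) (use fin[OF g] in auto)
    then show "ell2_norm X (s g) \<le> C * ell2_norm X g"
      unfolding ell2_norm_square[of X "s g", symmetric]
      by (rule power2_le_imp_le) (intro mult_nonneg_nonneg C(1) ell2_norm_nonneg)
  next
    fix f g assume "f \<in> ell2 X" "g \<in> ell2 X"
    then show "s (\<lambda>x. f x + g x) = (\<lambda>x. s f x + s g x)"
      by (simp add: s_def fun_eq_iff ell2_inner_add_left Td)
  next
    fix c f
    show "s (\<lambda>x. c * f x) = (\<lambda>x. c * s f x)"
      by (simp add: s_def fun_eq_iff ell2_inner_scale_left)
  qed (rule s_ell2)
  moreover have "ell2_inner X (T f) g = ell2_inner X f (S g)" if f: "f \<in> ell2 X" and g: "g \<in> ell2 X" for f g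
  proof -
    have "ell2_inner X (T f) g = (\<Sum>\<^sub>\<infinity>x\<in>X. f x * ell2_inner X (T (delta x)) g)"
      using bounded_op_inner_expansion[OF T f g] by (simp add: infsumI)
    also have "\<dots> = (\<Sum>\<^sub>\<infinity>x\<in>X. f x * cnj (s g x))"
      by (rule infsum_cong) (simp add: s_def flip: ell2_inner_commute)
    finally show ?thesis using g by (simp add: S_def ell2_inner_def)
  qed
  ultimately show ?thesis by blast
qed

lemma op_adjoint_unique:
  assumes "S \<in> bounded_ops X"
    and adj: "\<And>f g. f \<in> ell2 X \<Longrightarrow> g \<in> ell2 X \<Longrightarrow> ell2_inner X (T f) g = ell2_inner X f (S g)"
  shows "op_adjoint X T = S"
  unfolding op_adjoint_def
proof (rule the_equality)
  fix R assume R: "R \<in> bounded_ops X \<and>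
     (\<forall>f\<in>ell2 X. \<forall>g\<in>ell2 X. ell2_inner X (T f) g = ell2_inner X f (R g))"
  show "R = S"
  proof (rule extensionalityI[of _ "ell2 X"])
    fix g assume g: "g \<in> ell2 X"
    have Rg: "R g \<in> ell2 X" and Sg: "S g \<in> ell2 X"
      using R assms(1) g bounded_ops_ell2 by blast+
    show "R g = S g"
    proof
      fix x
      show "R g x = S g x"
      proof (cases "x \<in> X")
        case True
        then have "ell2_inner X (delta x) (R g) = ell2_inner X (delta x) (S g)"
          using R adj g delta_ell2 by metis
        then have "ell2_inner X (R g) (delta x) = ell2_inner X (S g) (delta x)"
          using ell2_inner_commute by metis
        then show ?thesis
          using ell2_inner_delta True Rg Sg by metis
      qed (simp add: ell2_outside[OF Rg] ell2_outside[OF Sg])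
    qed
  qed (use R assms(1) bounded_ops_extensional in blast)+
qed (use assms in auto)

lemma
  assumes "T \<in> bounded_ops X"
  shows op_adjoint_bounded: "op_adjoint X T \<in> bounded_ops X"
    and op_adjoint_inner: "f \<in> ell2 X \<Longrightarrow> g \<in> ell2 X
      \<Longrightarrow> ell2_inner X (T f) g = ell2_inner X f (op_adjoint X T g)"
  using adjoint_exists[OF assms] op_adjoint_unique by metis+

lemma op_adjoint_inner':
  assumes "T \<in> bounded_ops X" "f \<in> ell2 X" "g \<in> ell2 X"
  shows "ell2_inner X (op_adjoint X T f) g = ell2_inner X f (T g)"
  using op_adjoint_inner[OF assms(1,3,2)] ell2_inner_commute by metis

lemma op_adjoint_entry:
  assumes "T \<in> bounded_ops X" "x \<in> X" "y \<in> X"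
  shows "op_adjoint X T (delta x) y = cnj (T (delta y) x)"
proof -
  have "op_adjoint X T (delta x) y = ell2_inner X (op_adjoint X T (delta x)) (delta y)"
    using ell2_inner_delta[OF bounded_ops_ell2[OF op_adjoint_bounded[OF assms(1)]
      delta_ell2[OF assms(2)]] assms(3)] by (rule sym)
  also have "\<dots> = ell2_inner X (delta x) (T (delta y))"
    by (intro op_adjoint_inner' delta_ell2 assms)
  also have "\<dots> = cnj (T (delta y) x)"
    using ell2_inner_commute[of X "delta x"]
      ell2_inner_delta[OF bounded_ops_ell2[OF assms(1) delta_ell2[OF assms(3)]] assms(2)] by simp
  finally show ?thesis .
qed

lemma op_mult_apply: "f \<in> ell2 X \<Longrightarrow> op_mult X S T f = S (T f)"
  by (simp add: op_mult_def compose_eq)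

lemma op_one_apply: "f \<in> ell2 X \<Longrightarrow> op_one X f = f"
  by (simp add: op_one_def)

lemma op_mult_bounded:
  assumes S: "S \<in> bounded_ops X" and T: "T \<in> bounded_ops X"
  shows "op_mult X S T \<in> bounded_ops X"
proof -
  obtain C where C: "C \<ge> 0" "\<And>f. f \<in> ell2 X \<Longrightarrow> ell2_norm X (S f) \<le> C * ell2_norm X f"
    using bounded_ops_bound[OF S] by metis
  obtain D where D: "D \<ge> 0" "\<And>f. f \<in> ell2 X \<Longrightarrow> ell2_norm X (T f) \<le> D * ell2_norm X f"
    using bounded_ops_bound[OF T] by metis
  note ST = bounded_ops_ell2[OF S] bounded_ops_ell2[OF T]
  have "(\<lambda>f\<in>ell2 X. S (T f)) \<in> bounded_ops X"
  proof (rule bounded_opsI[where C = "C * D"])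
    fix f assume f: "f \<in> ell2 X"
    have "ell2_norm X (S (T f)) \<le> C * ell2_norm X (T f)"
      by (intro C ST f)
    also have "\<dots> \<le> C * (D * ell2_norm X f)"
      by (intro mult_left_mono C D f)
    finally show "ell2_norm X (S (T f)) \<le> C * D * ell2_norm X f"
      by (simp add: mult_ac)
  qed (simp_all add: ST bounded_ops_add[OF T] bounded_ops_add[OF S]
        bounded_ops_scale[OF T] bounded_ops_scale[OF S])
  then show ?thesis
    by (simp add: op_mult_def compose_def)
qed

lemma op_one_bounded: "op_one X \<in> bounded_ops X"
  unfolding op_one_def by (rule bounded_opsI[where C = 1]) auto

lemma op_minus_bounded:
  assumes S: "S \<in> bounded_ops X" and T: "T \<in> bounded_ops X"
  shows "op_minus X S T \<in> bounded_ops X"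
proof -
  obtain C where C: "C \<ge> 0" "\<And>f. f \<in> ell2 X \<Longrightarrow> ell2_norm X (S f) \<le> C * ell2_norm X f"
    using bounded_ops_bound[OF S] by metis
  obtain D where D: "D \<ge> 0" "\<And>f. f \<in> ell2 X \<Longrightarrow> ell2_norm X (T f) \<le> D * ell2_norm X f"
    using bounded_ops_bound[OF T] by metis
  note ST = bounded_ops_ell2[OF S] bounded_ops_ell2[OF T]
  show ?thesis
    unfolding op_minus_def
  proof (rule bounded_opsI[where C = "C + D"])
    fix f assume f: "f \<in> ell2 X"
    have "ell2_norm X (\<lambda>x. S f x - T f x) \<le> ell2_norm X (S f) + ell2_norm X (T f)"
      by (intro ell2_norm_diff_triangle ST f)
    also have "\<dots> \<le> C * ell2_norm X f + D * ell2_norm X f"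
      by (intro add_mono C D f)
    finally show "ell2_norm X (\<lambda>x. S f x - T f x) \<le> (C + D) * ell2_norm X f"
      by (simp add: algebra_simps)
  qed (auto simp: ST bounded_ops_add[OF T] bounded_ops_add[OF S]
        bounded_ops_scale[OF T] bounded_ops_scale[OF S] ell2_diff algebra_simps)
qed

section \<open>Unitary operators\<close>

lemma unitary_op_bounded: "unitary_op X U \<Longrightarrow> U \<in> bounded_ops X"
  by (simp add: unitary_op_def)

lemma unitary_op_inner:
  assumes U: "unitary_op X U" and f: "f \<in> ell2 X" and g: "g \<in> ell2 X"
  shows "ell2_inner X (U f) (U g) = ell2_inner X f g"
proof -
  have "op_mult X (op_adjoint X U) U g = op_one X g"
    using U by (simp add: unitary_op_def)
  then have "op_adjoint X U (U g) = g"
    using g by (simp add: op_mult_apply op_one_apply)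
  then show ?thesis
    using op_adjoint_inner[OF unitary_op_bounded[OF U] f bounded_ops_ell2[OF unitary_op_bounded[OF U] g]]
    by simp
qed

lemma unitary_op_norm:
  assumes U: "unitary_op X U" and f: "f \<in> ell2 X"
  shows "ell2_norm X (U f) = ell2_norm X f"
proof -
  have "(ell2_norm X (U f))\<^sup>2 = (ell2_norm X f)\<^sup>2"
    using unitary_op_inner[OF U f f] ell2_inner_self[OF f]
      ell2_inner_self[OF bounded_ops_ell2[OF unitary_op_bounded[OF U] f]]
    by (metis of_real_eq_iff)
  then show ?thesis
    by (simp add: ell2_norm_nonneg)
qed

lemma unitary_opI:
  assumes U: "U \<in> bounded_ops X" and V: "V \<in> bounded_ops X"
    and adj: "\<And>f g. f \<in> ell2 X \<Longrightarrow> g \<in> ell2 X \<Longrightarrow> ell2_inner X (U f) g = ell2_inner X f (V g)"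
    and VU: "\<And>f. f \<in> ell2 X \<Longrightarrow> V (U f) = f"
    and UV: "\<And>f. f \<in> ell2 X \<Longrightarrow> U (V f) = f"
  shows "unitary_op X U"
proof -
  have "op_adjoint X U = V"
    by (rule op_adjoint_unique[OF V adj])
  moreover have "op_mult X V U = op_one X" "op_mult X U V = op_one X"
    by (auto simp: op_mult_def op_one_def compose_def VU UV)
  ultimately show ?thesis
    using U by (simp add: unitary_op_def)
qed

lemma unitary_op_adjoint_cancel:
  assumes U: "unitary_op X U" and f: "f \<in> ell2 X"
  shows "op_adjoint X U (U f) = f" "U (op_adjoint X U f) = f"
proof -
  have "op_mult X (op_adjoint X U) U f = f" "op_mult X U (op_adjoint X U) f = f"
    using U f by (simp_all add: unitary_op_def op_one_apply)
  then show "op_adjoint X U (U f) = f" "U (op_adjoint X U f) = f"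
    using f by (simp_all add: op_mult_apply)
qed

lemma unitary_op_one: "unitary_op X (op_one X)"
  by (rule unitary_opI[of _ _ "op_one X"]) (auto simp: op_one_bounded op_one_apply)

lemma unitary_op_mult:
  assumes U: "unitary_op X U" and V: "unitary_op X V"
  shows "unitary_op X (op_mult X U V)"
proof -
  note b = unitary_op_bounded[OF U] unitary_op_bounded[OF V]
  note b = b op_adjoint_bounded[OF b(1)] op_adjoint_bounded[OF b(2)]
  note e = bounded_ops_ell2[OF b(1)] bounded_ops_ell2[OF b(2)]
    bounded_ops_ell2[OF b(3)] bounded_ops_ell2[OF b(4)]
  show ?thesis
    by (rule unitary_opI[of _ _ "op_mult X (op_adjoint X V) (op_adjoint X U)"])
       (simp_all add: op_mult_bounded b op_mult_apply e unitary_op_adjoint_cancel[OF U]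
         unitary_op_adjoint_cancel[OF V] op_adjoint_inner)
qed

lemma op_eq_oneI:
  assumes R: "R \<in> bounded_ops X"
    and entry: "\<And>x y. x \<in> X \<Longrightarrow> y \<in> X \<Longrightarrow> ell2_inner X (R (delta x)) (delta y) = delta x y"
  shows "R = op_one X"
proof (rule bounded_ops_eqI[OF R op_one_bounded])
  fix x assume x: "x \<in> X"
  note Rx = bounded_ops_ell2[OF R delta_ell2[OF x]]
  show "R (delta x) = op_one X (delta x)"
  proof
    fix y
    show "R (delta x) y = op_one X (delta x) y"
      using entry[OF x, of y] ell2_inner_delta[OF Rx, of y] ell2_outside[OF Rx, of y] x
      unfolding op_one_apply[OF delta_ell2[OF x]] by (cases "y \<in> X") (auto simp: delta_def)
  qed
qed

lemma adjoint_mult_if_orthonormal_columns: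
  assumes T: "T \<in> bounded_ops X"
    and columns: "\<And>x x'. x \<in> X \<Longrightarrow> x' \<in> X \<Longrightarrow> ell2_inner X (T (delta x)) (T (delta x')) = delta x x'"
  shows "op_mult X (op_adjoint X T) T = op_one X"
proof (rule op_eq_oneI)
  let ?S = "op_adjoint X T"
  fix x y assume xy: "x \<in> X" "y \<in> X"
  have "ell2_inner X (?S (T (delta x))) (delta y) = ell2_inner X (T (delta x)) (T (delta y))"
    by (intro op_adjoint_inner' T bounded_ops_ell2[OF T] delta_ell2 xy)
  then show "ell2_inner X (op_mult X ?S T (delta x)) (delta y) = delta x y"
    using columns[OF xy] xy by (simp add: op_mult_apply delta_ell2)
qed (rule op_mult_bounded[OF op_adjoint_bounded[OF T] T])

lemma norm_if_orthonormal_columns: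
  assumes T: "T \<in> bounded_ops X"
    and columns: "\<And>x x'. x \<in> X \<Longrightarrow> x' \<in> X \<Longrightarrow> ell2_inner X (T (delta x)) (T (delta x')) = delta x x'"
    and f: "f \<in> ell2 X"
  shows "ell2_norm X (T f) = ell2_norm X f"
proof -
  note Tf = bounded_ops_ell2[OF T f]
  have "op_adjoint X T (T f) = f"
    using adjoint_mult_if_orthonormal_columns[OF T columns] op_mult_apply[OF f] op_one_apply[OF f]
    by metis
  then have "ell2_inner X (T f) (T f) = ell2_inner X f f"
    using op_adjoint_inner[OF T f Tf] by simp
  then have "(ell2_norm X (T f))\<^sup>2 = (ell2_norm X f)\<^sup>2"
    unfolding ell2_inner_self[OF f] ell2_inner_self[OF Tf] of_real_eq_iff .
  then show ?thesis
    by (simp add: ell2_norm_nonneg)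
qed

lemma unitary_op_if_orthonormal:
  assumes T: "T \<in> bounded_ops X"
    and columns: "\<And>x x'. x \<in> X \<Longrightarrow> x' \<in> X \<Longrightarrow> ell2_inner X (T (delta x)) (T (delta x')) = delta x x'"
    and rows: "\<And>y y'. y \<in> X \<Longrightarrow> y' \<in> X
      \<Longrightarrow> (\<Sum>\<^sub>\<infinity>x\<in>X. cnj (T (delta x) y) * T (delta x) y') = delta y y'"
  shows "unitary_op X T"
proof -
  let ?S = "op_adjoint X T"
  have S: "?S \<in> bounded_ops X" by (rule op_adjoint_bounded[OF T])
  have "op_mult X T ?S = op_one X"
  proof (rule op_eq_oneI)
    fix x y assume xy: "x \<in> X" "y \<in> X"
    have "ell2_inner X (T (?S (delta x))) (delta y) = ell2_inner X (?S (delta x)) (?S (delta y))"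
      by (intro op_adjoint_inner T bounded_ops_ell2[OF S] delta_ell2 xy)
    also have "\<dots> = (\<Sum>\<^sub>\<infinity>z\<in>X. cnj (T (delta z) x) * T (delta z) y)"
      unfolding ell2_inner_def
      by (rule infsum_cong) (simp add: op_adjoint_entry[OF T] xy)
    finally show "ell2_inner X (op_mult X T ?S (delta x)) (delta y) = delta x y"
      using rows[OF xy] xy by (simp add: op_mult_apply delta_ell2)
  qed (rule op_mult_bounded[OF T S])
  then show ?thesis
    using T adjoint_mult_if_orthonormal_columns[OF T columns] by (simp add: unitary_op_def)
qed

text \<open>
  On finitely supported functions the prescribed columns define an isometry. For the other functions
  the series converge pointwise, because the rows are square-summable, and the bound passes to the
  limit on every finite set of coordinates.
\<close>

lemma isometry_of_orthonormal_columns: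
  assumes v: "\<And>x. x \<in> X \<Longrightarrow> v x \<in> ell2 X"
    and row: "\<And>y. y \<in> X \<Longrightarrow> (\<lambda>x. if x \<in> X then cnj (v x y) else 0) \<in> ell2 X"
    and columns: "\<And>x x'. x \<in> X \<Longrightarrow> x' \<in> X \<Longrightarrow> ell2_inner X (v x) (v x') = delta x x'"
  defines "T \<equiv> \<lambda>f\<in>ell2 X. \<lambda>y. if y \<in> X then \<Sum>\<^sub>\<infinity>x\<in>X. f x * v x y else 0"
  shows "T \<in> bounded_ops X" and "x \<in> X \<Longrightarrow> T (delta x) = v x"
proof -
  define t where "t f = (\<lambda>y. if y \<in> X then \<Sum>\<^sub>\<infinity>x\<in>X. f x * v x y else 0)" for f
  have sm: "(\<lambda>x. f x * v x y) summable_on X" if "f \<in> ell2 X" "y \<in> X" for f y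
  proof -
    have "(\<lambda>x. f x * cnj (if x \<in> X then cnj (v x y) else 0)) summable_on X"
      by (rule ell2_inner_summable[OF that(1) row[OF that(2)]])
    then show ?thesis
      by (rule summable_on_cong[THEN iffD1, rotated]) simp
  qed
  have t_delta: "t (delta x) = v x" if "x \<in> X" for x
  proof
    fix y
    have "(\<Sum>\<^sub>\<infinity>z\<in>X. delta x z * v z y) = (\<Sum>\<^sub>\<infinity>z\<in>{x}. v z y)"
      by (rule infsum_cong_neutral) (use that in \<open>auto simp: delta_def\<close>)
    then show "t (delta x) y = v x y"
      using ell2_outside[OF v[OF that]] by (auto simp: t_def)
  qed
  have fin: "(\<Sum>y\<in>Y. (cmod (t f y))\<^sup>2) \<le> (ell2_norm X f)\<^sup>2"
    if f: "f \<in> ell2 X" and Y: "finite Y" "Y \<subseteq> X" for f Y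
  proof -
    have "((\<lambda>F. \<Sum>y\<in>Y. (cmod (\<Sum>x\<in>F. f x * v x y))\<^sup>2) \<longlongrightarrow> (\<Sum>y\<in>Y. (cmod (t f y))\<^sup>2))
      (finite_subsets_at_top X)"
    proof (intro tendsto_intros)
      fix y assume "y \<in> Y"
      then have "y \<in> X" using Y by auto
      then have "((\<lambda>x. f x * v x y) has_sum t f y) X"
        using has_sum_infsum[OF sm[OF f \<open>y \<in> X\<close>]] by (simp add: t_def)
      then show "((\<lambda>F. \<Sum>x\<in>F. f x * v x y) \<longlongrightarrow> t f y) (finite_subsets_at_top X)"
        by (simp add: has_sum_def)
    qed
    moreover have "\<forall>\<^sub>F F in finite_subsets_at_top X.
       (\<Sum>y\<in>Y. (cmod (\<Sum>x\<in>F. f x * v x y))\<^sup>2) \<le> (ell2_norm X f)\<^sup>2"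
    proof (rule eventually_finite_subsets_at_top_weakI)
      fix F assume F: "finite F" "F \<subseteq> X"
      define w where "w = (\<lambda>y. \<Sum>x\<in>F. f x * v x y)"
      have w: "w \<in> ell2 X"
        unfolding w_def by (intro ell2_sum F ell2_scale v) (use F in auto)
      have inner_v: "ell2_inner X (v x) w = cnj (f x)" if x: "x \<in> F" for x
      proof -
        have "ell2_inner X w (v x) = (\<Sum>x'\<in>F. ell2_inner X (\<lambda>y. f x' * v x' y) (v x))"
          unfolding w_def by (rule ell2_inner_sum_left) (use F x in \<open>auto intro: ell2_scale v\<close>)
        also have "\<dots> = (\<Sum>x'\<in>F. f x' * delta x' x)"
          using F x by (intro sum.cong) (auto simp: ell2_inner_scale_left columns subset_iff)
        also have "\<dots> = f x"
          using F x by (simp add: delta_def if_distrib cong: if_cong)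
        finally show ?thesis using ell2_inner_commute[of X "v x" w] by simp
      qed
      have "ell2_inner X w w = (\<Sum>x\<in>F. ell2_inner X (\<lambda>y. f x * v x y) w)"
        by (subst (1) w_def, rule ell2_inner_sum_left) (use F w in \<open>auto intro: ell2_scale v\<close>)
      also have "\<dots> = (\<Sum>x\<in>F. of_real ((cmod (f x))\<^sup>2))"
        using inner_v by (intro sum.cong) (simp_all only: ell2_inner_scale_left complex_norm_square)
      finally have "(ell2_norm X w)\<^sup>2 = (\<Sum>x\<in>F. (cmod (f x))\<^sup>2)"
        unfolding ell2_inner_self[OF w] of_real_sum[symmetric] of_real_eq_iff .
      moreover have "(\<Sum>x\<in>F. (cmod (f x))\<^sup>2) \<le> (ell2_norm X f)\<^sup>2"
        unfolding ell2_norm_square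
        by (rule finite_sum_le_infsum) (use F in \<open>auto simp: ell2_summable[OF f]\<close>)
      moreover have "(\<Sum>y\<in>Y. (cmod (w y))\<^sup>2) \<le> (ell2_norm X w)\<^sup>2"
        unfolding ell2_norm_square
        by (rule finite_sum_le_infsum) (use Y in \<open>auto simp: ell2_summable[OF w]\<close>)
      ultimately show "(\<Sum>y\<in>Y. (cmod (\<Sum>x\<in>F. f x * v x y))\<^sup>2) \<le> (ell2_norm X f)\<^sup>2"
        by (simp add: w_def)
    qed
    ultimately show ?thesis
      by (rule tendsto_upperbound) simp
  qed
  have t_ell2: "t f \<in> ell2 X" if f: "f \<in> ell2 X" for f
  proof -
    have "(\<lambda>x. (cmod (t f x))\<^sup>2) summable_on X"
      by (rule nonneg_bdd_above_summable_on) (use fin[OF f] in \<open>auto intro!: bdd_aboveI\<close>)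
    then show ?thesis by (auto simp: ell2_def t_def)
  qed
  show "T \<in> bounded_ops X"
    unfolding T_def t_def[symmetric]
  proof (rule bounded_opsI[where C = 1])
    fix f assume f: "f \<in> ell2 X"
    have "(\<Sum>\<^sub>\<infinity>x\<in>X. (cmod (t f x))\<^sup>2) \<le> (ell2_norm X f)\<^sup>2"
      by (rule infsum_le_finite_sums[OF ell2_summable[OF t_ell2[OF f]]]) (use fin[OF f] in auto)
    then show "ell2_norm X (t f) \<le> 1 * ell2_norm X f"
      unfolding ell2_norm_square[of X "t f", symmetric] mult_1
      by (rule power2_le_imp_le) (rule ell2_norm_nonneg)
  next
    fix f g assume "f \<in> ell2 X" "g \<in> ell2 X"
    then show "t (\<lambda>x. f x + g x) = (\<lambda>x. t f x + t g x)"
      by (auto simp: t_def distrib_right infsum_add sm)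
  next
    fix c f assume "f \<in> ell2 X"
    then show "t (\<lambda>x. c * f x) = (\<lambda>x. c * t f x)"
      by (auto simp: t_def mult.assoc infsum_cmult_right')
  qed (rule t_ell2)
  show "T (delta x) = v x" if "x \<in> X"
    using t_delta[OF that] that by (simp add: T_def t_def delta_ell2)
qed

lemma strong_convergence_from_basis:
  fixes D :: "nat \<Rightarrow> 'a ell2_op"
  assumes add: "\<And>n f g. f \<in> ell2 X \<Longrightarrow> g \<in> ell2 X \<Longrightarrow> D n (\<lambda>x. f x + g x) = (\<lambda>x. D n f x + D n g x)"
    and scale: "\<And>n c f. f \<in> ell2 X \<Longrightarrow> D n (\<lambda>x. c * f x) = (\<lambda>x. c * D n f x)"
    and ell2: "\<And>n f. f \<in> ell2 X \<Longrightarrow> D n f \<in> ell2 X"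
    and bound: "\<And>n f. f \<in> ell2 X \<Longrightarrow> ell2_norm X (D n f) \<le> C * ell2_norm X f"
    and basis: "\<And>x. x \<in> X \<Longrightarrow> (\<lambda>n. ell2_norm X (D n (delta x))) \<longlonglongrightarrow> 0"
    and f: "f \<in> ell2 X"
  shows "(\<lambda>n. ell2_norm X (D n f)) \<longlonglongrightarrow> 0"
proof (rule LIMSEQ_I)
  fix \<epsilon> :: real assume "\<epsilon> > 0"
  let ?t = "\<lambda>F x. if x \<in> F then f x else 0"
  have "((\<lambda>F. C * ell2_norm X (\<lambda>x. f x - ?t F x)) \<longlongrightarrow> 0) (finite_subsets_at_top X)"
    using tendsto_mult_right_zero[OF ell2_truncation_tendsto[OF f]] by blast
  then have "\<forall>\<^sub>F F in finite_subsets_at_top X. C * ell2_norm X (\<lambda>x. f x - ?t F x) < \<epsilon> / 2"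
    using \<open>\<epsilon> > 0\<close> by (intro order_tendstoD) auto
  then obtain F where F: "finite F" "F \<subseteq> X" "C * ell2_norm X (\<lambda>x. f x - ?t F x) < \<epsilon> / 2"
    by (auto simp: eventually_finite_subsets_at_top)
  have sum_bound: "ell2_norm X (D n (\<lambda>y. \<Sum>x\<in>F'. f x * delta x y))
      \<le> (\<Sum>x\<in>F'. cmod (f x) * ell2_norm X (D n (delta x)))"
    if "finite F'" "F' \<subseteq> X" for n F'
    using that
  proof (induction F')
    case empty
    then show ?case using bound[OF ell2_zero] by (simp add: ell2_norm_def)
  next
    case (insert x F')
    have e: "(\<lambda>y. f x * delta x y) \<in> ell2 X" "(\<lambda>y. \<Sum>x\<in>F'. f x * delta x y) \<in> ell2 X"
      using insert by (auto intro!: ell2_scale ell2_sum delta_ell2)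
    have "ell2_norm X (D n (\<lambda>y. \<Sum>x\<in>insert x F'. f x * delta x y))
      \<le> ell2_norm X (D n (\<lambda>y. f x * delta x y)) + ell2_norm X (D n (\<lambda>y. \<Sum>x\<in>F'. f x * delta x y))"
      using ell2_norm_triangle[OF ell2[OF e(1)] ell2[OF e(2)], of n n] insert add[OF e] by simp
    moreover have "ell2_norm X (D n (\<lambda>y. f x * delta x y)) = cmod (f x) * ell2_norm X (D n (delta x))"
      using insert by (simp add: scale delta_ell2 ell2_norm_scale)
    ultimately show ?case using insert by simp
  qed
  have "(\<lambda>n. \<Sum>x\<in>F. cmod (f x) * ell2_norm X (D n (delta x))) \<longlonglongrightarrow> 0"
    by (intro tendsto_null_sum tendsto_mult_right_zero basis) (use F in auto)
  then have "\<forall>\<^sub>F n in sequentially. (\<Sum>x\<in>F. cmod (f x) * ell2_norm X (D n (delta x))) < \<epsilon> / 2"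
    using \<open>\<epsilon> > 0\<close> by (intro order_tendstoD) auto
  then obtain N where N: "\<And>n. n \<ge> N \<Longrightarrow> (\<Sum>x\<in>F. cmod (f x) * ell2_norm X (D n (delta x))) < \<epsilon> / 2"
    by (auto simp: eventually_sequentially)
  have tF: "?t F \<in> ell2 X" by (rule ell2_restrict[OF f])
  note fF = ell2_diff[OF f tF]
  show "\<exists>N. \<forall>n\<ge>N. norm (ell2_norm X (D n f) - 0) < \<epsilon>"
  proof (intro exI allI impI)
    fix n assume "n \<ge> N"
    have "ell2_norm X (D n f) \<le> ell2_norm X (D n (\<lambda>x. f x - ?t F x)) + ell2_norm X (D n (?t F))"
      using ell2_norm_triangle[OF ell2[OF fF] ell2[OF tF], of n n] add[OF fF tF] by simp
    moreover have "ell2_norm X (D n (\<lambda>x. f x - ?t F x)) < \<epsilon> / 2"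
      using bound[OF fF, of n] F by simp
    moreover have "ell2_norm X (D n (?t F)) < \<epsilon> / 2"
      using sum_bound[OF F(1,2), of n] N[OF \<open>n \<ge> N\<close>] ell2_truncation_eq_sum[OF F(1), of f] by simp
    ultimately show "norm (ell2_norm X (D n f) - 0) < \<epsilon>"
      by (simp add: ell2_norm_nonneg)
  qed
qed


section \<open>The group von Neumann algebra\<close>

lemma ell2_reindex:
  assumes h: "bij_betw h X X" and f: "f \<in> ell2 X"
  defines "f' \<equiv> (\<lambda>x. if x \<in> X then f (h x) else 0)"
  shows "f' \<in> ell2 X" and "ell2_norm X f' = ell2_norm X f"
proof -
  have "(\<lambda>x. (cmod (f (h x)))\<^sup>2) summable_on X"
    using summable_on_reindex_bij_betw[OF h, of "\<lambda>x. (cmod (f x))\<^sup>2"] ell2_summable[OF f] by blast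
  then have "(\<lambda>x. (cmod (f' x))\<^sup>2) summable_on X"
    by (rule summable_on_cong[THEN iffD1, rotated]) (simp add: f'_def)
  then show "f' \<in> ell2 X"
    by (auto simp: ell2_def f'_def)
  have "(\<Sum>\<^sub>\<infinity>x\<in>X. (cmod (f' x))\<^sup>2) = (\<Sum>\<^sub>\<infinity>x\<in>X. (cmod (f (h x)))\<^sup>2)"
    by (rule infsum_cong) (simp add: f'_def)
  also have "\<dots> = (\<Sum>\<^sub>\<infinity>x\<in>X. (cmod (f x))\<^sup>2)"
    by (rule infsum_reindex_bij_betw[OF h])
  finally show "ell2_norm X f' = ell2_norm X f"
    by (simp add: ell2_norm_def)
qed

lemma ell2_cnj: "f \<in> ell2 X \<Longrightarrow> (\<lambda>x. cnj (f x)) \<in> ell2 X"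
  by (simp add: ell2_def)

lemma commutantI:
  assumes "T \<in> bounded_ops X"
    and "\<And>S f. S \<in> A \<Longrightarrow> f \<in> ell2 X \<Longrightarrow> T (S f) = S (T f)"
  shows "T \<in> commutant X A"
  using assms by (auto simp: commutant_def op_mult_def compose_def fun_eq_iff restrict_def)

lemma commutantD:
  assumes "T \<in> commutant X A" "S \<in> A" "f \<in> ell2 X"
  shows "T (S f) = S (T f)"
proof -
  have "op_mult X T S f = op_mult X S T f"
    using assms by (auto simp: commutant_def)
  then show ?thesis using assms by (simp add: op_mult_apply)
qed

lemma commutant_bounded: "T \<in> commutant X A \<Longrightarrow> T \<in> bounded_ops X"
  by (simp add: commutant_def)

context group
begin

lemma bij_left_mult: "g \<in> carrier G \<Longrightarrow> bij_betw (\<lambda>x. g \<otimes> x) (carrier G) (carrier G)"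
  by (rule bij_betw_byWitness[where f' = "\<lambda>x. inv g \<otimes> x"]) (auto simp: m_assoc[symmetric])

lemma bij_right_mult: "g \<in> carrier G \<Longrightarrow> bij_betw (\<lambda>x. x \<otimes> g) (carrier G) (carrier G)"
  by (rule bij_betw_byWitness[where f' = "\<lambda>x. x \<otimes> inv g"]) (auto simp: m_assoc)

lemma bij_inv: "bij_betw (\<lambda>x. inv x) (carrier G) (carrier G)"
  by (rule bij_betw_byWitness[where f' = "\<lambda>x. inv x"]) auto

lemma bij_inv_mult: "g \<in> carrier G \<Longrightarrow> bij_betw (\<lambda>x. g \<otimes> inv x) (carrier G) (carrier G)"
  using bij_betw_trans[OF bij_inv bij_left_mult] by (simp add: comp_def)

lemma bij_mult_inv: "g \<in> carrier G \<Longrightarrow> bij_betw (\<lambda>x. inv x \<otimes> g) (carrier G) (carrier G)"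
  using bij_betw_trans[OF bij_inv bij_right_mult] by (simp add: comp_def)

lemma mult_inv_eq_iff:
  assumes "x \<in> carrier G" "y \<in> carrier G" "z \<in> carrier G"
  shows "y \<otimes> inv x = z \<longleftrightarrow> y = z \<otimes> x" "inv x \<otimes> y = z \<longleftrightarrow> y = x \<otimes> z"
  using assms by (metis inv_solve_right, metis inv_solve_left)

definition right_translation :: "'a \<Rightarrow> 'a ell2_op" where
  "right_translation g = (\<lambda>f\<in>ell2 (carrier G). \<lambda>x. if x \<in> carrier G then f (x \<otimes> g) else 0)"

lemma right_translation_bounded:
  "g \<in> carrier G \<Longrightarrow> right_translation g \<in> bounded_ops (carrier G)"
  unfolding right_translation_def
  by (rule bounded_opsI[where C = 1]) (auto simp: ell2_reindex[OF bij_right_mult])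

lemma canonical_unitary_bounded:
  "g \<in> carrier G \<Longrightarrow> canonical_unitary G g \<in> bounded_ops (carrier G)"
  unfolding canonical_unitary_def
  by (rule bounded_opsI[where C = 1]) (auto simp: ell2_reindex[OF bij_left_mult])

lemma canonical_unitary_delta:
  assumes "g \<in> carrier G" "x \<in> carrier G"
  shows "canonical_unitary G g (delta x) = delta (g \<otimes> x)"
proof -
  have "canonical_unitary G g (delta x) = (\<lambda>y. if y \<in> carrier G then delta x (inv g \<otimes> y) else 0)"
    using delta_ell2[OF assms(2)] by (simp add: canonical_unitary_def)
  then show ?thesis
    using assms by (auto simp: delta_def fun_eq_iff mult_inv_eq_iff)
qed

lemma right_translation_delta:
  assumes "g \<in> carrier G" "x \<in> carrier G"
  shows "right_translation g (delta x) = delta (x \<otimes> inv g)"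
proof -
  have "right_translation g (delta x) = (\<lambda>y. if y \<in> carrier G then delta x (y \<otimes> g) else 0)"
    using delta_ell2[OF assms(2)] by (simp add: right_translation_def)
  then show ?thesis
    using assms by (auto simp: delta_def fun_eq_iff inv_solve_right m_assoc)
qed

lemma right_translation_commutant:
  assumes g: "g \<in> carrier G"
  shows "right_translation g \<in> commutant (carrier G) (canonical_unitary G ` carrier G)"
proof (rule commutantI[OF right_translation_bounded[OF g]])
  fix S f assume S: "S \<in> canonical_unitary G ` carrier G" and f: "f \<in> ell2 (carrier G)"
  then obtain h where h: "h \<in> carrier G" "S = canonical_unitary G h" by blast
  then have "S f \<in> ell2 (carrier G)" "right_translation g f \<in> ell2 (carrier G)"
    using bounded_ops_ell2[OF canonical_unitary_bounded f]
      bounded_ops_ell2[OF right_translation_bounded f] g by auto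
  then show "right_translation g (S f) = S (right_translation g f)"
    using f g unfolding h(2) by (auto simp: right_translation_def canonical_unitary_def fun_eq_iff m_assoc h)
qed

lemma vN_bounded: "T \<in> group_vN_algebra G \<Longrightarrow> T \<in> bounded_ops (carrier G)"
  unfolding group_vN_algebra_def by (rule commutant_bounded)

lemma vN_one: "op_one (carrier G) \<in> group_vN_algebra G"
  unfolding group_vN_algebra_def
  by (rule commutantI) (auto simp: op_one_bounded op_one_apply dest!: commutant_bounded bounded_ops_ell2)

lemma vN_mult:
  assumes "S \<in> group_vN_algebra G" "T \<in> group_vN_algebra G"
  shows "op_mult (carrier G) S T \<in> group_vN_algebra G"
  unfolding group_vN_algebra_def
proof (rule commutantI)
  note b = assms[THEN vN_bounded]
  show "op_mult (carrier G) S T \<in> bounded_ops (carrier G)"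
    by (intro op_mult_bounded b)
  fix R f assume R: "R \<in> commutant (carrier G) (canonical_unitary G ` carrier G)"
    and f: "f \<in> ell2 (carrier G)"
  note e = bounded_ops_ell2[OF b(2) f] bounded_ops_ell2[OF commutant_bounded[OF R] f]
  show "op_mult (carrier G) S T (R f) = R (op_mult (carrier G) S T f)"
    using commutantD[OF assms(1)[unfolded group_vN_algebra_def] R e(1)]
      commutantD[OF assms(2)[unfolded group_vN_algebra_def] R f]
    by (simp add: op_mult_apply e f)
qed

text \<open>
  An element of the algebra commutes with right translations, so that its matrix is determined by the
  image of the basis vector at the neutral element, that is, by its Fourier coefficients.
\<close>

lemma vN_entry:
  assumes T: "T \<in> group_vN_algebra G" and x: "x \<in> carrier G" and y: "y \<in> carrier G"
  shows "T (delta x) y = T (delta \<one>) (y \<otimes> inv x)"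
proof -
  note d = delta_ell2[OF one_closed]
  have "T (right_translation (inv x) (delta \<one>)) = right_translation (inv x) (T (delta \<one>))"
    using T unfolding group_vN_algebra_def
    by (rule commutantD) (use x d in \<open>auto intro: right_translation_commutant\<close>)
  moreover have "right_translation (inv x) (delta \<one>) = delta x"
    using x by (simp add: right_translation_delta)
  ultimately show ?thesis
    using y bounded_ops_ell2[OF vN_bounded[OF T] d] by (simp add: right_translation_def)
qed

lemma canonical_trace_eq:
  assumes "T \<in> bounded_ops (carrier G)"
  shows "canonical_trace G T = T (delta \<one>) \<one>"
  using ell2_inner_delta[OF bounded_ops_ell2[OF assms delta_ell2] one_closed]
  by (simp add: canonical_trace_def Let_def delta_def[symmetric])

lemma trace_norm2_eq:
  assumes T: "T \<in> bounded_ops (carrier G)"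
  shows "trace_norm2 G T = ell2_norm (carrier G) (T (delta \<one>))"
proof -
  let ?X = "carrier G"
  have d: "delta \<one> \<in> ell2 ?X" by (simp add: delta_ell2)
  note Td = bounded_ops_ell2[OF T d]
  note S = op_adjoint_bounded[OF T]
  have "canonical_trace G (op_mult ?X (op_adjoint ?X T) T)
    = ell2_inner ?X (op_adjoint ?X T (T (delta \<one>))) (delta \<one>)"
    by (simp add: canonical_trace_def Let_def delta_def[symmetric] op_mult_apply[OF d])
  also have "\<dots> = of_real ((ell2_norm ?X (T (delta \<one>)))\<^sup>2)"
    using op_adjoint_inner'[OF T Td d] ell2_inner_self[OF Td] by simp
  finally show ?thesis
    by (simp add: trace_norm2_def ell2_norm_nonneg)
qed

section \<open>A criterion for property Gamma\<close>

text \<open>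
  On Fourier coefficients, conjugation of an operator by the canonical unitary of \<open>g\<close>.
\<close>

definition conj_translate :: "'a \<Rightarrow> ('a \<Rightarrow> complex) \<Rightarrow> 'a \<Rightarrow> complex" where
  "conj_translate g f = (\<lambda>x. if x \<in> carrier G then f (inv g \<otimes> x \<otimes> g) else 0)"

lemma bij_conj: "g \<in> carrier G \<Longrightarrow> bij_betw (\<lambda>x. inv g \<otimes> x \<otimes> g) (carrier G) (carrier G)"
  using bij_betw_trans[OF bij_left_mult[of "inv g"] bij_right_mult[of g]] by (simp add: comp_def)

lemma
  assumes "g \<in> carrier G" "f \<in> ell2 (carrier G)"
  shows conj_translate_ell2: "conj_translate g f \<in> ell2 (carrier G)"
    and conj_translate_norm: "ell2_norm (carrier G) (conj_translate g f) = ell2_norm (carrier G) f"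
  unfolding conj_translate_def using ell2_reindex[OF bij_conj] assms by auto

definition conj_invariant :: "(nat \<Rightarrow> 'a \<Rightarrow> complex) \<Rightarrow> 'a \<Rightarrow> bool" where
  "conj_invariant f g \<longleftrightarrow>
     (\<lambda>n. ell2_norm (carrier G) (\<lambda>x. f n x - conj_translate g (f n) x)) \<longlonglongrightarrow> 0"

lemma conj_invariant_generate:
  assumes f: "\<And>n. f n \<in> ell2 (carrier G)" and S: "S \<subseteq> carrier G"
    and inv: "\<And>s. s \<in> S \<Longrightarrow> conj_invariant f s" and g: "g \<in> generate G S"
  shows "conj_invariant f g"
proof -
  let ?n = "ell2_norm (carrier G)"
  have one: "conj_invariant f \<one>"
  proof -
    have "conj_translate \<one> (f n) = f n" for n
      using ell2_outside[OF f] by (auto simp: conj_translate_def fun_eq_iff)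
    then show ?thesis by (simp add: conj_invariant_def ell2_norm_def)
  qed
  have minv: "conj_invariant f (inv h)" if h: "h \<in> carrier G" "conj_invariant f h" for h
  proof -
    have "?n (\<lambda>x. f n x - conj_translate (inv h) (f n) x)
      = ?n (\<lambda>x. f n x - conj_translate h (f n) x)" for n
    proof -
      have d: "(\<lambda>x. conj_translate h (f n) x - f n x) \<in> ell2 (carrier G)"
        by (intro ell2_diff conj_translate_ell2 f h)
      have "conj_translate (inv h) (\<lambda>x. conj_translate h (f n) x - f n x)
        = (\<lambda>x. f n x - conj_translate (inv h) (f n) x)"
        using h ell2_outside[OF f]
        by (auto simp: conj_translate_def fun_eq_iff m_assoc inv_mult_group[symmetric])
           (simp add: m_assoc[symmetric])
      then have "?n (\<lambda>x. f n x - conj_translate (inv h) (f n) x)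
        = ?n (\<lambda>x. conj_translate h (f n) x - f n x)"
        using conj_translate_norm[OF inv_closed[OF h(1)] d] by simp
      also have "\<dots> = ?n (\<lambda>x. f n x - conj_translate h (f n) x)"
        by (simp add: ell2_norm_def norm_minus_commute)
      finally show ?thesis .
    qed
    then show ?thesis using h by (simp add: conj_invariant_def)
  qed
  have mult: "conj_invariant f (h \<otimes> k)"
    if hk: "h \<in> carrier G" "k \<in> carrier G" "conj_invariant f h" "conj_invariant f k" for h k
  proof -
    have le: "?n (\<lambda>x. f n x - conj_translate (h \<otimes> k) (f n) x)
      \<le> ?n (\<lambda>x. f n x - conj_translate h (f n) x) + ?n (\<lambda>x. f n x - conj_translate k (f n) x)" for n
    proof -
      have d: "(\<lambda>x. f n x - conj_translate k (f n) x) \<in> ell2 (carrier G)"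
          "(\<lambda>x. f n x - conj_translate h (f n) x) \<in> ell2 (carrier G)"
        by (intro ell2_diff conj_translate_ell2 f hk)+
      have "(\<lambda>x. f n x - conj_translate (h \<otimes> k) (f n) x)
        = (\<lambda>x. (f n x - conj_translate h (f n) x)
             + conj_translate h (\<lambda>x. f n x - conj_translate k (f n) x) x)"
        using hk by (auto simp: conj_translate_def fun_eq_iff m_assoc inv_mult_group)
      then show ?thesis
        using ell2_norm_triangle[OF d(2) conj_translate_ell2[OF hk(1) d(1)]]
          conj_translate_norm[OF hk(1) d(1)] by simp
    qed
    have "(\<lambda>n. ?n (\<lambda>x. f n x - conj_translate h (f n) x)
       + ?n (\<lambda>x. f n x - conj_translate k (f n) x)) \<longlonglongrightarrow> 0"
      using tendsto_add[OF hk(3,4)[unfolded conj_invariant_def]] by simp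
    then show ?thesis
      unfolding conj_invariant_def
      by (rule tendsto_sandwich[OF _ _ tendsto_const, rotated 2])
         (auto simp: ell2_norm_nonneg le)
  qed
  show ?thesis
    using g
  proof induction
    case (eng h k)
    then show ?case using mult generate_in_carrier[OF S] by blast
  qed (use one inv minv S in auto)
qed

text \<open>
  Let \<open>\<xi>\<close> be the coefficients of the unitary \<open>x\<close>. Right convolution \<open>R\<close> by \<open>\<xi>\<close> is an isometry, and
  the coefficients of \<open>x y - y x\<close> are the image under \<open>x - R\<close> of those of \<open>y\<close>. Since \<open>x - R\<close> has norm at
  most \<open>2\<close>, it suffices that it is small on basis vectors, and this is what almost invariance of \<open>\<xi>\<close>
  under conjugation says.
\<close>

theorem vN_property_GammaI:
  assumes x: "\<And>n. x n \<in> group_vN_algebra G" "\<And>n. unitary_op (carrier G) (x n)"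
    and trace: "\<And>n. x n (delta \<one>) \<one> = 0"
    and inv: "\<And>g. g \<in> carrier G \<Longrightarrow> conj_invariant (\<lambda>n. x n (delta \<one>)) g"
  shows "vN_property_Gamma G"
proof -
  let ?X = "carrier G"
  note d = delta_ell2[OF one_closed]
  note xb = vN_bounded[OF x(1)]
  define \<xi> where "\<xi> n = x n (delta \<one>)" for n
  have \<xi>: "\<xi> n \<in> ell2 ?X" for n
    unfolding \<xi>_def by (rule bounded_ops_ell2[OF xb d])
  have entry: "x n (delta a) b = \<xi> n (b \<otimes> inv a)" if "a \<in> ?X" "b \<in> ?X" for n a b
    using vN_entry[OF x(1) that] by (simp add: \<xi>_def)
  \<comment> \<open>the columns of right convolution by \<open>\<xi> n\<close>\<close>
  define v where "v n g = (\<lambda>z. if z \<in> ?X then \<xi> n (inv g \<otimes> z) else 0)" for n g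
  have v: "v n g \<in> ell2 ?X" if "g \<in> ?X" for n g
    unfolding v_def using ell2_reindex(1)[OF bij_left_mult[OF inv_closed[OF that]] \<xi>] .
  have row: "(\<lambda>g. if g \<in> ?X then cnj (v n g y) else 0) \<in> ell2 ?X" if y: "y \<in> ?X" for n y
  proof -
    have "(\<lambda>g. if g \<in> ?X then cnj (v n g y) else 0) = (\<lambda>g. if g \<in> ?X then cnj (\<xi> n (inv g \<otimes> y)) else 0)"
      by (auto simp: v_def y)
    then show ?thesis
      using ell2_reindex(1)[OF bij_mult_inv[OF y] ell2_cnj[OF \<xi>], of n] by metis
  qed
  have columns: "ell2_inner ?X (v n g) (v n h) = delta g h" if gh: "g \<in> ?X" "h \<in> ?X" for n g h
  proof -
    \<comment> \<open>the columns are, up to inversion of the variable, the conjugated columns of the unitary adjoint\<close>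
    let ?S = "op_adjoint ?X (x n)"
    have "ell2_inner ?X (?S (delta (inv h))) (?S (delta (inv g)))
       = ell2_inner ?X (delta (inv h)) (delta (inv g))"
    proof -
      have gh': "delta (inv g) \<in> ell2 ?X" "delta (inv h) \<in> ell2 ?X" using gh by (auto intro: delta_ell2)
      show ?thesis
        using op_adjoint_inner'[OF xb gh'(2) bounded_ops_ell2[OF op_adjoint_bounded[OF xb] gh'(1)]]
          unitary_op_adjoint_cancel(2)[OF x(2) gh'(1)] by simp
    qed
    also have "\<dots> = delta g h"
      using gh ell2_inner_delta[OF delta_ell2[OF inv_closed[OF gh(2)]] inv_closed[OF gh(1)]]
        inj_onD[OF bij_betw_imp_inj_on[OF bij_inv] _ gh]
      by (auto simp: delta_def)
    also have "ell2_inner ?X (?S (delta (inv h))) (?S (delta (inv g)))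
       = (\<Sum>\<^sub>\<infinity>w\<in>?X. v n g (inv w) * cnj (v n h (inv w)))"
      unfolding ell2_inner_def
      by (rule infsum_cong) (simp add: op_adjoint_entry[OF xb] entry gh v_def)
    also have "\<dots> = ell2_inner ?X (v n g) (v n h)"
      unfolding ell2_inner_def by (rule infsum_reindex_bij_betw[OF bij_inv])
    finally show ?thesis .
  qed
  define R where "R n = (\<lambda>f\<in>ell2 ?X. \<lambda>y. if y \<in> ?X then \<Sum>\<^sub>\<infinity>g\<in>?X. f g * v n g y else 0)" for n
  have Rb: "R n \<in> bounded_ops ?X" and Rd: "\<And>g. g \<in> ?X \<Longrightarrow> R n (delta g) = v n g" for n
    using isometry_of_orthonormal_columns[where v = "v n", OF v row columns] by (auto simp: R_def)
  have Rn: "ell2_norm ?X (R n f) = ell2_norm ?X f" if "f \<in> ell2 ?X" for n f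
    by (rule norm_if_orthonormal_columns[OF Rb _ that]) (simp add: Rd columns)
  \<comment> \<open>on coefficients, multiplication by \<open>x n\<close> from the right is the operator \<open>R n\<close>\<close>
  have right_mult: "y (\<xi> n) = R n (y (delta \<one>))" if y: "y \<in> group_vN_algebra G" for y n
  proof
    fix z
    note yb = vN_bounded[OF y]
    note yd = bounded_ops_ell2[OF yb d]
    show "y (\<xi> n) z = R n (y (delta \<one>)) z"
    proof (cases "z \<in> ?X")
      case True
      have "y (\<xi> n) z = (\<Sum>\<^sub>\<infinity>h\<in>?X. \<xi> n h * y (delta h) z)"
        by (rule infsumI[OF bounded_op_expansion[OF yb \<xi>], symmetric])
      also have "\<dots> = (\<Sum>\<^sub>\<infinity>h\<in>?X. \<xi> n h * y (delta \<one>) (z \<otimes> inv h))"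
        by (rule infsum_cong) (simp add: vN_entry[OF y, of _ z] True)
      also have "\<dots> = (\<Sum>\<^sub>\<infinity>g\<in>?X. \<xi> n (inv g \<otimes> z) * y (delta \<one>) (z \<otimes> inv (inv g \<otimes> z)))"
        by (rule infsum_reindex_bij_betw[OF bij_mult_inv[OF True], symmetric])
      also have "\<dots> = (\<Sum>\<^sub>\<infinity>g\<in>?X. y (delta \<one>) g * R n (delta g) z)"
        by (rule infsum_cong) (use True in \<open>simp add: Rd v_def inv_mult_group m_assoc[symmetric]\<close>)
      also have "\<dots> = R n (y (delta \<one>)) z"
        by (rule infsumI[OF bounded_op_expansion[OF Rb yd]])
      finally show ?thesis .
    next
      case False
      then show ?thesis
        using ell2_outside[OF bounded_ops_ell2[OF yb \<xi>] False]
          ell2_outside[OF bounded_ops_ell2[OF Rb yd] False] by simp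
    qed
  qed
  have "(\<lambda>n. trace_norm2 G (op_minus ?X (op_mult ?X (x n) y) (op_mult ?X y (x n)))) \<longlonglongrightarrow> 0"
    if y: "y \<in> group_vN_algebra G" for y
  proof -
    note yb = vN_bounded[OF y]
    note yd = bounded_ops_ell2[OF yb d]
    define D where "D n f = (\<lambda>z. x n f z - R n f z)" for n f
    note e = bounded_ops_ell2[OF xb] bounded_ops_ell2[OF Rb]
    have "(\<lambda>n. ell2_norm ?X (D n (y (delta \<one>)))) \<longlonglongrightarrow> 0"
    proof (rule strong_convergence_from_basis[where C = 2, OF _ _ _ _ _ yd])
      fix g assume g: "g \<in> ?X"
      have "ell2_norm ?X (D n (delta g)) = ell2_norm ?X (\<lambda>z. \<xi> n z - conj_translate g (\<xi> n) z)" for n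
      proof -
        have e: "(\<lambda>z. \<xi> n z - conj_translate g (\<xi> n) z) \<in> ell2 ?X"
          by (intro ell2_diff conj_translate_ell2 g \<xi>)
        have "D n (delta g) = (\<lambda>z. if z \<in> ?X then \<xi> n (z \<otimes> inv g) - conj_translate g (\<xi> n) (z \<otimes> inv g) else 0)"
        proof
          fix z
          show "D n (delta g) z = (if z \<in> ?X then \<xi> n (z \<otimes> inv g) - conj_translate g (\<xi> n) (z \<otimes> inv g) else 0)"
            using g ell2_outside[OF bounded_ops_ell2[OF xb delta_ell2[OF g]], of z]
            by (auto simp: D_def Rd v_def entry conj_translate_def m_assoc)
        qed
        then show ?thesis
          using ell2_reindex(2)[OF bij_right_mult[OF inv_closed[OF g]] e] by simp
      qed
      then show "(\<lambda>n. ell2_norm ?X (D n (delta g))) \<longlonglongrightarrow> 0"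
        using inv[OF g] by (simp add: conj_invariant_def \<xi>_def)
    next
      fix n f assume f: "f \<in> ell2 ?X"
      show "ell2_norm ?X (D n f) \<le> 2 * ell2_norm ?X f"
        using ell2_norm_diff_triangle[OF e(1)[OF f, of n] e(2)[OF f, of n]]
          unitary_op_norm[OF x(2) f, of n] Rn[OF f, of n] by (simp add: D_def)
    qed (auto simp: D_def bounded_ops_add[OF xb] bounded_ops_add[OF Rb] bounded_ops_scale[OF xb]
          bounded_ops_scale[OF Rb] algebra_simps intro!: ell2_diff e)
    moreover have "trace_norm2 G (op_minus ?X (op_mult ?X (x n) y) (op_mult ?X y (x n)))
       = ell2_norm ?X (D n (y (delta \<one>)))" for n
    proof -
      have "op_minus ?X (op_mult ?X (x n) y) (op_mult ?X y (x n)) (delta \<one>) = D n (y (delta \<one>))"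
        using right_mult[OF y, of n] d by (simp add: op_minus_def op_mult_apply D_def \<xi>_def)
      then show ?thesis
        by (subst trace_norm2_eq) (auto intro!: op_minus_bounded op_mult_bounded xb yb)
    qed
    ultimately show ?thesis by simp
  qed
  then show ?thesis
    unfolding vN_property_Gamma_def
    using x trace canonical_trace_eq[OF xb] by (intro exI[of _ x]) auto
qed

end


section \<open>Convolution operators\<close>

text \<open>
  A sequence stands for the function on the circle with these Fourier coefficients. The correlation
  at \<open>k\<close> is the coefficient at \<open>- k\<close> of the product of the first function with the conjugate of the
  second, and a unitary sequence is a function with values of modulus \<open>1\<close>.
\<close>

definition correlation :: "(int \<Rightarrow> complex) \<Rightarrow> (int \<Rightarrow> complex) \<Rightarrow> int \<Rightarrow> complex" where
  "correlation c c' k = (\<Sum>\<^sub>\<infinity>m. c m * cnj (c' (m + k)))"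

definition unitary_sequence :: "(int \<Rightarrow> complex) \<Rightarrow> bool" where
  "unitary_sequence c \<longleftrightarrow> c \<in> ell2 UNIV \<and> correlation c c = delta 0"

context group
begin

text \<open>
  The two conditions say that the left convolution operator has orthonormal columns and orthonormal
  rows.
\<close>

definition unitary_vector :: "('a \<Rightarrow> complex) \<Rightarrow> bool" where
  "unitary_vector \<xi> \<longleftrightarrow> \<xi> \<in> ell2 (carrier G)
     \<and> (\<forall>g\<in>carrier G. (\<Sum>\<^sub>\<infinity>y\<in>carrier G. \<xi> y * cnj (\<xi> (y \<otimes> g))) = delta \<one> g)
     \<and> (\<forall>g\<in>carrier G. (\<Sum>\<^sub>\<infinity>y\<in>carrier G. cnj (\<xi> y) * \<xi> (g \<otimes> y)) = delta \<one> g)"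

definition left_convolution :: "('a \<Rightarrow> complex) \<Rightarrow> 'a ell2_op" where
  "left_convolution \<xi> = (\<lambda>f\<in>ell2 (carrier G). \<lambda>y. if y \<in> carrier G
     then \<Sum>\<^sub>\<infinity>x\<in>carrier G. f x * \<xi> (y \<otimes> inv x) else 0)"

definition right_shift :: "('a \<Rightarrow> complex) \<Rightarrow> 'a \<Rightarrow> 'a \<Rightarrow> complex" where
  "right_shift \<xi> x = (\<lambda>y. if y \<in> carrier G then \<xi> (y \<otimes> inv x) else 0)"

lemma right_shift_ell2:
  "\<xi> \<in> ell2 (carrier G) \<Longrightarrow> x \<in> carrier G \<Longrightarrow> right_shift \<xi> x \<in> ell2 (carrier G)"
  unfolding right_shift_def by (rule ell2_reindex[OF bij_right_mult]) auto

lemma right_shift_inner: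
  assumes "x \<in> carrier G" "x' \<in> carrier G"
  shows "ell2_inner (carrier G) (right_shift \<xi> x) (right_shift \<xi>' x')
    = (\<Sum>\<^sub>\<infinity>y\<in>carrier G. \<xi> y * cnj (\<xi>' (y \<otimes> (x \<otimes> inv x'))))"
proof -
  have "ell2_inner (carrier G) (right_shift \<xi> x) (right_shift \<xi>' x')
    = (\<Sum>\<^sub>\<infinity>y\<in>carrier G. \<xi> (y \<otimes> inv x) * cnj (\<xi>' ((y \<otimes> inv x) \<otimes> (x \<otimes> inv x'))))"
    unfolding ell2_inner_def
    by (rule infsum_cong) (use assms in \<open>simp add: right_shift_def m_assoc inv_solve_left'[symmetric] l_inv_ex flip: m_assoc[of "inv x" x]\<close>)
  also have "\<dots> = (\<Sum>\<^sub>\<infinity>y\<in>carrier G. \<xi> y * cnj (\<xi>' (y \<otimes> (x \<otimes> inv x'))))"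
    by (rule infsum_reindex_bij_betw[OF bij_right_mult[OF inv_closed[OF assms(1)]]])
  finally show ?thesis .
qed

lemma delta_mult_inv:
  assumes "x \<in> carrier G" "y \<in> carrier G"
  shows "delta \<one> (x \<otimes> inv y) = delta x y" "delta \<one> (y \<otimes> inv x) = delta x y"
  using assms by (auto simp: delta_def mult_inv_eq_iff)

lemma
  assumes u: "unitary_vector \<xi>"
  shows left_convolution_bounded: "left_convolution \<xi> \<in> bounded_ops (carrier G)"
    and left_convolution_delta: "x \<in> carrier G \<Longrightarrow> left_convolution \<xi> (delta x) = right_shift \<xi> x"
    and left_convolution_unitary: "unitary_op (carrier G) (left_convolution \<xi>)"
    and left_convolution_vN: "left_convolution \<xi> \<in> group_vN_algebra G"
proof -
  let ?X = "carrier G"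
  let ?L = "left_convolution \<xi>"
  have \<xi>: "\<xi> \<in> ell2 ?X"
    using u by (simp add: unitary_vector_def)
  have row: "(\<lambda>x. if x \<in> ?X then cnj (right_shift \<xi> x y) else 0) \<in> ell2 ?X" if y: "y \<in> ?X" for y
  proof -
    have "(\<lambda>x. if x \<in> ?X then cnj (right_shift \<xi> x y) else 0)
       = (\<lambda>x. if x \<in> ?X then cnj (\<xi> (y \<otimes> inv x)) else 0)"
      using y by (auto simp: right_shift_def)
    then show ?thesis
      using ell2_reindex(1)[OF bij_inv_mult[OF y] ell2_cnj[OF \<xi>]] by metis
  qed
  have columns: "ell2_inner ?X (right_shift \<xi> x) (right_shift \<xi> x') = delta x x'"
    if "x \<in> ?X" "x' \<in> ?X" for x x'
    using u that by (simp add: right_shift_inner unitary_vector_def delta_mult_inv)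
  have L_eq: "?L = (\<lambda>f\<in>ell2 ?X. \<lambda>y. if y \<in> ?X then \<Sum>\<^sub>\<infinity>x\<in>?X. f x * right_shift \<xi> x y else 0)"
    unfolding left_convolution_def
    by (intro restrict_ext ext) (simp add: right_shift_def)
  note iso = isometry_of_orthonormal_columns[where v = "right_shift \<xi>", OF right_shift_ell2[OF \<xi>] row columns]
  show L: "?L \<in> bounded_ops ?X"
    unfolding L_eq by (rule iso)
  show L_delta: "?L (delta x) = right_shift \<xi> x" if "x \<in> ?X" for x
    unfolding L_eq by (rule iso) (use that in simp_all)
  show "unitary_op ?X ?L"
  proof (rule unitary_op_if_orthonormal[OF L])
    fix y y' assume y: "y \<in> ?X" "y' \<in> ?X"
    have "(\<Sum>\<^sub>\<infinity>x\<in>?X. cnj (?L (delta x) y) * ?L (delta x) y')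
       = (\<Sum>\<^sub>\<infinity>x\<in>?X. cnj (\<xi> (y \<otimes> inv x)) * \<xi> ((y' \<otimes> inv y) \<otimes> (y \<otimes> inv x)))"
      by (rule infsum_cong)
         (use y in \<open>simp add: L_delta right_shift_def m_assoc flip: m_assoc[of "inv y" y]\<close>)
    also have "\<dots> = (\<Sum>\<^sub>\<infinity>z\<in>?X. cnj (\<xi> z) * \<xi> ((y' \<otimes> inv y) \<otimes> z))"
      by (rule infsum_reindex_bij_betw[OF bij_inv_mult[OF y(1)]])
    also have "\<dots> = delta y y'"
      using u y delta_mult_inv(2)[OF y] by (simp only: unitary_vector_def m_closed inv_closed)
    finally show "(\<Sum>\<^sub>\<infinity>x\<in>?X. cnj (?L (delta x) y) * ?L (delta x) y') = delta y y'" .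
  qed (simp add: L_delta columns)
  show "?L \<in> group_vN_algebra G"
    unfolding group_vN_algebra_def
  proof (rule commutantI[OF L])
    fix S f assume S: "S \<in> commutant ?X (canonical_unitary G ` ?X)" and f: "f \<in> ell2 ?X"
    have Sb: "S \<in> bounded_ops ?X" by (rule commutant_bounded[OF S])
    have "op_mult ?X ?L S = op_mult ?X S ?L"
    proof (rule bounded_ops_eqI)
      fix x assume x: "x \<in> ?X"
      note d = delta_ell2[OF x]
      note Sd = bounded_ops_ell2[OF Sb d] and Ld = bounded_ops_ell2[OF L d]
      have "?L (S (delta x)) y = S (?L (delta x)) y" if y: "y \<in> ?X" for y
      proof -
        \<comment> \<open>operators commuting with left translations have matrices that depend on \<open>z\<^sup>-\<^sup>1 y\<close> only\<close>
        have shift: "S (delta z) y = S (delta x) (x \<otimes> (inv z \<otimes> y))" if z: "z \<in> ?X" for z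
        proof -
          have g: "z \<otimes> inv x \<in> ?X" using x z by simp
          have "S (canonical_unitary G (z \<otimes> inv x) (delta x))
             = canonical_unitary G (z \<otimes> inv x) (S (delta x))"
            by (rule commutantD[OF S _ d]) (use g in blast)
          then have "S (delta z) = canonical_unitary G (z \<otimes> inv x) (S (delta x))"
            using x z by (simp add: canonical_unitary_delta m_assoc)
          then show ?thesis
            using x y z Sd by (simp add: canonical_unitary_def inv_mult_group m_assoc)
        qed
        have "S (?L (delta x)) y = (\<Sum>\<^sub>\<infinity>z\<in>?X. ?L (delta x) z * S (delta z) y)"
          by (rule infsumI[OF bounded_op_expansion[OF Sb Ld], symmetric])
        also have "\<dots> = (\<Sum>\<^sub>\<infinity>z\<in>?X. \<xi> (z \<otimes> inv x) * S (delta x) (x \<otimes> (inv z \<otimes> y)))"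
          by (rule infsum_cong) (use x in \<open>simp add: L_delta right_shift_def shift\<close>)
        also have "\<dots> = (\<Sum>\<^sub>\<infinity>w\<in>?X. S (delta x) w * \<xi> (y \<otimes> inv w))"
        proof (rule infsum_reindex_bij_witness[where j = "\<lambda>z. x \<otimes> (inv z \<otimes> y)" and i = "\<lambda>w. y \<otimes> inv w \<otimes> x"])
          fix z assume z: "z \<in> ?X"
          have *: "y \<otimes> inv (x \<otimes> (inv z \<otimes> y)) = z \<otimes> inv x"
            using x y z by (simp add: inv_mult_group m_assoc[symmetric])
          show "y \<otimes> inv (x \<otimes> (inv z \<otimes> y)) \<otimes> x = z"
            unfolding * using x z by (simp add: m_assoc)
          show "S (delta x) (x \<otimes> (inv z \<otimes> y)) * \<xi> (y \<otimes> inv (x \<otimes> (inv z \<otimes> y)))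
             = \<xi> (z \<otimes> inv x) * S (delta x) (x \<otimes> (inv z \<otimes> y))"
            unfolding * by simp
        next
          fix w assume w: "w \<in> ?X"
          show "x \<otimes> (inv (y \<otimes> inv w \<otimes> x) \<otimes> y) = w"
            using x y w by (simp add: inv_mult_group m_assoc[symmetric]) (simp add: x y w m_assoc)
        qed (use x y in auto)
        also have "\<dots> = ?L (S (delta x)) y"
          using y Sd by (simp add: left_convolution_def)
        finally show ?thesis by simp
      qed
      then have "?L (S (delta x)) = S (?L (delta x))"
        using ell2_outside[OF bounded_ops_ell2[OF L Sd]] ell2_outside[OF bounded_ops_ell2[OF Sb Ld]]
        by (metis ext)
      then show "op_mult ?X ?L S (delta x) = op_mult ?X S ?L (delta x)"
        by (simp add: op_mult_apply d)
    qed (intro op_mult_bounded L Sb)+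
    then have "op_mult ?X ?L S f = op_mult ?X S ?L f" by simp
    then show "?L (S f) = S (?L f)"
      by (simp add: op_mult_apply f)
  qed
qed

lemma left_convolution_apply:
  "f \<in> ell2 (carrier G) \<Longrightarrow> y \<in> carrier G
    \<Longrightarrow> left_convolution \<xi> f y = (\<Sum>\<^sub>\<infinity>x\<in>carrier G. f x * \<xi> (y \<otimes> inv x))"
  by (simp add: left_convolution_def)

lemma left_convolution_delta_one:
  assumes "f \<in> ell2 (carrier G)"
  shows "left_convolution (delta \<one>) f = f"
proof
  fix y
  show "left_convolution (delta \<one>) f y = f y"
  proof (cases "y \<in> carrier G")
    case True
    have "(\<Sum>\<^sub>\<infinity>x\<in>carrier G. f x * delta \<one> (y \<otimes> inv x)) = (\<Sum>\<^sub>\<infinity>x\<in>{y}. f x)"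
      by (rule infsum_cong_neutral) (use True in \<open>auto simp: delta_def mult_inv_eq_iff\<close>)
    then show ?thesis using left_convolution_apply[OF assms True] by simp
  next
    case False
    then show ?thesis using assms ell2_outside[OF assms False] by (simp add: left_convolution_def)
  qed
qed

section \<open>Sequences spread over a cyclic subgroup\<close>

definition infinite_order :: "'a \<Rightarrow> bool" where
  "infinite_order b \<longleftrightarrow> b \<in> carrier G \<and> inj (\<lambda>m::int. b [^] m)"

lemma infinite_order_closed: "infinite_order b \<Longrightarrow> b \<in> carrier G"
  by (simp add: infinite_order_def)

lemma infinite_order_eq: "infinite_order b \<Longrightarrow> b [^] m = b [^] n \<longleftrightarrow> m = n" for m n :: int
  by (auto simp: infinite_order_def inj_def)

text \<open>
  The Fourier coefficients of the function of \<open>b\<close> that \<open>c\<close> represents.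
\<close>

definition spread :: "'a \<Rightarrow> (int \<Rightarrow> complex) \<Rightarrow> 'a \<Rightarrow> complex" where
  "spread b c = (\<lambda>y. if y \<in> range (\<lambda>m::int. b [^] m) then c (the_inv (\<lambda>m. b [^] m) y) else 0)"

lemma spread_pow: "infinite_order b \<Longrightarrow> spread b c (b [^] m) = c m" for m :: int
  by (simp add: spread_def the_inv_f_f infinite_order_def)

lemma spread_outside: "y \<notin> range (\<lambda>m::int. b [^] m) \<Longrightarrow> spread b c y = 0"
  by (simp add: spread_def)

lemma infsum_powers:
  fixes F :: "'a \<Rightarrow> 'c::{comm_monoid_add, t2_space}"
  assumes b: "infinite_order b" and F: "\<And>y. y \<notin> range (\<lambda>m::int. b [^] m) \<Longrightarrow> F y = 0"
  shows "(\<Sum>\<^sub>\<infinity>y\<in>carrier G. F y) = (\<Sum>\<^sub>\<infinity>m::int. F (b [^] m))"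
    and "F summable_on carrier G \<longleftrightarrow> (\<lambda>m::int. F (b [^] m)) summable_on UNIV"
proof -
  let ?R = "range (\<lambda>m::int. b [^] m)"
  have R: "?R \<subseteq> carrier G" using infinite_order_closed[OF b] by auto
  have inj: "inj (\<lambda>m::int. b [^] m)" using b by (simp add: infinite_order_def)
  have "infsum F (carrier G) = infsum F ?R"
    by (rule infsum_cong_neutral) (use R F in auto)
  also have "\<dots> = infsum (F \<circ> (\<lambda>m::int. b [^] m)) UNIV"
    by (rule infsum_reindex[OF inj])
  finally show "(\<Sum>\<^sub>\<infinity>y\<in>carrier G. F y) = (\<Sum>\<^sub>\<infinity>m::int. F (b [^] m))" by (simp add: comp_def)
  have "F summable_on carrier G \<longleftrightarrow> F summable_on ?R"
    by (rule summable_on_cong_neutral) (use R F in auto)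
  also have "\<dots> \<longleftrightarrow> (F \<circ> (\<lambda>m::int. b [^] m)) summable_on UNIV"
    by (rule summable_on_reindex[OF inj])
  finally show "F summable_on carrier G \<longleftrightarrow> (\<lambda>m::int. F (b [^] m)) summable_on UNIV"
    by (simp add: comp_def)
qed

lemma spread_ell2:
  assumes b: "infinite_order b" and c: "c \<in> ell2 UNIV"
  shows "spread b c \<in> ell2 (carrier G)"
proof -
  have "(\<lambda>y. (cmod (spread b c y))\<^sup>2) summable_on carrier G"
    using infsum_powers(2)[OF b, of "\<lambda>y. (cmod (spread b c y))\<^sup>2"] ell2_summable[OF c]
    by (simp add: spread_pow[OF b] spread_outside)
  moreover have "spread b c y = 0" if "y \<notin> carrier G" for y
    using that infinite_order_closed[OF b] by (intro spread_outside) auto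
  ultimately show ?thesis by (simp add: ell2_def)
qed

lemma spread_correlation:
  assumes b: "infinite_order b"
  shows "(\<Sum>\<^sub>\<infinity>y\<in>carrier G. spread b c y * cnj (spread b c' (y \<otimes> b [^] k))) = correlation c c' k"
    and "g \<in> carrier G \<Longrightarrow> g \<notin> range (\<lambda>m::int. b [^] m)
      \<Longrightarrow> (\<Sum>\<^sub>\<infinity>y\<in>carrier G. spread b c y * cnj (spread b c' (y \<otimes> g))) = 0"
proof -
  note bG = infinite_order_closed[OF b]
  show "(\<Sum>\<^sub>\<infinity>y\<in>carrier G. spread b c y * cnj (spread b c' (y \<otimes> b [^] k))) = correlation c c' k"
    using infsum_powers(1)[OF b, of "\<lambda>y. spread b c y * cnj (spread b c' (y \<otimes> b [^] k))"]
    by (simp add: spread_outside spread_pow[OF b] int_pow_mult[OF bG, symmetric] correlation_def)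
  assume g: "g \<in> carrier G" "g \<notin> range (\<lambda>m::int. b [^] m)"
  have "b [^] m \<otimes> g \<notin> range (\<lambda>m::int. b [^] m)" for m :: int
  proof
    assume "b [^] m \<otimes> g \<in> range (\<lambda>m::int. b [^] m)"
    then obtain n :: int where "b [^] m \<otimes> g = b [^] n" by blast
    then have "g = b [^] (n - m)"
      using g bG by (metis int_pow_closed int_pow_diff int_pow_mult int_pow_neg add.commute
          diff_conv_add_uminus inv_solve_left)
    then show False using g by blast
  qed
  then show "(\<Sum>\<^sub>\<infinity>y\<in>carrier G. spread b c y * cnj (spread b c' (y \<otimes> g))) = 0"
    using infsum_powers(1)[OF b, of "\<lambda>y. spread b c y * cnj (spread b c' (y \<otimes> g))"]
    by (simp add: spread_outside)
qed

lemma spread_correlation_left: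
  assumes b: "infinite_order b"
  shows "(\<Sum>\<^sub>\<infinity>y\<in>carrier G. cnj (spread b c y) * spread b c' (b [^] k \<otimes> y)) = cnj (correlation c c' k)"
    and "g \<in> carrier G \<Longrightarrow> g \<notin> range (\<lambda>m::int. b [^] m)
      \<Longrightarrow> (\<Sum>\<^sub>\<infinity>y\<in>carrier G. cnj (spread b c y) * spread b c' (g \<otimes> y)) = 0"
proof -
  note bG = infinite_order_closed[OF b]
  have "(\<Sum>\<^sub>\<infinity>y\<in>carrier G. cnj (spread b c y) * spread b c' (b [^] k \<otimes> y))
     = (\<Sum>\<^sub>\<infinity>m. cnj (c m) * c' (m + k))"
    using infsum_powers(1)[OF b, of "\<lambda>y. cnj (spread b c y) * spread b c' (b [^] k \<otimes> y)"]
    by (simp add: spread_outside spread_pow[OF b] int_pow_mult[OF bG, symmetric] add.commute)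
  also have "\<dots> = cnj (correlation c c' k)"
    unfolding correlation_def infsum_cnj[symmetric] by simp
  finally show "(\<Sum>\<^sub>\<infinity>y\<in>carrier G. cnj (spread b c y) * spread b c' (b [^] k \<otimes> y))
    = cnj (correlation c c' k)" .
  assume g: "g \<in> carrier G" "g \<notin> range (\<lambda>m::int. b [^] m)"
  have "g \<otimes> b [^] m \<notin> range (\<lambda>m::int. b [^] m)" for m :: int
  proof
    assume "g \<otimes> b [^] m \<in> range (\<lambda>m::int. b [^] m)"
    then obtain n :: int where "g \<otimes> b [^] m = b [^] n" by auto
    then have "g = b [^] (n - m)"
      using g bG by (metis int_pow_closed int_pow_diff inv_solve_right)
    then show False using g by blast
  qed
  then show "(\<Sum>\<^sub>\<infinity>y\<in>carrier G. cnj (spread b c y) * spread b c' (g \<otimes> y)) = 0"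
    using infsum_powers(1)[OF b, of "\<lambda>y. cnj (spread b c y) * spread b c' (g \<otimes> y)"]
    by (simp add: spread_outside)
qed

lemma spread_unitary_vector:
  assumes b: "infinite_order b" and c: "unitary_sequence c"
  shows "unitary_vector (spread b c)"
proof -
  have delta: "delta \<one> (b [^] k) = delta 0 k" for k :: int
    using infinite_order_eq[OF b, of k 0] by (auto simp: delta_def)
  have one: "delta \<one> g = 0" if "g \<notin> range (\<lambda>m::int. b [^] m)" for g
    using that by (auto simp: delta_def) (metis int_pow_0 rangeI)
  show ?thesis
    unfolding unitary_vector_def
  proof (intro conjI ballI)
    show "spread b c \<in> ell2 (carrier G)"
      using b c by (simp add: spread_ell2 unitary_sequence_def)
    fix g assume g: "g \<in> carrier G"
    show "(\<Sum>\<^sub>\<infinity>y\<in>carrier G. spread b c y * cnj (spread b c (y \<otimes> g))) = delta \<one> g"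
      using spread_correlation(1)[OF b] spread_correlation(2)[OF b g] delta one c
      by (cases "g \<in> range (\<lambda>m::int. b [^] m)") (auto simp: unitary_sequence_def)
    show "(\<Sum>\<^sub>\<infinity>y\<in>carrier G. cnj (spread b c y) * spread b c (g \<otimes> y)) = delta \<one> g"
    proof (cases "g \<in> range (\<lambda>m::int. b [^] m)")
      case True
      then obtain k :: int where k: "g = b [^] k" by blast
      have "cnj (delta 0 k) = delta 0 k" by (simp add: delta_def)
      then show ?thesis
        unfolding k using spread_correlation_left(1)[OF b] delta c by (simp add: unitary_sequence_def)
    qed (use spread_correlation_left(2)[OF b g] one in simp)
  qed
qed

lemma spread_delta: "infinite_order b \<Longrightarrow> spread b (delta 0) = delta \<one>"
proof
  fix y assume b: "infinite_order b"
  show "spread b (delta 0) y = delta \<one> y"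
  proof (cases "y \<in> range (\<lambda>m::int. b [^] m)")
    case True
    then obtain m :: int where m: "y = b [^] m" by blast
    then have "y = \<one> \<longleftrightarrow> m = 0" using infinite_order_eq[OF b, of m 0] by simp
    then show ?thesis using m spread_pow[OF b] by (simp add: delta_def)
  next
    case False
    then have "y \<noteq> \<one>" by (metis int_pow_0 rangeI)
    then show ?thesis using False by (simp add: spread_outside delta_def)
  qed
qed

lemma conj_int_pow:
  assumes "t \<in> carrier G" "b \<in> carrier G"
  shows "(t \<otimes> b \<otimes> inv t) [^] (m::int) = t \<otimes> b [^] m \<otimes> inv t"
proof -
  have hom: "(\<lambda>x. t \<otimes> x \<otimes> inv t) \<in> hom G G"
    using assms by (auto simp: hom_def m_assoc) (simp add: m_assoc[symmetric])
  show ?thesis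
    using hom_int_pow[OF hom assms(2) is_group is_group, of m] by simp
qed

lemma conj_eq_iff:
  assumes "t \<in> carrier G" "x \<in> carrier G" "y \<in> carrier G"
  shows "inv t \<otimes> y \<otimes> t = x \<longleftrightarrow> y = t \<otimes> x \<otimes> inv t"
proof
  assume "inv t \<otimes> y \<otimes> t = x"
  then have "t \<otimes> x \<otimes> inv t = t \<otimes> (inv t \<otimes> y \<otimes> t) \<otimes> inv t" by simp
  also have "\<dots> = y" using assms by (simp add: m_assoc) (simp add: m_assoc[symmetric] assms)
  finally show "y = t \<otimes> x \<otimes> inv t" by simp
next
  assume "y = t \<otimes> x \<otimes> inv t"
  then show "inv t \<otimes> y \<otimes> t = x"
    using assms by (simp add: m_assoc) (simp add: m_assoc[symmetric] assms)
qed

lemma conj_infinite_order: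
  assumes t: "t \<in> carrier G" and b: "infinite_order b"
  shows "infinite_order (t \<otimes> b \<otimes> inv t)"
  using assms infinite_order_closed[OF b] infinite_order_eq[OF b]
  by (auto simp: infinite_order_def inj_def conj_int_pow)

lemma conj_translate_spread:
  assumes t: "t \<in> carrier G" and b: "infinite_order b"
  shows "conj_translate t (spread b c) = spread (t \<otimes> b \<otimes> inv t) c"
proof
  fix y
  note bG = infinite_order_closed[OF b]
  note b' = conj_infinite_order[OF t b]
  show "conj_translate t (spread b c) y = spread (t \<otimes> b \<otimes> inv t) c y"
  proof (cases "y \<in> range (\<lambda>m::int. (t \<otimes> b \<otimes> inv t) [^] m)")
    case True
    then obtain m :: int where m: "y = (t \<otimes> b \<otimes> inv t) [^] m" by blast
    then have "y \<in> carrier G" "inv t \<otimes> y \<otimes> t = b [^] m"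
      using conj_eq_iff[OF t] conj_int_pow[OF t bG] t bG by simp_all
    then show ?thesis
      using m spread_pow[OF b'] spread_pow[OF b] by (simp add: conj_translate_def)
  next
    case False
    then have "inv t \<otimes> y \<otimes> t \<notin> range (\<lambda>m::int. b [^] m)" if "y \<in> carrier G"
      using conj_eq_iff[OF t] conj_int_pow[OF t bG] t bG that by auto
    then show ?thesis
      using False by (simp add: conj_translate_def spread_outside)
  qed
qed

lemma conj_translate_convolution:
  assumes t: "t \<in> carrier G" and \<eta>: "\<eta> \<in> ell2 (carrier G)"
  shows "conj_translate t (left_convolution \<xi> \<eta>)
    = left_convolution (conj_translate t \<xi>) (conj_translate t \<eta>)"
proof
  fix y
  note \<eta>' = conj_translate_ell2[OF t \<eta>]
  show "conj_translate t (left_convolution \<xi> \<eta>) y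
    = left_convolution (conj_translate t \<xi>) (conj_translate t \<eta>) y"
  proof (cases "y \<in> carrier G")
    case True
    have "left_convolution (conj_translate t \<xi>) (conj_translate t \<eta>) y
      = (\<Sum>\<^sub>\<infinity>x\<in>carrier G. conj_translate t \<eta> x * conj_translate t \<xi> (y \<otimes> inv x))"
      by (rule left_convolution_apply[OF \<eta>' True])
    also have "\<dots> = (\<Sum>\<^sub>\<infinity>x\<in>carrier G. \<eta> (inv t \<otimes> x \<otimes> t) * \<xi> ((inv t \<otimes> y \<otimes> t) \<otimes> inv (inv t \<otimes> x \<otimes> t)))"
    proof (rule infsum_cong)
      fix x assume x: "x \<in> carrier G"
      have "(inv t \<otimes> y \<otimes> t) \<otimes> inv (inv t \<otimes> x \<otimes> t) = inv t \<otimes> (y \<otimes> inv x) \<otimes> t"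
        using t x True by (simp add: inv_mult_group m_assoc) (simp add: m_assoc[symmetric] t x True)
      then show "conj_translate t \<eta> x * conj_translate t \<xi> (y \<otimes> inv x)
        = \<eta> (inv t \<otimes> x \<otimes> t) * \<xi> ((inv t \<otimes> y \<otimes> t) \<otimes> inv (inv t \<otimes> x \<otimes> t))"
        using x True by (simp add: conj_translate_def)
    qed
    also have "\<dots> = (\<Sum>\<^sub>\<infinity>x\<in>carrier G. \<eta> x * \<xi> ((inv t \<otimes> y \<otimes> t) \<otimes> inv x))"
      by (rule infsum_reindex_bij_betw[OF bij_conj[OF t]])
    also have "\<dots> = conj_translate t (left_convolution \<xi> \<eta>) y"
      using True t by (simp add: conj_translate_def left_convolution_apply[OF \<eta>])
    finally show ?thesis by simp
  next
    case False
    then show ?thesis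
      using \<eta>' by (simp add: conj_translate_def left_convolution_def)
  qed
qed

lemma left_convolution_support:
  assumes H: "subgroup H G" and "\<And>y. y \<notin> H \<Longrightarrow> \<xi> y = 0" and "\<And>y. y \<notin> H \<Longrightarrow> \<eta> y = 0"
    and \<eta>: "\<eta> \<in> ell2 (carrier G)" and y: "y \<notin> H"
  shows "left_convolution \<xi> \<eta> y = 0"
proof (cases "y \<in> carrier G")
  case True
  have "\<eta> x * \<xi> (y \<otimes> inv x) = 0" if x: "x \<in> carrier G" for x
  proof (cases "x \<in> H")
    case True
    then have "y \<otimes> inv x \<notin> H"
      using subgroup.m_closed[OF H, of "y \<otimes> inv x" x] x \<open>y \<in> carrier G\<close> y by (auto simp: m_assoc)
    then show ?thesis using assms by simp
  qed (use assms in simp)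
  then show ?thesis
    using left_convolution_apply[OF \<eta> True] by (simp add: infsum_0)
next
  case False
  then show ?thesis using \<eta> by (simp add: left_convolution_def)
qed

text \<open>
  The vectors supported on \<open>H\<close> see of the operator \<open>L(\<xi>)\<^sup>* L(\<xi>')\<close> only its coefficients on \<open>H\<close>. If those
  vanish away from the neutral element, the operator acts on the inner product as the scalar
  \<open>\<langle>\<xi>', \<xi>\<rangle>\<close>: this is independence of \<open>L(\<xi>)\<close>, \<open>L(\<xi>')\<close> from the functions of the elements of \<open>H\<close>.
\<close>

lemma left_convolution_inner:
  assumes \<xi>: "unitary_vector \<xi>" and \<xi>': "unitary_vector \<xi>'" and H: "subgroup H G"
    and \<eta>: "\<eta> \<in> ell2 (carrier G)" "\<And>y. y \<notin> H \<Longrightarrow> \<eta> y = 0"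
    and \<eta>': "\<eta>' \<in> ell2 (carrier G)" "\<And>y. y \<notin> H \<Longrightarrow> \<eta>' y = 0"
    and ortho: "\<And>h. h \<in> H \<Longrightarrow> h \<noteq> \<one> \<Longrightarrow> (\<Sum>\<^sub>\<infinity>y\<in>carrier G. \<xi>' y * cnj (\<xi> (y \<otimes> h))) = 0"
  shows "ell2_inner (carrier G) (left_convolution \<xi>' \<eta>') (left_convolution \<xi> \<eta>)
    = (\<Sum>\<^sub>\<infinity>y\<in>carrier G. \<xi>' y * cnj (\<xi> y)) * ell2_inner (carrier G) \<eta>' \<eta>"
proof -
  let ?X = "carrier G"
  let ?L = "left_convolution \<xi>" and ?L' = "left_convolution \<xi>'"
  let ?C = "\<lambda>h. \<Sum>\<^sub>\<infinity>y\<in>?X. \<xi>' y * cnj (\<xi> (y \<otimes> h))"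
  have HX: "x \<in> ?X" if "x \<in> H" for x using subgroup.mem_carrier[OF H that] .
  note L = left_convolution_bounded[OF \<xi>] and L' = left_convolution_bounded[OF \<xi>']
  define S where "S = op_mult ?X (op_adjoint ?X ?L) ?L'"
  have S: "S \<in> bounded_ops ?X"
    unfolding S_def by (intro op_mult_bounded op_adjoint_bounded L L')
  have entry: "S (delta z) x = ?C (z \<otimes> inv x)" if zx: "z \<in> ?X" "x \<in> ?X" for z x
  proof -
    note d = delta_ell2[OF zx(1)] delta_ell2[OF zx(2)]
    have "S (delta z) x = ell2_inner ?X (op_adjoint ?X ?L (?L' (delta z))) (delta x)"
      using ell2_inner_delta[OF bounded_ops_ell2[OF S d(1)] zx(2)] d by (simp add: S_def op_mult_apply)
    also have "\<dots> = ell2_inner ?X (?L' (delta z)) (?L (delta x))"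
      by (rule op_adjoint_inner'[OF L bounded_ops_ell2[OF L' d(1)] d(2)])
    also have "\<dots> = ?C (z \<otimes> inv x)"
      using zx by (simp add: left_convolution_delta[OF \<xi>] left_convolution_delta[OF \<xi>'] right_shift_inner)
    finally show ?thesis .
  qed
  have S_eta: "S \<eta>' x = ?C \<one> * \<eta>' x" if x: "x \<in> H" for x
  proof -
    have "S \<eta>' x = (\<Sum>\<^sub>\<infinity>z\<in>?X. \<eta>' z * S (delta z) x)"
      by (rule infsumI[OF bounded_op_expansion[OF S \<eta>'(1)], symmetric])
    also have "\<dots> = (\<Sum>\<^sub>\<infinity>z\<in>{x}. \<eta>' z * ?C \<one>)"
    proof (rule infsum_cong_neutral)
      fix z assume z: "z \<in> ?X - {x}"
      show "\<eta>' z * S (delta z) x = 0"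
      proof (cases "z \<in> H")
        case True
        then have "z \<otimes> inv x \<in> H" "z \<otimes> inv x \<noteq> \<one>"
          using x z HX subgroup.m_closed[OF H True subgroup.m_inv_closed[OF H x]]
          by (auto simp: mult_inv_eq_iff)
        then have "?C (z \<otimes> inv x) = 0" by (rule ortho)
        then show ?thesis using entry[of z x] z x HX by simp
      qed (simp add: \<eta>'(2))
    qed (use x HX entry in auto)
    finally show ?thesis by simp
  qed
  have "ell2_inner ?X (?L' \<eta>') (?L \<eta>) = ell2_inner ?X (S \<eta>') \<eta>"
    using op_adjoint_inner'[OF L bounded_ops_ell2[OF L' \<eta>'(1)] \<eta>(1)] \<eta>'(1)
    by (simp add: S_def op_mult_apply)
  also have "\<dots> = (\<Sum>\<^sub>\<infinity>x\<in>?X. ?C \<one> * (\<eta>' x * cnj (\<eta> x)))"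
    unfolding ell2_inner_def
  proof (rule infsum_cong)
    fix x assume "x \<in> ?X"
    show "S \<eta>' x * cnj (\<eta> x) = ?C \<one> * (\<eta>' x * cnj (\<eta> x))"
      by (cases "x \<in> H") (auto simp: S_eta \<eta>(2) mult.assoc)
  qed
  also have "\<dots> = ?C \<one> * ell2_inner ?X \<eta>' \<eta>"
    unfolding ell2_inner_def by (rule infsum_cmult_right')
  also have "?C \<one> = (\<Sum>\<^sub>\<infinity>y\<in>?X. \<xi>' y * cnj (\<xi> y))"
    by (rule infsum_cong) simp
  finally show ?thesis .
qed

section \<open>Products over several cyclic subgroups\<close>

text \<open>
  The recursion peels off the first factor, because independence is proved for the first factor
  against all later ones.
\<close>

primrec product_op :: "nat \<Rightarrow> (nat \<Rightarrow> 'a) \<Rightarrow> (nat \<Rightarrow> int \<Rightarrow> complex) \<Rightarrow> 'a ell2_op" where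
  "product_op 0 b c = op_one (carrier G)"
| "product_op (Suc n) b c = op_mult (carrier G) (left_convolution (spread (b 0) (c 0)))
     (product_op n (b \<circ> Suc) (c \<circ> Suc))"

abbreviation product_vector :: "nat \<Rightarrow> (nat \<Rightarrow> 'a) \<Rightarrow> (nat \<Rightarrow> int \<Rightarrow> complex) \<Rightarrow> 'a \<Rightarrow> complex" where
  "product_vector n b c \<equiv> product_op n b c (delta \<one>)"

lemma product_op_vN_unitary:
  assumes "\<And>i. i < n \<Longrightarrow> infinite_order (b i)" "\<And>i. i < n \<Longrightarrow> unitary_sequence (c i)"
  shows "product_op n b c \<in> group_vN_algebra G \<and> unitary_op (carrier G) (product_op n b c)"
  using assms
proof (induction n arbitrary: b c)
  case 0
  then show ?case by (simp add: vN_one unitary_op_one)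
next
  case (Suc n)
  have u: "unitary_vector (spread (b 0) (c 0))"
    using Suc.prems by (simp add: spread_unitary_vector)
  have "product_op n (b \<circ> Suc) (c \<circ> Suc) \<in> group_vN_algebra G
      \<and> unitary_op (carrier G) (product_op n (b \<circ> Suc) (c \<circ> Suc))"
    by (rule Suc.IH) (use Suc.prems in auto)
  then show ?case
    by (auto intro: vN_mult unitary_op_mult left_convolution_vN[OF u] left_convolution_unitary[OF u])
qed

lemma product_vector_ell2:
  assumes "\<And>i. i < n \<Longrightarrow> infinite_order (b i)" "\<And>i. i < n \<Longrightarrow> unitary_sequence (c i)"
  shows "product_vector n b c \<in> ell2 (carrier G)"
  by (rule bounded_ops_ell2[OF vN_bounded[OF conjunct1[OF product_op_vN_unitary[OF assms]]]
      delta_ell2[OF one_closed]])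

lemma product_vector_Suc:
  "product_vector (Suc n) b c = left_convolution (spread (b 0) (c 0)) (product_vector n (b \<circ> Suc) (c \<circ> Suc))"
  by (simp add: op_mult_apply delta_ell2)

lemma product_vector_support:
  assumes "\<And>i. i < n \<Longrightarrow> infinite_order (b i)" "\<And>i. i < n \<Longrightarrow> unitary_sequence (c i)"
    and H: "subgroup H G" "\<And>i. i < n \<Longrightarrow> b i \<in> H" and "y \<notin> H"
  shows "product_vector n b c y = 0"
  using assms(1,2) H(2) \<open>y \<notin> H\<close>
proof (induction n arbitrary: b c y)
  case 0
  then show ?case
    using subgroup.one_closed[OF H(1)] by (simp add: op_one_apply delta_ell2) (auto simp: delta_def)
next
  case (Suc n)
  show ?case
    unfolding product_vector_Suc
  proof (rule left_convolution_support[OF H(1) _ _ _ \<open>y \<notin> H\<close>])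
    show "product_vector n (b \<circ> Suc) (c \<circ> Suc) \<in> ell2 (carrier G)"
      by (rule product_vector_ell2) (use Suc.prems in auto)
    fix z assume z: "z \<notin> H"
    show "product_vector n (b \<circ> Suc) (c \<circ> Suc) z = 0"
      by (rule Suc.IH) (use Suc.prems z in auto)
    have "b 0 [^] m \<in> H" for m :: int
      using Suc.prems(3)[of 0] subgroup_int_pow_closed[OF H(1)] by simp
    then show "spread (b 0) (c 0) z = 0"
      using z by (intro spread_outside) auto
  qed
qed

text \<open>
  By induction, each factor is independent of the later ones: the subgroup \<open>H\<close> contains all later
  generators, and meets the cyclic group of \<open>b i\<close> in exponents at which the correlation vanishes.
\<close>

lemma product_vector_inner:
  assumes "\<And>i. i < n \<Longrightarrow> infinite_order (b i)"
    and "\<And>i. i < n \<Longrightarrow> unitary_sequence (c i)" "\<And>i. i < n \<Longrightarrow> unitary_sequence (c' i)"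
    and "\<And>i k. i < n \<Longrightarrow> P dvd k \<Longrightarrow> k \<noteq> 0 \<Longrightarrow> correlation (c' i) (c i) k = 0"
    and "\<And>i. i < n \<Longrightarrow> \<exists>H. subgroup H G \<and> (\<forall>j<n. i < j \<longrightarrow> b j \<in> H)
       \<and> (\<forall>k::int. b i [^] k \<in> H \<longrightarrow> P dvd k)"
  shows "ell2_inner (carrier G) (product_vector n b c') (product_vector n b c)
    = (\<Prod>i<n. correlation (c' i) (c i) 0)"
  using assms
proof (induction n arbitrary: b c c')
  case 0
  have "ell2_inner (carrier G) (delta \<one>) (delta \<one>) = delta \<one> \<one>"
    by (rule ell2_inner_delta) (simp_all add: delta_ell2)
  then show ?case by (simp add: op_one_apply delta_ell2) (simp add: delta_def)
next
  case (Suc n)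
  obtain H where H: "subgroup H G" "\<And>j. j < Suc n \<Longrightarrow> 0 < j \<Longrightarrow> b j \<in> H"
    "\<And>k::int. b 0 [^] k \<in> H \<Longrightarrow> P dvd k"
    using Suc.prems(5)[of 0] by auto
  have b0: "infinite_order (b 0)" using Suc.prems by simp
  have ortho: "(\<Sum>\<^sub>\<infinity>y\<in>carrier G. spread (b 0) (c' 0) y * cnj (spread (b 0) (c 0) (y \<otimes> h))) = 0"
    if h: "h \<in> H" "h \<noteq> \<one>" for h
  proof (cases "h \<in> range (\<lambda>m::int. b 0 [^] m)")
    case True
    then obtain k :: int where k: "h = b 0 [^] k" by blast
    then have "P dvd k" "k \<noteq> 0" using H h by auto
    then show ?thesis
      using spread_correlation(1)[OF b0] Suc.prems(4)[of 0 k] k by simp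
  next
    case False
    then show ?thesis
      using spread_correlation(2)[OF b0] subgroup.mem_carrier[OF H(1) h(1)] by blast
  qed
  have corr0: "(\<Sum>\<^sub>\<infinity>y\<in>carrier G. spread (b 0) (c' 0) y * cnj (spread (b 0) (c 0) y))
      = correlation (c' 0) (c 0) 0"
  proof -
    have "(\<Sum>\<^sub>\<infinity>y\<in>carrier G. spread (b 0) (c' 0) y * cnj (spread (b 0) (c 0) y))
      = (\<Sum>\<^sub>\<infinity>y\<in>carrier G. spread (b 0) (c' 0) y * cnj (spread (b 0) (c 0) (y \<otimes> b 0 [^] (0::int))))"
      by (rule infsum_cong) simp
    then show ?thesis using spread_correlation(1)[OF b0, of "c' 0" "c 0" 0] by simp
  qed
  have "ell2_inner (carrier G) (product_vector (Suc n) b c') (product_vector (Suc n) b c)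
     = (\<Sum>\<^sub>\<infinity>y\<in>carrier G. spread (b 0) (c' 0) y * cnj (spread (b 0) (c 0) y))
       * ell2_inner (carrier G) (product_vector n (b \<circ> Suc) (c' \<circ> Suc)) (product_vector n (b \<circ> Suc) (c \<circ> Suc))"
    unfolding product_vector_Suc
  proof (rule left_convolution_inner[OF _ _ H(1)])
    show "unitary_vector (spread (b 0) (c 0))" "unitary_vector (spread (b 0) (c' 0))"
      using Suc.prems by (auto intro: spread_unitary_vector)
    show "product_vector n (b \<circ> Suc) (c' \<circ> Suc) \<in> ell2 (carrier G)"
      "product_vector n (b \<circ> Suc) (c \<circ> Suc) \<in> ell2 (carrier G)"
      by (rule product_vector_ell2; use Suc.prems in auto)+
    show "product_vector n (b \<circ> Suc) (c' \<circ> Suc) y = 0"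
      "product_vector n (b \<circ> Suc) (c \<circ> Suc) y = 0" if "y \<notin> H" for y
      by (rule product_vector_support[OF _ _ H(1) _ that]; use Suc.prems H in auto)+
  qed (rule ortho)
  also have "ell2_inner (carrier G) (product_vector n (b \<circ> Suc) (c' \<circ> Suc)) (product_vector n (b \<circ> Suc) (c \<circ> Suc))
     = (\<Prod>i<n. correlation ((c' \<circ> Suc) i) ((c \<circ> Suc) i) 0)"
  proof (rule Suc.IH)
    fix i assume "i < n"
    then obtain K where "subgroup K G" "\<forall>j<Suc n. Suc i < j \<longrightarrow> b j \<in> K"
        "\<forall>k::int. b (Suc i) [^] k \<in> K \<longrightarrow> P dvd k"
      using Suc.prems(5)[of "Suc i"] by auto
    then show "\<exists>H. subgroup H G \<and> (\<forall>j<n. i < j \<longrightarrow> (b \<circ> Suc) j \<in> H)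
       \<and> (\<forall>k::int. (b \<circ> Suc) i [^] k \<in> H \<longrightarrow> P dvd k)"
      by (intro exI[of _ K]) auto
  qed (use Suc.prems in auto)
  finally show ?case
    unfolding corr0 prod.lessThan_Suc_shift by simp
qed

text \<open>
  The sequence \<open>delta 0\<close> represents the constant function \<open>1\<close>, so trivial factors can be added at both
  ends. This lets a product and its shift be written over the same list of generators.
\<close>

lemma product_vector_append_delta:
  assumes "\<And>i. i < Suc n \<Longrightarrow> infinite_order (b i)" and "\<And>i. i < n \<Longrightarrow> unitary_sequence (c i)"
    and "c n = delta 0"
  shows "product_vector (Suc n) b c = product_vector n b c"
  using assms
proof (induction n arbitrary: b c)
  case 0
  then show ?case
    by (simp add: op_mult_apply delta_ell2 op_one_apply spread_delta left_convolution_delta_one)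
next
  case (Suc n)
  then have "product_vector (Suc n) (b \<circ> Suc) (c \<circ> Suc) = product_vector n (b \<circ> Suc) (c \<circ> Suc)"
    by (intro Suc.IH) auto
  then show ?case
    unfolding product_vector_Suc[of _ b c] by (simp del: product_op.simps)
qed

lemma product_vector_prepend_delta:
  assumes "\<And>i. i < Suc n \<Longrightarrow> infinite_order (b i)" and "\<And>i. i < Suc n \<Longrightarrow> unitary_sequence (c i)"
    and "c 0 = delta 0"
  shows "product_vector (Suc n) b c = product_vector n (b \<circ> Suc) (c \<circ> Suc)"
proof -
  have "product_vector n (b \<circ> Suc) (c \<circ> Suc) \<in> ell2 (carrier G)"
    by (rule product_vector_ell2) (use assms in auto)
  then show ?thesis
    unfolding product_vector_Suc using assms by (simp add: spread_delta left_convolution_delta_one)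
qed

lemma conj_translate_delta_one: "t \<in> carrier G \<Longrightarrow> conj_translate t (delta \<one>) = delta \<one>"
  by (auto simp: conj_translate_def delta_def fun_eq_iff conj_eq_iff)

lemma conj_translate_product:
  assumes t: "t \<in> carrier G"
    and "\<And>i. i < n \<Longrightarrow> infinite_order (b i)" "\<And>i. i < n \<Longrightarrow> unitary_sequence (c i)"
  shows "conj_translate t (product_vector n b c) = product_vector n (\<lambda>i. t \<otimes> b i \<otimes> inv t) c"
  using assms(2-)
proof (induction n arbitrary: b c)
  case 0
  then show ?case by (simp add: op_one_apply delta_ell2 conj_translate_delta_one t)
next
  case (Suc n)
  have e: "product_vector n (b \<circ> Suc) (c \<circ> Suc) \<in> ell2 (carrier G)"
    by (rule product_vector_ell2) (use Suc.prems in auto)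
  have "conj_translate t (product_vector n (b \<circ> Suc) (c \<circ> Suc))
      = product_vector n (\<lambda>i. t \<otimes> (b \<circ> Suc) i \<otimes> inv t) (c \<circ> Suc)"
    by (rule Suc.IH) (use Suc.prems in auto)
  moreover have "(\<lambda>i. t \<otimes> (b \<circ> Suc) i \<otimes> inv t) = (\<lambda>i. t \<otimes> b i \<otimes> inv t) \<circ> Suc"
    by auto
  ultimately show ?case
    unfolding product_vector_Suc
    using conj_translate_convolution[OF t e] conj_translate_spread[OF t] Suc.prems by simp
qed

end


section \<open>Reciprocals in a residue class\<close>

lemma filterlim_symmetric_intervals:
  "filterlim (\<lambda>N. {- int N..<int N}) (finite_subsets_at_top UNIV) sequentially"
  unfolding filterlim_finite_subsets_at_top
proof (intro allI impI)
  fix X :: "int set" assume X: "finite X \<and> X \<subseteq> UNIV"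
  then obtain B where B: "\<And>x. x \<in> X \<Longrightarrow> \<bar>x\<bar> < B"
    using finite_int_iff_bounded[of X] by auto
  show "\<forall>\<^sub>F N in sequentially. finite {- int N..<int N} \<and> X \<subseteq> {- int N..<int N} \<and> {- int N..<int N} \<subseteq> UNIV"
    using eventually_ge_at_top[of "nat B"]
  proof eventually_elim
    case (elim N)
    then show ?case using B by force
  qed
qed

lemma has_sum_imp_symmetric_LIMSEQ:
  fixes f :: "int \<Rightarrow> 'a::{comm_monoid_add, topological_space}"
  assumes "(f has_sum S) UNIV"
  shows "(\<lambda>N. \<Sum>y\<in>{- int N..<int N}. f y) \<longlonglongrightarrow> S"
  using filterlim_compose[OF assms[unfolded has_sum_def] filterlim_symmetric_intervals] .

text \<open>
  Summed over a symmetric interval, only \<open>n\<close> terms at either end remain, and these tend to \<open>0\<close>.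
\<close>

lemma infsum_telescope_nat:
  fixes F :: "int \<Rightarrow> complex" and n :: nat
  assumes decay: "\<And>y. cmod (F y) \<le> 1 / \<bar>of_int y\<bar>"
    and sm: "(\<lambda>y. F y - F (y + int n)) summable_on UNIV"
  shows "(\<Sum>\<^sub>\<infinity>y. F y - F (y + int n)) = 0"
proof -
  have block: "(\<Sum>y\<in>{- int N..<int N}. F y - F (y + int n))
      = (\<Sum>i<n. F (- int N + int i) - F (int N + int i))" for N n
  proof (induction n)
    case (Suc n)
    have step: "(\<Sum>y\<in>{- int N..<int N}. F (y + int n) - F (y + int n + 1)) = F (- int N + int n) - F (int N + int n)"
    proof (induction N)
      case (Suc N)
      have "{- int (Suc N)..<int (Suc N)} = insert (- int N - 1) (insert (int N) {- int N..<int N})"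
        by auto
      then show ?case using Suc by (simp add: algebra_simps)
    qed simp
    have "(\<Sum>y\<in>{- int N..<int N}. F y - F (y + int (Suc n)))
      = (\<Sum>y\<in>{- int N..<int N}. F y - F (y + int n))
        + (\<Sum>y\<in>{- int N..<int N}. F (y + int n) - F (y + int n + 1))"
      unfolding sum.distrib[symmetric] by (intro sum.cong) (simp_all add: algebra_simps)
    then show ?case using Suc step by simp
  qed simp
  have lim: "(\<lambda>N. F (\<sigma> * int N + int i)) \<longlonglongrightarrow> 0" if "\<sigma> = 1 \<or> \<sigma> = -1" for \<sigma> i
  proof (rule Lim_null_comparison)
    show "\<forall>\<^sub>F N in sequentially. norm (F (\<sigma> * int N + int i)) \<le> 1 / (real N - real i)"
      using eventually_gt_at_top[of i]
    proof eventually_elim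
      case (elim N)
      have "norm (F (\<sigma> * int N + int i)) \<le> 1 / \<bar>of_int (\<sigma> * int N + int i)\<bar>"
        by (rule decay)
      also have "\<dots> \<le> 1 / (real N - real i)"
        using elim that by (intro divide_left_mono) (auto intro!: mult_pos_pos)
      finally show ?case .
    qed
    have "filterlim (\<lambda>N. - real i + real N) at_top sequentially"
      by (rule filterlim_tendsto_add_at_top[OF tendsto_const filterlim_real_sequentially])
    then show "(\<lambda>N. 1 / (real N - real i)) \<longlonglongrightarrow> 0"
      by (intro tendsto_divide_0[OF tendsto_const] filterlim_at_top_imp_at_infinity) simp
  qed
  have "(\<lambda>N. \<Sum>i<n. F (- int N + int i) - F (int N + int i)) \<longlonglongrightarrow> (\<Sum>i<n. 0 - 0)"
    using lim[of "-1"] lim[of 1] by (intro tendsto_sum tendsto_diff) simp_all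
  moreover have "(\<lambda>N. \<Sum>i<n. F (- int N + int i) - F (int N + int i)) \<longlonglongrightarrow> (\<Sum>\<^sub>\<infinity>y. F y - F (y + int n))"
    using has_sum_imp_symmetric_LIMSEQ[OF has_sum_infsum[OF sm]] by (simp add: block)
  ultimately show ?thesis
    using LIMSEQ_unique by fastforce
qed

lemma bij_add_int: "bij_betw (\<lambda>x. x + (k::int)) UNIV UNIV"
  by (rule bij_betw_byWitness[where f' = "\<lambda>x. x - k"]) auto

lemma infsum_telescope:
  fixes F :: "int \<Rightarrow> complex" and n :: int
  assumes decay: "\<And>y. cmod (F y) \<le> 1 / \<bar>of_int y\<bar>"
    and sm: "(\<lambda>y. F y - F (y + n)) summable_on UNIV"
  shows "(\<Sum>\<^sub>\<infinity>y. F y - F (y + n)) = 0"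
proof (cases "n \<ge> 0")
  case True
  then show ?thesis using infsum_telescope_nat[OF decay, of "nat n"] sm by simp
next
  case False
  have eq: "F y - F (y + n) = - (F (y + n) - F ((y + n) + int (nat (- n))))" for y
    using False by simp
  have sm': "(\<lambda>y. F y - F (y + int (nat (- n)))) summable_on UNIV"
  proof -
    have "(\<lambda>y. F (y + n) - F ((y + n) + int (nat (- n)))) summable_on UNIV"
      using summable_on_uminus[THEN iffD2, OF sm] eq by simp
    then show ?thesis
      using summable_on_reindex_bij_betw[OF bij_add_int[of n], of "\<lambda>y. F y - F (y + int (nat (- n)))"]
      by simp
  qed
  have "(\<Sum>\<^sub>\<infinity>y. F y - F (y + n)) = - (\<Sum>\<^sub>\<infinity>y. F (y + n) - F ((y + n) + int (nat (- n))))"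
    unfolding infsum_uminus[symmetric] using eq by simp
  also have "(\<Sum>\<^sub>\<infinity>y. F (y + n) - F ((y + n) + int (nat (- n)))) = (\<Sum>\<^sub>\<infinity>y. F y - F (y + int (nat (- n))))"
    by (rule infsum_reindex_bij_betw[OF bij_add_int])
  also have "\<dots> = 0"
    by (rule infsum_telescope_nat[OF decay sm'])
  finally show ?thesis by simp
qed

definition recip_class :: "nat \<Rightarrow> nat \<Rightarrow> int \<Rightarrow> complex" where
  "recip_class P j = (\<lambda>m. if m mod int P = int j mod int P then 1 / of_int m else 0)"

lemma recip_class_bound: "cmod (recip_class P j y) \<le> 1 / \<bar>of_int y\<bar>"
  by (simp add: recip_class_def norm_divide)

lemma recip_ell2: "(\<lambda>m::int. 1 / of_int m) \<in> ell2 UNIV"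
proof -
  have nat: "(\<lambda>n::nat. 1 / (real n)\<^sup>2) summable_on UNIV"
    using inverse_power_summable[of 2, where ?'a = real]
    by (subst summable_on_UNIV_nonneg_real_iff) (simp_all add: inverse_eq_divide)
  have "(\<lambda>m::int. 1 / (real_of_int m)\<^sup>2) summable_on ({0..} \<union> {..<0})"
  proof (rule summable_on_union)
    have "inj_on nat {0..}" by (auto simp: inj_on_def)
    moreover have "nat ` {0..} = UNIV"
      by (auto simp: image_iff) (metis nat_int of_nat_0_le_iff atLeast_iff)
    ultimately have "(\<lambda>n. 1 / (real n)\<^sup>2) \<circ> nat summable_on {0..}"
      using summable_on_reindex[of nat "{0..}" "\<lambda>n. 1 / (real n)\<^sup>2"] nat by simp
    then show "(\<lambda>m::int. 1 / (real_of_int m)\<^sup>2) summable_on {0..}"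
      by (rule summable_on_cong[THEN iffD1, rotated]) auto
    have inj: "inj_on (\<lambda>m. nat (- m)) {..<0}" by (auto simp: inj_on_def)
    have "(\<lambda>n. 1 / (real n)\<^sup>2) summable_on ((\<lambda>m. nat (- m)) ` {..<0})"
      by (rule summable_on_subset_banach[OF nat]) simp
    then have "(\<lambda>n. 1 / (real n)\<^sup>2) \<circ> (\<lambda>m. nat (- m)) summable_on {..<0}"
      by (simp add: summable_on_reindex[OF inj])
    then show "(\<lambda>m::int. 1 / (real_of_int m)\<^sup>2) summable_on {..<0}"
      by (rule summable_on_cong[THEN iffD1, rotated]) auto
  qed
  moreover have "{0..} \<union> {..<0} = (UNIV :: int set)" by auto
  ultimately show ?thesis
    by (simp add: ell2_def norm_divide power_divide)
qed

lemma recip_class_ell2: "recip_class P j \<in> ell2 UNIV"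
  using ell2_restrict[OF recip_ell2, of "{m. m mod int P = int j mod int P}"]
  by (simp add: recip_class_def)

text \<open>
  The difference of two reciprocals \<open>1 / y\<close> and \<open>1 / (y + n)\<close> is \<open>n / (y (y + n))\<close>, which is summable as a
  product of two square-summable functions.
\<close>

lemma recip_class_shift:
  assumes "int P dvd n"
  shows "(\<Sum>\<^sub>\<infinity>y. recip_class P j y - recip_class P j (y + n)) = 0"
    and "(\<lambda>y. recip_class P j y - recip_class P j (y + n)) summable_on UNIV"
proof -
  let ?r = "recip_class P j"
  have shift: "(\<lambda>y. ?r (y + n)) \<in> ell2 UNIV"
    using ell2_reindex(1)[OF bij_add_int[of n] recip_class_ell2] by simp
  have prod: "(\<lambda>y. cmod (?r y) * cmod (?r (y + n))) summable_on UNIV"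
    by (rule ell2_product_summable[OF recip_class_ell2 shift])
  \<comment> \<open>the terms with a vanishing denominator are finitely many exceptions\<close>
  have "(\<lambda>y. of_int \<bar>n\<bar> * (cmod (?r y) * cmod (?r (y + n)))) summable_on (- {0, - n})"
    by (intro summable_on_cmult_right summable_on_subset_banach[OF prod]) simp
  then have "(\<lambda>y. cmod (?r y - ?r (y + n))) summable_on (- {0, - n})"
  proof (rule summable_on_comparison_test)
    fix y :: int assume y: "y \<in> - {0, - n}"
    have cl: "(y + n) mod int P = int j mod int P \<longleftrightarrow> y mod int P = int j mod int P"
      using assms by (metis mod_add_right_eq mod_0_imp_dvd dvd_imp_mod_0 add.right_neutral mod_add_cong)
    show "cmod (?r y - ?r (y + n)) \<le> of_int \<bar>n\<bar> * (cmod (?r y) * cmod (?r (y + n)))"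
    proof (cases "y mod int P = int j mod int P")
      case True
      have nz: "(of_int y :: complex) \<noteq> 0" "(of_int (y + n) :: complex) \<noteq> 0"
        using y by (auto simp del: of_int_add)
      have "1 / of_int y - 1 / of_int (y + n) = (of_int n * (1 / of_int y * (1 / of_int (y + n))) :: complex)"
        using nz by (simp add: field_simps)
      then have "cmod (?r y - ?r (y + n)) = cmod (of_int n * (1 / of_int y * (1 / of_int (y + n))))"
        using True cl by (simp add: recip_class_def)
      then show ?thesis
        using True cl by (simp add: recip_class_def norm_mult norm_divide)
    qed (use cl in \<open>simp add: recip_class_def\<close>)
  qed simp
  then have "(\<lambda>y. ?r y - ?r (y + n)) summable_on (- {0, - n})"
    by (rule abs_summable_summable)
  then have "(\<lambda>y. ?r y - ?r (y + n)) summable_on (- {0, - n} \<union> {0, - n})"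
    by (rule summable_on_union) simp
  moreover have "- {0, - n} \<union> {0, - n} = UNIV" by auto
  ultimately show sm: "(\<lambda>y. ?r y - ?r (y + n)) summable_on UNIV"
    by (simp only:)
  show "(\<Sum>\<^sub>\<infinity>y. ?r y - ?r (y + n)) = 0"
    by (rule infsum_telescope[OF recip_class_bound sm])
qed

text \<open>
  For \<open>k\<close> not divisible by \<open>P\<close> the supports are disjoint; otherwise the partial fraction decomposition of
  \<open>1 / (m (m + k))\<close> turns the sum into a telescoping one.
\<close>

lemma recip_class_correlation:
  assumes P: "P \<ge> 2" and k: "k \<noteq> 0"
  shows "correlation (recip_class P 1) (recip_class P 1) k = 0"
proof (cases "int P dvd k")
  case True
  let ?r = "recip_class P 1"
  have "?r m * cnj (?r (m + k)) = (1 / of_int k) * (?r m - ?r (m + k))" for m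
  proof (cases "m mod int P = 1")
    case m: True
    then have mk: "(m + k) mod int P = 1"
      using True by (metis mod_add_right_eq dvd_imp_mod_0 add.right_neutral)
    have "m \<noteq> 0" "m + k \<noteq> 0" using m mk by auto
    then have "(of_int m :: complex) \<noteq> 0" "(of_int (m + k) :: complex) \<noteq> 0"
      by (simp_all del: of_int_add)
    then show ?thesis
      using m mk P k by (simp add: recip_class_def field_simps)
  next
    case m: False
    then have "(m + k) mod int P \<noteq> 1"
      using True by (metis mod_add_right_eq dvd_imp_mod_0 add.right_neutral)
    then show ?thesis
      using m P by (simp add: recip_class_def)
  qed
  then have "correlation ?r ?r k = (1 / of_int k) * (\<Sum>\<^sub>\<infinity>m. ?r m - ?r (m + k))"
    unfolding correlation_def by (simp only: infsum_cmult_right')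
  then show ?thesis
    by (simp only: recip_class_shift[OF True] mult_zero_right)
next
  case False
  have "recip_class P 1 m * cnj (recip_class P 1 (m + k)) = 0" for m
  proof -
    have "\<not> (m mod int P = 1 mod int P \<and> (m + k) mod int P = 1 mod int P)"
      using False by (metis mod_eq_dvd_iff add_diff_cancel_left')
    then show ?thesis by (auto simp: recip_class_def)
  qed
  then show ?thesis unfolding correlation_def by (intro infsum_0)
qed

text \<open>
  Multiplying the term \<open>1 / (x (k - x))\<close> by \<open>k\<close> gives \<open>1 / x + 1 / (k - x)\<close>. Therefore \<open>k A(k) - k' A(k')\<close>
  telescopes to \<open>0\<close> for \<open>k\<close>, \<open>k'\<close> in the class of \<open>j + 1\<close>, so that \<open>A\<close> is again a multiple of a reciprocal.
  In the class of \<open>0\<close> the sum of the two reciprocals telescopes by itself.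
\<close>

lemma recip_class_convolution:
  assumes P: "P \<ge> 2" and j: "0 < j"
  defines "A \<equiv> \<lambda>k. \<Sum>\<^sub>\<infinity>x. recip_class P j x * recip_class P 1 (k - x)"
  shows "k mod int P \<noteq> int (Suc j) mod int P \<Longrightarrow> A k = 0"
    and "Suc j < P \<Longrightarrow> \<exists>\<gamma>. \<forall>k. A k = \<gamma> * recip_class P (Suc j) k"
    and "Suc j = P \<Longrightarrow> k \<noteq> 0 \<Longrightarrow> A k = 0"
proof -
  let ?r = "recip_class P 1"
  have cls: "k mod int P = int (Suc j) mod int P" if "x mod int P = int j mod int P" "(k - x) mod int P = 1 mod int P" for k x
    using mod_add_cong[OF that] by (simp add: add.commute)
  have cls': "x mod int P = int j mod int P \<longleftrightarrow> (k - x) mod int P = 1 mod int P" if "k mod int P = int (Suc j) mod int P" for k x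
  proof
    assume "x mod int P = int j mod int P"
    then show "(k - x) mod int P = 1 mod int P" using mod_diff_cong[OF that] by simp
  next
    assume "(k - x) mod int P = 1 mod int P"
    then have "(k - (k - x)) mod int P = (int (Suc j) - 1) mod int P" using mod_diff_cong[OF that] by blast
    then show "x mod int P = int j mod int P" by simp
  qed
  show zero: "A k = 0" if "k mod int P \<noteq> int (Suc j) mod int P" for k
  proof -
    have "recip_class P j x * ?r (k - x) = 0" for x
      using cls[of x k] that by (auto simp: recip_class_def)
    then show ?thesis unfolding A_def by (intro infsum_0)
  qed
  have nz1: "(of_int y :: complex) \<noteq> 0" if "y mod int P = 1 mod int P" for y
    using that P by (auto simp: mod_eq_0_iff_dvd)
  show "\<exists>\<gamma>. \<forall>k. A k = \<gamma> * recip_class P (Suc j) k" if jP: "Suc j < P"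
  proof -
    have nzj: "(of_int x :: complex) \<noteq> 0" if "x mod int P = int j mod int P" for x
      using that jP j by auto
    have sm: "(\<lambda>x. recip_class P j x * ?r (k - x)) summable_on UNIV" for k
    proof -
      have "bij_betw (\<lambda>x. k - x) UNIV UNIV"
        by (rule bij_betw_byWitness[where f' = "\<lambda>x. k - x"]) auto
      then have "(\<lambda>x. cnj (?r (k - x))) \<in> ell2 UNIV"
        using ell2_reindex(1)[of "\<lambda>x. k - x" UNIV "\<lambda>x. cnj (?r x)"] ell2_cnj[OF recip_class_ell2] by simp
      then show ?thesis
        using ell2_inner_summable[OF recip_class_ell2] by fastforce
    qed
    have indep: "of_int k * A k = of_int k' * A k'"
      if k: "k mod int P = int (Suc j) mod int P" and k': "k' mod int P = int (Suc j) mod int P" for k k'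
    proof -
      have summand: "of_int k * (recip_class P j x * ?r (k - x)) - of_int k' * (recip_class P j x * ?r (k' - x))
         = - (?r (k' - x) - ?r ((k' - x) + (k - k')))" for x
      proof (cases "x mod int P = int j mod int P")
        case True
        then have a: "(k - x) mod int P = 1 mod int P" "(k' - x) mod int P = 1 mod int P"
          using cls'[OF k] cls'[OF k'] by auto
        have "of_int l * (recip_class P j x * ?r (l - x)) = 1 / of_int x + ?r (l - x)"
          if "(l - x) mod int P = 1 mod int P" for l
        proof -
          have "(of_int l :: complex) = of_int x + of_int (l - x)" by simp
          then show ?thesis
            using True that nzj[OF True] nz1[OF that] by (simp add: recip_class_def field_simps del: of_int_diff)
        qed
        from this[OF a(1)] this[OF a(2)] show ?thesis by simp
      next
        case False
        then show ?thesis
          using cls'[OF k] cls'[OF k'] by (auto simp: recip_class_def)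
      qed
      have bij: "bij_betw (\<lambda>x. k' - x) UNIV UNIV"
        by (rule bij_betw_byWitness[where f' = "\<lambda>x. k' - x"]) auto
      have dvd: "int P dvd k - k'"
        using k k' by (simp add: mod_eq_dvd_iff[symmetric])
      have "of_int k * A k - of_int k' * A k' = (\<Sum>\<^sub>\<infinity>x. of_int k * (recip_class P j x * ?r (k - x)) - of_int k' * (recip_class P j x * ?r (k' - x)))"
      proof -
        have e: "of_int l * A l = (\<Sum>\<^sub>\<infinity>x. of_int l * (recip_class P j x * ?r (l - x)))" for l
          unfolding A_def by (rule infsum_cmult_right'[symmetric])
        have "(\<lambda>x. of_int l * (recip_class P j x * ?r (l - x))) summable_on UNIV" for l
          by (intro summable_on_cmult_right sm)
        from has_sum_add[OF this[of k, THEN has_sum_infsum] has_sum_uminusI[OF this[of k', THEN has_sum_infsum]]]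
        show ?thesis unfolding e by (simp only: infsumI add_uminus_conv_diff)
      qed
      also have "\<dots> = - (\<Sum>\<^sub>\<infinity>x. ?r (k' - x) - ?r ((k' - x) + (k - k')))"
        unfolding summand by (rule infsum_uminus)
      also have "\<dots> = - (\<Sum>\<^sub>\<infinity>y. ?r y - ?r (y + (k - k')))"
        using infsum_reindex_bij_betw[OF bij, of "\<lambda>y. ?r y - ?r (y + (k - k'))"] by simp
      also have "\<dots> = 0" by (simp add: recip_class_shift[OF dvd])
      finally show ?thesis by simp
    qed
    show ?thesis
    proof (intro exI allI)
      fix k
      show "A k = (of_int (int (Suc j)) * A (int (Suc j))) * recip_class P (Suc j) k"
      proof (cases "k mod int P = int (Suc j) mod int P")
        case True
        then have "k \<noteq> 0" using jP by auto
        then show ?thesis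
          using indep[OF True refl] True by (simp add: recip_class_def field_simps)
      next
        case False
        then show ?thesis using zero by (simp add: recip_class_def)
      qed
    qed
  qed
  show "A k = 0" if jP: "Suc j = P" and k: "k \<noteq> 0"
  proof (cases "k mod int P = int (Suc j) mod int P")
    case True
    have dvd: "int P dvd - k" using True jP by auto
    have nzj: "(of_int x :: complex) \<noteq> 0" if "x mod int P = int j mod int P" for x
      using that jP j by auto
    have shift: "(- x) mod int P = (k - x) mod int P" for x
      using dvd by (simp add: mod_eq_dvd_iff)
    have summand: "recip_class P j x * ?r (k - x) = (1 / of_int k) * (?r (k - x) - ?r ((k - x) + (- k)))" for x
    proof (cases "x mod int P = int j mod int P")
      case x: True
      then have a: "(k - x) mod int P = 1 mod int P"
        using cls'[OF True] by auto
      then have b: "(- x) mod int P = 1 mod int P"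
        using shift[of x] by simp
      define u v :: complex where "u = of_int x" and "v = of_int (k - x)"
      have k_eq: "of_int k = u + v" and nz: "u \<noteq> 0" "v \<noteq> 0" "u + v \<noteq> 0"
        using nzj[OF x] nz1[OF a] k by (simp_all add: u_def v_def)
      have "1 / u * (1 / v) = 1 / (u + v) * (1 / v - 1 / (- u))"
        using nz by (simp add: field_simps)
      then show ?thesis
        unfolding k_eq using x a b by (simp add: recip_class_def u_def v_def)
    next
      case x: False
      then have a: "(k - x) mod int P \<noteq> 1 mod int P"
        using cls'[OF True] by auto
      then have b: "(- x) mod int P \<noteq> 1 mod int P"
        using shift[of x] by simp
      show ?thesis using x a b by (simp add: recip_class_def)
    qed
    have bij: "bij_betw (\<lambda>x. k - x) UNIV UNIV"
      by (rule bij_betw_byWitness[where f' = "\<lambda>x. k - x"]) auto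
    have "A k = (1 / of_int k) * (\<Sum>\<^sub>\<infinity>x. ?r (k - x) - ?r ((k - x) + (- k)))"
      unfolding A_def summand by (rule infsum_cmult_right')
    also have "(\<Sum>\<^sub>\<infinity>x. ?r (k - x) - ?r ((k - x) + (- k))) = (\<Sum>\<^sub>\<infinity>y. ?r y - ?r (y + (- k)))"
      by (rule infsum_reindex_bij_betw[OF bij])
    also have "\<dots> = 0" by (rule recip_class_shift[OF dvd])
    finally show ?thesis by simp
  qed (rule zero)
qed


section \<open>A unitary of finite order with powers in distinct residue classes\<close>

lemma unitary_sequence_vector:
  assumes "unitary_sequence c"
  shows "group.unitary_vector integer_group c"
proof -
  interpret Z: group integer_group by simp
  have c: "correlation c c k = delta 0 k" for k
    using assms by (simp add: unitary_sequence_def)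
  have "(\<Sum>\<^sub>\<infinity>y. cnj (c y) * c (k + y)) = cnj (correlation c c k)" for k
    unfolding correlation_def infsum_cnj[symmetric] by (simp add: add.commute)
  moreover have "cnj (delta 0 k) = delta 0 k" for k :: int
    by (simp add: delta_def)
  ultimately show ?thesis
    using assms c unfolding Z.unitary_vector_def
    by (simp add: unitary_sequence_def correlation_def[symmetric])
qed

lemma correlation_eq_inner: "correlation f g k = ell2_inner UNIV f (\<lambda>m. g (m + k))"
  by (simp add: correlation_def ell2_inner_def)

lemma shift_ell2: "g \<in> ell2 UNIV \<Longrightarrow> (\<lambda>m. g (m + k)) \<in> ell2 (UNIV :: int set)"
  using ell2_reindex(1)[OF bij_add_int[of k]] by simp

text \<open>
  Convolution by a unitary sequence is a unitary operator that commutes with translations, and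
  correlations are inner products of translates.
\<close>

lemma correlation_convolution:
  assumes c: "unitary_sequence c" and f: "f \<in> ell2 UNIV" and g: "g \<in> ell2 UNIV"
  defines "C \<equiv> group.left_convolution integer_group c"
  shows "correlation (C f) (C g) k = correlation f g k"
proof -
  interpret Z: group integer_group by simp
  note u = unitary_sequence_vector[OF c]
  have C: "unitary_op UNIV C" "C \<in> bounded_ops UNIV" "C \<in> group_vN_algebra integer_group"
    unfolding C_def using Z.left_convolution_unitary[OF u] Z.left_convolution_bounded[OF u]
      Z.left_convolution_vN[OF u] by simp_all
  have shift: "Z.right_translation k h = (\<lambda>m. h (m + k))" if "h \<in> ell2 UNIV" for h
    using that by (simp add: Z.right_translation_def)
  have "C (Z.right_translation k g) = Z.right_translation k (C g)"
    using C(3) Z.right_translation_commutant[of k] g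
    unfolding group_vN_algebra_def by (intro commutantD) auto
  then have "(\<lambda>m. C g (m + k)) = C (\<lambda>m. g (m + k))"
    by (simp add: shift g bounded_ops_ell2[OF C(2)])
  then show ?thesis
    unfolding correlation_eq_inner using unitary_op_inner[OF C(1) f shift_ell2[OF g]] by simp
qed

lemma normalised_recip_class:
  assumes P: "P \<ge> 2"
  obtains K where "K \<noteq> 0" "unitary_sequence (\<lambda>m. K * recip_class P 1 m)"
proof -
  let ?r = "recip_class P 1" and ?n = "ell2_norm UNIV (recip_class P 1)"
  have r1: "?r 1 = 1" by (simp add: recip_class_def)
  have n: "?n > 0"
    using cmod_le_ell2_norm[OF recip_class_ell2, of P 1 1] r1 by simp
  have c0: "correlation ?r ?r 0 = of_real (?n\<^sup>2)"
    using ell2_inner_self[OF recip_class_ell2, of P 1] by (simp add: correlation_eq_inner)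
  show ?thesis
  proof
    show "complex_of_real (1 / ?n) \<noteq> 0" using n by simp
    have "correlation (\<lambda>m. of_real (1 / ?n) * ?r m) (\<lambda>m. of_real (1 / ?n) * ?r m) k
      = of_real (1 / ?n\<^sup>2) * correlation ?r ?r k" for k
      unfolding correlation_def infsum_cmult_right'[symmetric]
      by (simp add: power2_eq_square mult_ac)
    moreover have "of_real (1 / ?n\<^sup>2) * correlation ?r ?r k = delta 0 k" for k
      using recip_class_correlation[OF P] c0 n by (cases "k = 0") (auto simp: delta_def)
    ultimately show "unitary_sequence (\<lambda>m. of_real (1 / ?n) * ?r m)"
      unfolding unitary_sequence_def by (intro conjI ext ell2_scale recip_class_ell2) (simp only:)
  qed
qed

text \<open>
  Here \<open>e j\<close> is the sequence of Fourier coefficients of \<open>\<phi>\<^sup>j\<close>, for a unitary \<open>\<phi>\<close> of \<open>L\<int>\<close> with \<open>\<phi>\<^sup>P = 1\<close>. Start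
  with the normalised reciprocals in the class of \<open>1\<close> as the coefficients of a unitary. By partial
  fractions its \<open>j\<close>-th power is a multiple of the reciprocals in the class of \<open>j\<close> for \<open>0 < j < P\<close>, and its
  \<open>P\<close>-th power is a scalar \<open>\<zeta>\<close>, necessarily of modulus \<open>1\<close>. Multiplication by a \<open>P\<close>-th root of
  \<open>1 / \<zeta>\<close> then makes the \<open>P\<close>-th power equal to \<open>1\<close>.
\<close>

lemma cyclic_family_exists:
  assumes P: "P \<ge> 2"
  obtains e :: "nat \<Rightarrow> int \<Rightarrow> complex" where
    "\<And>j. e j \<in> ell2 UNIV" "e 0 = delta 0" "\<And>j. e (j + P) = e j"
    "\<And>i j k. i \<le> j \<Longrightarrow> correlation (e i) (e j) k = cnj (e (j - i) k)"
    "\<And>j k. j < P \<Longrightarrow> k mod int P \<noteq> int j \<Longrightarrow> e j k = 0"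
proof -
  interpret Z: group integer_group by simp
  obtain K where K: "K \<noteq> 0" and c: "unitary_sequence (\<lambda>m. K * recip_class P 1 m)"
    using normalised_recip_class[OF P] .
  define C where "C = Z.left_convolution (\<lambda>m. K * recip_class P 1 m)"
  note u = unitary_sequence_vector[OF c]
  have C: "C \<in> bounded_ops UNIV"
    unfolding C_def using Z.left_convolution_bounded[OF u] by simp
  define d where "d j = (C ^^ j) (delta 0)" for j
  have d_ell2: "d j \<in> ell2 UNIV" for j
    by (induction j) (auto simp: d_def delta_ell2 bounded_ops_ell2[OF C])
  have d_Suc: "d (Suc j) = C (d j)" for j
    by (simp add: d_def)
  have C_apply: "C f k = K * (\<Sum>\<^sub>\<infinity>x. f x * recip_class P 1 (k - x))" if "f \<in> ell2 UNIV" for f k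
  proof -
    have "C f k = (\<Sum>\<^sub>\<infinity>x. f x * (K * recip_class P 1 (k - x)))"
      unfolding C_def using Z.left_convolution_apply[of f k] that by simp
    also have "\<dots> = (\<Sum>\<^sub>\<infinity>x. K * (f x * recip_class P 1 (k - x)))"
      by (simp add: mult_ac)
    finally show ?thesis by (simp only: infsum_cmult_right')
  qed
  have corr_step: "correlation (d (i + l)) (d (j + l)) k = correlation (d i) (d j) k" for i j l k
  proof (induction l)
    case (Suc l)
    have "correlation (d (i + Suc l)) (d (j + Suc l)) k = correlation (d (i + l)) (d (j + l)) k"
      using correlation_convolution[OF c d_ell2 d_ell2] by (simp add: d_Suc C_def)
    then show ?case using Suc by simp
  qed simp
  have corr_delta: "correlation (delta 0) f k = cnj (f k)" for f k
  proof -
    have "correlation (delta 0) f k = (\<Sum>\<^sub>\<infinity>m\<in>{0}. cnj (f (m + k)))"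
      unfolding correlation_def by (rule infsum_cong_neutral) (auto simp: delta_def)
    then show ?thesis by simp
  qed
  have d0: "d 0 = delta 0" by (simp add: d_def)
  have corr_d: "correlation (d i) (d j) k = cnj (d (j - i) k)" if "i \<le> j" for i j k
    using corr_step[of 0 i "j - i" k] that by (simp add: d0 corr_delta)
  have d1: "d 1 = (\<lambda>m. K * recip_class P 1 m)"
    unfolding d_def C_def using Z.left_convolution_delta[OF u, of 0]
    by (simp add: Z.right_shift_def)
  have shape: "\<exists>\<gamma>. d j = (\<lambda>m. \<gamma> * recip_class P j m)" if "0 < j" "j < P" for j
    using that
  proof (induction j)
    case (Suc j)
    show ?case
    proof (cases "j = 0")
      case True
      then show ?thesis using d1 by auto
    next
      case False
      then obtain \<gamma> where \<gamma>: "d j = (\<lambda>m. \<gamma> * recip_class P j m)" using Suc by auto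
      obtain \<gamma>' where \<gamma>': "\<And>k. (\<Sum>\<^sub>\<infinity>x. recip_class P j x * recip_class P 1 (k - x)) = \<gamma>' * recip_class P (Suc j) k"
        using recip_class_convolution(2)[OF P, of j] False Suc.prems by auto
      have "d (Suc j) k = K * \<gamma> * \<gamma>' * recip_class P (Suc j) k" for k
      proof -
        have "d (Suc j) k = K * (\<Sum>\<^sub>\<infinity>x. \<gamma> * (recip_class P j x * recip_class P 1 (k - x)))"
          unfolding d_Suc C_apply[OF d_ell2] unfolding \<gamma> by (simp only: mult.assoc)
        then show ?thesis by (simp only: infsum_cmult_right' \<gamma>' mult.assoc)
      qed
      then show ?thesis by blast
    qed
  qed simp
  define \<zeta> where "\<zeta> = d P 0"
  have dP: "d P = (\<lambda>m. \<zeta> * delta 0 m)"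
  proof
    fix k
    have j: "0 < P - 1" "P - 1 < P" "Suc (P - 1) = P" using P by auto
    obtain \<gamma> where \<gamma>: "d (P - 1) = (\<lambda>m. \<gamma> * recip_class P (P - 1) m)" using shape[OF j(1,2)] by auto
    have "d P k = 0" if "k \<noteq> 0"
    proof -
      have "d P k = K * (\<Sum>\<^sub>\<infinity>x. \<gamma> * (recip_class P (P - 1) x * recip_class P 1 (k - x)))"
        using d_Suc[of "P - 1"] unfolding j(3) C_apply[OF d_ell2] unfolding \<gamma>
        by (simp only: mult.assoc)
      also have "\<dots> = K * (\<gamma> * 0)"
        using recip_class_convolution(3)[OF P j(1,3) that] by (simp only: infsum_cmult_right')
      finally show ?thesis by simp
    qed
    then show "d P k = \<zeta> * delta 0 k" by (auto simp: \<zeta>_def delta_def)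
  qed
  have "cmod \<zeta> = 1"
  proof -
    have "correlation (d P) (d P) 0 = \<zeta> * cnj \<zeta>"
    proof -
      have "correlation (d P) (d P) 0 = (\<Sum>\<^sub>\<infinity>m\<in>{0::int}. \<zeta> * cnj \<zeta>)"
        unfolding correlation_def dP by (rule infsum_cong_neutral) (auto simp: delta_def)
      then show ?thesis by simp
    qed
    then have "\<zeta> * cnj \<zeta> = 1"
      using corr_d[of P P 0] by (simp add: d0 delta_def)
    then show ?thesis
      by (metis complex_mod_sqrt_Re_mult_cnj one_complex.simps(1) real_sqrt_one)
  qed
  then have "\<zeta> \<noteq> 0" "sgn \<zeta> = \<zeta>" by (auto simp: sgn_eq)
  then have lam: "\<zeta> = cis (Arg \<zeta>)" using cis_Arg[of \<zeta>] by simp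
  define \<mu> where "\<mu> = cis (- Arg \<zeta> / real P)"
  have \<mu>P: "\<mu> ^ P * \<zeta> = 1"
  proof -
    have "\<mu> ^ P = cis (- Arg \<zeta>)" using P by (simp add: \<mu>_def Complex.DeMoivre)
    then show ?thesis using lam by (metis cis_mult cis_zero add.left_inverse)
  qed
  have \<mu>: "\<mu> * cnj \<mu> = 1" "\<mu> \<noteq> 0"
    by (simp_all add: \<mu>_def cis_cnj cis_mult)
  have dP_add: "d (j + P) = (\<lambda>m. \<zeta> * d j m)" for j
  proof (induction j)
    case 0
    then show ?case by (simp add: dP d0)
  next
    case (Suc j)
    then show ?case using bounded_ops_scale[OF C d_ell2] by (simp add: d_Suc)
  qed
  define e where "e j = (\<lambda>m. \<mu> ^ j * d j m)" for j
  show ?thesis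
  proof
    show "e j \<in> ell2 UNIV" for j
      unfolding e_def by (rule ell2_scale[OF d_ell2])
    show "e 0 = delta 0" by (simp add: e_def d0)
    show "e (j + P) = e j" for j
      using \<mu>P by (simp add: e_def dP_add power_add mult_ac fun_eq_iff)
    show "correlation (e i) (e j) k = cnj (e (j - i) k)" if "i \<le> j" for i j k
    proof -
      have "correlation (e i) (e j) k = (\<Sum>\<^sub>\<infinity>m. (\<mu> ^ i * cnj \<mu> ^ j) * (d i m * cnj (d j (m + k))))"
        by (simp add: correlation_def e_def mult_ac)
      also have "\<dots> = (\<mu> ^ i * cnj \<mu> ^ j) * correlation (d i) (d j) k"
        unfolding correlation_def by (rule infsum_cmult_right')
      also have "\<mu> ^ i * cnj \<mu> ^ j = (\<mu> * cnj \<mu>) ^ i * cnj \<mu> ^ (j - i)"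
        using that by (simp add: power_mult_distrib mult.assoc flip: power_add)
      finally show ?thesis by (simp add: \<mu> corr_d[OF that] e_def)
    qed
    show "e j k = 0" if "j < P" "k mod int P \<noteq> int j" for j k
    proof (cases "j = 0")
      case True
      then show ?thesis using that by (auto simp: e_def d0 delta_def)
    next
      case False
      then show ?thesis
        using shape[of j] that by (auto simp: e_def recip_class_def)
    qed
  qed
qed

section \<open>A path of unitaries through one of trace zero\<close>

text \<open>
  For \<open>x = s - i\<close> this is the \<open>i\<close>-th Fourier coefficient on \<open>\<int> / P\<int>\<close> of the function
  \<open>l \<mapsto> exp (2\<pi>\<i> l s / P)\<close> of modulus \<open>1\<close>, for \<open>0 \<le> l < P\<close>.
\<close>

definition dirichlet_mean :: "nat \<Rightarrow> real \<Rightarrow> complex" where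
  "dirichlet_mean P x = (\<Sum>l<P. cis (2 * pi * real l * x / real P)) / of_nat P"

lemma dirichlet_mean_int:
  assumes P: "P > 0"
  shows "dirichlet_mean P (of_int n) = (if int P dvd n then 1 else 0)"
proof -
  define \<omega> where "\<omega> = cis (2 * pi * of_int n / real P)"
  have sum: "(\<Sum>l<P. cis (2 * pi * real l * of_int n / real P)) = (\<Sum>l<P. \<omega> ^ l)"
    by (rule sum.cong) (simp_all add: \<omega>_def Complex.DeMoivre mult_ac)
  have \<omega>P: "\<omega> ^ P = 1"
    using P cis_multiple_2pi[of "of_int n"] by (simp add: \<omega>_def Complex.DeMoivre)
  show ?thesis
  proof (cases "int P dvd n")
    case True
    then obtain k where k: "n = int P * k" by blast
    have "2 * pi * of_int n / real P = 2 * pi * of_int k" using P by (simp add: k)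
    then have "\<omega> = 1" unfolding \<omega>_def by (simp only: cis_multiple_2pi[OF Ints_of_int])
    then show ?thesis using True P by (simp add: dirichlet_mean_def sum)
  next
    case False
    have "\<omega> \<noteq> 1"
    proof
      assume "\<omega> = 1"
      then have "cos (2 * pi * of_int n / real P) = 1"
        by (simp add: \<omega>_def complex_eq_iff)
      then obtain k :: int where "2 * pi * of_int n / real P = of_int k * 2 * pi"
        using cos_one_2pi_int by auto
      then have "real_of_int n = of_int (k * int P)" using P by (simp add: field_simps)
      then have "n = k * int P" by (simp only: of_int_eq_iff)
      then show False using False by simp
    qed
    then have "(\<Sum>l<P. \<omega> ^ l) = 0"
      using geometric_sum[of \<omega> P] \<omega>P by simp
    then show ?thesis using False by (simp add: dirichlet_mean_def sum)
  qed
qed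

lemma dirichlet_mean_periodic:
  assumes P: "P > 0" and "int P dvd n"
  shows "dirichlet_mean P (x + of_int n) = dirichlet_mean P x"
proof -
  obtain k where k: "n = int P * k" using assms(2) by blast
  have "cis (2 * pi * real l * (x + of_int n) / real P) = cis (2 * pi * real l * x / real P)" for l
  proof -
    have "2 * pi * real l * (x + of_int n) / real P
      = 2 * pi * real l * x / real P + 2 * pi * of_int (int l * k)"
      using P by (simp add: k field_simps)
    then show ?thesis using cis_multiple_2pi[of "of_int (int l * k)"] by (simp add: cis_mult[symmetric])
  qed
  then show ?thesis by (simp add: dirichlet_mean_def)
qed

text \<open>
  Parseval's identity on \<open>\<int> / P\<int>\<close>, for two functions of modulus \<open>1\<close> and a character.
\<close>

lemma dirichlet_mean_convolution:
  assumes P: "P > 0"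
  shows "(\<Sum>i<P. dirichlet_mean P (s - real i) * cnj (dirichlet_mean P (s' - (real i + of_int k))))
    = dirichlet_mean P (s - s' + of_int k)"
proof -
  let ?c = "\<lambda>x. cis (2 * pi * x / real P)"
  have D: "dirichlet_mean P x = (\<Sum>l<P. ?c (real l * x)) / of_nat P" for x
    by (simp add: dirichlet_mean_def mult.assoc)
  have "(\<Sum>i<P. dirichlet_mean P (s - real i) * cnj (dirichlet_mean P (s' - (real i + of_int k))))
     = (\<Sum>i<P. \<Sum>l<P. \<Sum>l'<P. ?c (real l * (s - real i)) * cnj (?c (real l' * (s' - (real i + of_int k)))))
       / (of_nat P)\<^sup>2"
    by (simp only: D complex_cnj_divide complex_cnj_of_nat cnj_sum times_divide_times_eq
        sum_product power2_eq_square sum_divide_distrib)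
  also have "(\<Sum>i<P. \<Sum>l<P. \<Sum>l'<P. ?c (real l * (s - real i)) * cnj (?c (real l' * (s' - (real i + of_int k)))))
     = (\<Sum>l<P. \<Sum>l'<P. \<Sum>i<P. ?c (real l * (s - real i)) * cnj (?c (real l' * (s' - (real i + of_int k)))))"
    by (rule trans[OF sum.swap]) (intro sum.cong refl sum.swap)
  also have "\<dots> = (\<Sum>l<P. \<Sum>l'<P. ?c (real l * s - real l' * (s' - of_int k))
       * (of_nat P * dirichlet_mean P (of_int (int l' - int l))))"
  proof (intro sum.cong refl)
    fix l l'
    have "?c (real l * (s - real i)) * cnj (?c (real l' * (s' - (real i + of_int k))))
       = ?c (real l * s - real l' * (s' - of_int k)) * ?c (real i * of_int (int l' - int l))" for i
      unfolding cis_cnj cis_mult by (rule arg_cong[of _ _ cis]) (use P in \<open>simp add: field_simps\<close>)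
    then have "(\<Sum>i<P. ?c (real l * (s - real i)) * cnj (?c (real l' * (s' - (real i + of_int k)))))
       = ?c (real l * s - real l' * (s' - of_int k)) * (\<Sum>i<P. ?c (real i * of_int (int l' - int l)))"
      by (simp only: sum_distrib_left)
    also have "(\<Sum>i<P. ?c (real i * of_int (int l' - int l))) = of_nat P * dirichlet_mean P (of_int (int l' - int l))"
      using P by (simp only: D) simp
    finally show "(\<Sum>i<P. ?c (real l * (s - real i)) * cnj (?c (real l' * (s' - (real i + of_int k)))))
       = ?c (real l * s - real l' * (s' - of_int k)) * (of_nat P * dirichlet_mean P (of_int (int l' - int l)))" .
  qed
  also have "\<dots> = (\<Sum>l<P. \<Sum>l'<P. if l' = l then ?c (real l * (s - s' + of_int k)) * of_nat P else 0)"
  proof (intro sum.cong refl)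
    fix l l' assume l: "l \<in> {..<P}" "l' \<in> {..<P}"
    have "int P dvd int l' - int l \<longleftrightarrow> l' = l"
    proof
      assume "int P dvd int l' - int l"
      then have "int l' mod int P = int l mod int P" by (simp add: mod_eq_dvd_iff)
      then show "l' = l" using l by simp
    qed simp
    then show "?c (real l * s - real l' * (s' - of_int k)) * (of_nat P * dirichlet_mean P (of_int (int l' - int l)))
       = (if l' = l then ?c (real l * (s - s' + of_int k)) * of_nat P else 0)"
      unfolding dirichlet_mean_int[OF P] by (auto simp: algebra_simps)
  qed
  also have "\<dots> = (\<Sum>l<P. ?c (real l * (s - s' + of_int k))) * of_nat P"
    by (simp add: sum_distrib_right)
  also have "\<dots> / (of_nat P)\<^sup>2 = dirichlet_mean P (s - s' + of_int k)"
    using P by (simp add: D power2_eq_square)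
  finally show ?thesis .
qed

lemma dirichlet_mean_uminus: "dirichlet_mean P (- x) = cnj (dirichlet_mean P x)"
  by (simp add: dirichlet_mean_def cis_cnj)

lemma Re_dirichlet_mean_ge:
  assumes P: "P > 0"
  shows "Re (dirichlet_mean P x) \<ge> 1 - 2 * pi\<^sup>2 * x\<^sup>2"
proof -
  have cos_ge: "cos u \<ge> 1 - u\<^sup>2 / 2" for u :: real
  proof -
    have "cos u = 1 - 2 * (sin (u / 2))\<^sup>2"
      using cos_double_sin[of "u / 2"] by simp
    moreover have "(sin (u / 2))\<^sup>2 \<le> (u / 2)\<^sup>2"
      using abs_sin_x_le_abs_x[of "u / 2"] by (rule abs_le_square_iff[THEN iffD1])
    ultimately show ?thesis by (simp add: power_divide)
  qed
  have "1 - 2 * pi\<^sup>2 * x\<^sup>2 \<le> cos (2 * pi * real l * x / real P)" if "l < P" for l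
  proof -
    have le: "\<bar>2 * pi * real l * x / real P\<bar> \<le> \<bar>2 * pi * x\<bar>"
    proof -
      have "\<bar>2 * pi * real l * x / real P\<bar> = (real l / real P) * \<bar>2 * pi * x\<bar>"
        using P by (simp add: abs_mult)
      also have "\<dots> \<le> 1 * \<bar>2 * pi * x\<bar>"
        using that by (intro mult_right_mono) auto
      finally show ?thesis by simp
    qed
    have "1 - (2 * pi * x)\<^sup>2 / 2 \<le> 1 - (2 * pi * real l * x / real P)\<^sup>2 / 2"
      using abs_le_square_iff[THEN iffD1, OF le] by simp
    also have "\<dots> \<le> cos (2 * pi * real l * x / real P)" by (rule cos_ge)
    finally show ?thesis by (simp add: power_mult_distrib)
  qed
  then have "(\<Sum>l<P. 1 - 2 * pi\<^sup>2 * x\<^sup>2) \<le> (\<Sum>l<P. cos (2 * pi * real l * x / real P))"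
    by (intro sum_mono) auto
  moreover have "Re (dirichlet_mean P x) = (\<Sum>l<P. cos (2 * pi * real l * x / real P)) / real P"
    by (simp add: dirichlet_mean_def Re_sum Re_divide_of_nat)
  ultimately have "real P * (1 - 2 * pi\<^sup>2 * x\<^sup>2) \<le> real P * Re (dirichlet_mean P x)"
    using P by simp
  then show ?thesis using P by (simp only: mult_le_cancel_left_pos of_nat_0_less_iff)
qed

text \<open>
  The path is \<open>V s = \<Sum>\<^sub>i dirichlet_mean P (s - i) e i\<close>, which has the value \<open>exp (2\<pi>\<i> l s / P)\<close> where \<open>\<phi>\<close>
  has the value \<open>exp (2\<pi>\<i> l / P)\<close>. At \<open>k\<close> only the pairs of powers whose residue classes differ by \<open>k\<close>
  contribute to the correlation of two points of the path, all with the same factor \<open>\<epsilon> k\<close>; the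
  remaining sum is Parseval's identity. For \<open>k\<close> divisible by \<open>P\<close> the factor \<open>\<epsilon> k\<close> is a coefficient of
  \<open>\<phi>\<^sup>0 = 1\<close>.
\<close>

lemma unitary_path_exists:
  assumes P: "P \<ge> 2"
  obtains V :: "real \<Rightarrow> int \<Rightarrow> complex" where
    "V 0 = delta 0" "\<And>s. unitary_sequence (V s)"
    "\<And>s s' k. int P dvd k \<Longrightarrow> k \<noteq> 0 \<Longrightarrow> correlation (V s) (V s') k = 0"
    "\<And>s s'. correlation (V s) (V s') 0 = dirichlet_mean P (s - s')"
proof (rule cyclic_family_exists[OF P])
  fix e :: "nat \<Rightarrow> int \<Rightarrow> complex"
  assume e: "\<And>j. e j \<in> ell2 UNIV" "e 0 = delta 0" "\<And>j. e (j + P) = e j"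
    "\<And>i j k. i \<le> j \<Longrightarrow> correlation (e i) (e j) k = cnj (e (j - i) k)"
    "\<And>j k. j < P \<Longrightarrow> k mod int P \<noteq> int j \<Longrightarrow> e j k = 0"
  have P0: "P > 0" using P by simp
  define \<epsilon> where "\<epsilon> k = cnj (e (nat (k mod int P)) k)" for k
  have corr_e: "correlation (e i) (e j) k = (if j = nat ((int i + k) mod int P) then \<epsilon> k else 0)"
    if ij: "i < P" "j < P" for i j k
  proof -
    define r where "r = nat ((int j - int i) mod int P)"
    have r: "r < P" "int r = (int j - int i) mod int P"
      using P by (simp_all add: r_def nat_less_iff)
    have "correlation (e i) (e j) k = cnj (e r k)"
    proof (cases "i \<le> j")
      case True
      then have "r = j - i" using ij by (simp add: r_def of_nat_diff[symmetric] del: of_nat_diff)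
      then show ?thesis using e(4)[OF True] by simp
    next
      case False
      \<comment> \<open>the case \<open>i > j\<close> reduces to the other one by periodicity\<close>
      then have "int j - int i + int P = int (j + P - i)" using ij by simp
      moreover have "(int j - int i + int P) mod int P = (int j - int i) mod int P" by simp
      ultimately have "int r = int (j + P - i) mod int P" using r(2) by simp
      also have "\<dots> = int (j + P - i)" using ij False by (intro mod_pos_pos_trivial) auto
      finally have "r = j + P - i" by simp
      moreover have "correlation (e i) (e j) k = correlation (e i) (e (j + P)) k" by (simp add: e(3))
      ultimately show ?thesis using e(4)[of i "j + P" k] ij by simp
    qed
    moreover have "j = nat ((int i + k) mod int P) \<longleftrightarrow> k mod int P = int r"
    proof -
      have "j = nat ((int i + k) mod int P) \<longleftrightarrow> int j mod int P = (int i + k) mod int P"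
        using ij P by auto
      also have "\<dots> \<longleftrightarrow> (int j - int i) mod int P = k mod int P"
        by (simp add: mod_eq_dvd_iff algebra_simps)
      finally show ?thesis using r by auto
    qed
    ultimately show ?thesis
      using e(5)[OF r(1), of k] by (auto simp: \<epsilon>_def)
  qed
  define V where "V s = (\<lambda>m. \<Sum>i<P. dirichlet_mean P (s - real i) * e i m)" for s
  have V_ell2: "V s \<in> ell2 UNIV" for s
    unfolding V_def by (intro ell2_sum ell2_scale e) simp
  have corr: "correlation (V s) (V s') k = \<epsilon> k * dirichlet_mean P (s - s' + of_int k)" for s s' k
  proof -
    note shift_V = shift_ell2[OF V_ell2]
    have right: "ell2_inner UNIV (e i) (\<lambda>m. V s' (m + k))
      = (\<Sum>j<P. cnj (dirichlet_mean P (s' - real j)) * correlation (e i) (e j) k)" for i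
    proof -
      have "ell2_inner UNIV (\<lambda>m. V s' (m + k)) (e i)
         = (\<Sum>j<P. ell2_inner UNIV (\<lambda>m. dirichlet_mean P (s' - real j) * e j (m + k)) (e i))"
        unfolding V_def by (rule ell2_inner_sum_left) (auto intro!: ell2_scale shift_ell2 e)
      also have "\<dots> = (\<Sum>j<P. dirichlet_mean P (s' - real j) * cnj (correlation (e i) (e j) k))"
        unfolding correlation_eq_inner ell2_inner_scale_left
        by (intro sum.cong refl arg_cong2[of _ _ _ _ "(*)"]) (rule ell2_inner_commute)
      finally show ?thesis
        using ell2_inner_commute[of UNIV "e i"] by simp
    qed
    have "correlation (V s) (V s') k
      = (\<Sum>i<P. ell2_inner UNIV (\<lambda>m. dirichlet_mean P (s - real i) * e i m) (\<lambda>m. V s' (m + k)))"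
      unfolding correlation_eq_inner
      by (subst (1) V_def, rule ell2_inner_sum_left) (auto intro!: ell2_scale e shift_V)
    also have "\<dots> = (\<Sum>i<P. dirichlet_mean P (s - real i)
        * (cnj (dirichlet_mean P (s' - (real i + of_int k))) * \<epsilon> k))"
    proof (intro sum.cong refl)
      fix i assume i: "i \<in> {..<P}"
      define j where "j = nat ((int i + k) mod int P)"
      have j: "j < P" using P by (simp add: j_def nat_less_iff)
      have "dirichlet_mean P (s' - real j) = dirichlet_mean P (s' - (real i + of_int k))"
      proof -
        have "int j = (int i + k) mod int P" using P by (simp add: j_def)
        then have "int P dvd (int i + k) - int j" by (simp add: dvd_minus_mod)
        from dirichlet_mean_periodic[OF P0 this, of "s' - (real i + of_int k)"]
        show ?thesis by (simp add: algebra_simps)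
      qed
      moreover have "(\<Sum>l<P. cnj (dirichlet_mean P (s' - real l)) * correlation (e i) (e l) k)
         = cnj (dirichlet_mean P (s' - real j)) * \<epsilon> k"
      proof -
        have "(\<Sum>l<P. cnj (dirichlet_mean P (s' - real l)) * correlation (e i) (e l) k)
           = (\<Sum>l<P. if l = j then cnj (dirichlet_mean P (s' - real l)) * \<epsilon> k else 0)"
          by (rule sum.cong) (use i in \<open>auto simp: corr_e j_def\<close>)
        then show ?thesis using j by simp
      qed
      ultimately show "ell2_inner UNIV (\<lambda>m. dirichlet_mean P (s - real i) * e i m) (\<lambda>m. V s' (m + k))
         = dirichlet_mean P (s - real i) * (cnj (dirichlet_mean P (s' - (real i + of_int k))) * \<epsilon> k)"
        by (simp only: ell2_inner_scale_left right)
    qed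
    also have "\<dots> = \<epsilon> k * (\<Sum>i<P. dirichlet_mean P (s - real i) * cnj (dirichlet_mean P (s' - (real i + of_int k))))"
      by (simp add: sum_distrib_left mult_ac)
    finally show ?thesis by (simp add: dirichlet_mean_convolution[OF P0])
  qed
  have \<epsilon>0: "\<epsilon> k = delta 0 k" if "int P dvd k" for k
    using that by (simp add: \<epsilon>_def e(2) delta_def)
  have D: "dirichlet_mean P (real_of_int k) = (if int P dvd k then 1 else 0)" for k
    by (rule dirichlet_mean_int[OF P0])
  show ?thesis
  proof
    have D0: "dirichlet_mean P (- real i) = (if i = 0 then 1 else 0)" if "i < P" for i
      using D[of "- int i"] that by (auto dest: zdvd_imp_le)
    have "V 0 m = (\<Sum>i<P. if i = 0 then e i m else 0)" for m
      unfolding V_def by (rule sum.cong) (auto simp: D0)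
    then show "V 0 = delta 0"
      using P0 e(2) by (auto simp: fun_eq_iff)
    have "correlation (V s) (V s) k = delta 0 k" for s k
      using corr[of s s k] D[of k] \<epsilon>0[of k] by (cases "int P dvd k") (auto simp: delta_def)
    then show "unitary_sequence (V s)" for s
      using V_ell2 by (auto simp: unitary_sequence_def)
    show "correlation (V s) (V s') k = 0" if "int P dvd k" "k \<noteq> 0" for s s' k
      using corr[of s s' k] \<epsilon>0[of k] that by (simp add: delta_def)
    show "correlation (V s) (V s') 0 = dirichlet_mean P (s - s')" for s s'
      using corr[of s s' 0] \<epsilon>0[of 0] by (simp add: delta_def)
  qed
qed


context group
begin

section \<open>Property Gamma from a scaling relation\<close>

lemma product_op_cong:
  "(\<And>i. i < n \<Longrightarrow> b i = b' i) \<Longrightarrow> product_op n b c = product_op n b' c"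
proof (induction n arbitrary: b b' c)
  case (Suc n)
  have "product_op n (b \<circ> Suc) (c \<circ> Suc) = product_op n (b' \<circ> Suc) (c \<circ> Suc)"
    by (rule Suc.IH) (simp add: Suc.prems)
  then show ?case using Suc.prems[of 0] by simp
qed simp

\<comment> \<open>otherwise products over \<open>2 * Suc n\<close> factors would be unfolded\<close>
declare product_op.simps(2) [simp del]

lemma infinite_order_int_pow:
  assumes a: "infinite_order a" and k: "k \<noteq> 0"
  shows "infinite_order (a [^] (k::int))"
  using infinite_order_closed[OF a] k infinite_order_eq[OF a]
  by (auto simp: infinite_order_def inj_def int_pow_pow)

lemma product_vector_delta:
  assumes "\<And>i. i < n \<Longrightarrow> infinite_order (b i)"
  shows "product_vector n b (\<lambda>i. delta 0) = delta \<one>"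
  using assms
proof (induction n arbitrary: b)
  case 0
  then show ?case by (simp add: op_one_apply delta_ell2)
next
  case (Suc n)
  have "product_vector n (b \<circ> Suc) (\<lambda>i. delta 0) = delta \<one>"
    by (rule Suc.IH) (use Suc.prems in auto)
  then show ?case
    unfolding product_vector_Suc using Suc.prems
    by (simp add: comp_def spread_delta left_convolution_delta_one delta_ell2)
qed

text \<open>
  All exponents share the factor \<open>d\<^sup>n p'\<^sup>i\<close>, and those after \<open>\<kappa> i\<close> a further factor \<open>p'\<close>; \<open>H\<close> consists of the
  powers of \<open>a\<close> with an exponent divisible by \<open>d\<^sup>n p'\<^bsup>i + 1\<^esup>\<close>. The remaining factor of \<open>\<kappa> i\<close> is a power of
  \<open>q'\<close>, hence coprime to \<open>p'\<close>.
\<close>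

lemma independent_powers:
  fixes d p' q' :: int
  assumes a: "infinite_order a" and "d \<noteq> 0" "p' \<noteq> 0" and cop: "coprime p' q'"
    and i: "i \<le> n"
  defines "\<kappa> \<equiv> \<lambda>i. (d * p') ^ i * (d * q') ^ (n - i)"
  shows "\<exists>H. subgroup H G \<and> (\<forall>j\<le>n. i < j \<longrightarrow> a [^] \<kappa> j \<in> H)
     \<and> (\<forall>k::int. (a [^] \<kappa> i) [^] k \<in> H \<longrightarrow> p' dvd k)"
proof -
  note aG = infinite_order_closed[OF a]
  define h where "h = d ^ n * p' ^ Suc i"
  define H where "H = range (\<lambda>m::int. (a [^] h) [^] m)"
  have \<kappa>: "\<kappa> j = d ^ n * (p' ^ j * q' ^ (n - j))" if "j \<le> n" for j
  proof -
    have "d ^ n = d ^ j * d ^ (n - j)" using that by (simp flip: power_add)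
    then show ?thesis by (simp add: \<kappa>_def power_mult_distrib mult_ac)
  qed
  show ?thesis
  proof (intro exI[of _ H] conjI allI impI)
    show "subgroup H G" unfolding H_def by (rule subgroup_of_powers) (simp add: aG)
    fix j assume j: "j \<le> n" "i < j"
    then have "Suc i + (j - Suc i) = j" by simp
    then have "p' ^ j = p' ^ Suc i * p' ^ (j - Suc i)" by (metis power_add)
    then have "\<kappa> j = h * (p' ^ (j - Suc i) * q' ^ (n - j))"
      using \<kappa>[OF j(1)] by (simp add: h_def mult_ac)
    then show "a [^] \<kappa> j \<in> H" using aG by (auto simp: H_def int_pow_pow)
  next
    fix k :: int assume "(a [^] \<kappa> i) [^] k \<in> H"
    then obtain m :: int where "a [^] (\<kappa> i * k) = a [^] (h * m)"
      using aG by (auto simp: H_def int_pow_pow)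
    then have "\<kappa> i * k = h * m" using infinite_order_eq[OF a] by blast
    then have "(d ^ n * p' ^ i) * (q' ^ (n - i) * k) = (d ^ n * p' ^ i) * (p' * m)"
      by (simp add: \<kappa>[OF i] h_def mult_ac)
    then have "q' ^ (n - i) * k = p' * m" using \<open>d \<noteq> 0\<close> \<open>p' \<noteq> 0\<close> by simp
    then have "p' dvd q' ^ (n - i) * k" by simp
    then show "p' dvd k" using cop by (simp add: coprime_dvd_mult_right_iff)
  qed
qed

text \<open>
  The unitary \<open>x n\<close> climbs the path \<open>V\<close> from \<open>V 0 = 1\<close> to \<open>V 1\<close> in \<open>N = n + 1\<close> steps and descends in the same
  way. Conjugation by \<open>t\<close> shifts the factors by one place. By independence, the inner product of \<open>x n\<close>
  with its conjugate by \<open>t\<close> is the product of the \<open>2 N\<close> numbers \<open>\<tau>(V\<^sub>s V\<^sub>s\<^sub>'\<^sup>*)\<close> with \<open>s - s' = \<plusminus>1 / N\<close>. The ascending half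
  contributes the complex conjugate of the descending half, so the product is the real number
  \<open>\<bar>dirichlet_mean P (1 / N)\<bar>\<^bsup>2 N\<^esup>\<close>, which is at least \<open>1 - 4 \<pi>\<^sup>2 / N\<close> by Bernoulli's inequality. The trace of
  \<open>x n\<close> contains the factor \<open>\<tau>(V\<^sub>1) = dirichlet_mean P 1 = 0\<close>.
\<close>

theorem vN_property_Gamma_of_scaling:
  fixes d p' q' :: int
  assumes a: "infinite_order a" and t: "t \<in> carrier G"
    and Z: "\<And>z. z \<in> Z \<Longrightarrow> z \<in> carrier G \<and> z \<otimes> a = a \<otimes> z"
    and gen: "carrier G \<subseteq> generate G (insert t Z)"
    and nz: "d \<noteq> 0" "q' \<noteq> 0" and p': "\<bar>p'\<bar> \<ge> 2" and cop: "coprime p' q'"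
    and rel: "t \<otimes> a [^] (d * p') \<otimes> inv t = a [^] (d * q')"
  shows "vN_property_Gamma G"
proof -
  note aG = infinite_order_closed[OF a]
  have p'0: "p' \<noteq> 0" using p' by auto
  define P where "P = nat \<bar>p'\<bar>"
  have P: "P \<ge> 2" "int P = \<bar>p'\<bar>" using p' by (auto simp: P_def)
  obtain V :: "real \<Rightarrow> int \<Rightarrow> complex" where V:
    "V 0 = delta 0" "\<And>s. unitary_sequence (V s)"
    "\<And>s s' k. int P dvd k \<Longrightarrow> k \<noteq> 0 \<Longrightarrow> correlation (V s) (V s') k = 0"
    "\<And>s s'. correlation (V s) (V s') 0 = dirichlet_mean P (s - s')"
    using unitary_path_exists[OF P(1)] by metis
  define \<kappa> where "\<kappa> n i = (d * p') ^ i * (d * q') ^ (n - i)" for n i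
  define b where "b n i = a [^] \<kappa> n i" for n i
  have b: "infinite_order (b n i)" for n i
    unfolding b_def \<kappa>_def using nz p'0 by (intro infinite_order_int_pow[OF a]) simp
  have indep: "\<exists>H. subgroup H G \<and> (\<forall>j<n. i < j \<longrightarrow> b n j \<in> H)
       \<and> (\<forall>k::int. b n i [^] k \<in> H \<longrightarrow> int P dvd k)" if "i < n" for n i
  proof -
    have "i \<le> n" using that by simp
    then obtain H where "subgroup H G" "\<forall>j\<le>n. i < j \<longrightarrow> b n j \<in> H" "\<forall>k::int. b n i [^] k \<in> H \<longrightarrow> p' dvd k"
      using independent_powers[OF a nz(1) p'0 cop, of i n] unfolding b_def \<kappa>_def by blast
    then show ?thesis using P(2) by (intro exI[of _ H]) auto
  qed
  define s where "s N i = (if i \<le> N then real i / real N else real (2 * N - i) / real N)" for N i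
  define x where "x n = product_op (2 * Suc n) (b (2 * Suc n)) (\<lambda>i. V (s (Suc n) i))" for n
  have inner: "ell2_inner (carrier G) (product_vector n (b n) (\<lambda>i. V (u i))) (product_vector n (b n) (\<lambda>i. V (v i)))
     = (\<Prod>i<n. dirichlet_mean P (u i - v i))" for n u v
    using product_vector_inner[of n "b n" "\<lambda>i. V (v i)" "\<lambda>i. V (u i)" "int P"] b V indep by simp
  have ell2: "product_vector n (b m) (\<lambda>i. V (u i)) \<in> ell2 (carrier G)" for n m u
    by (rule product_vector_ell2) (simp_all add: b V)
  have x_ell2: "x n (delta \<one>) \<in> ell2 (carrier G)" for n
    unfolding x_def by (rule ell2)
  have Z_inv: "conj_invariant (\<lambda>n. x n (delta \<one>)) z" if z: "z \<in> Z" for z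
  proof -
    have zG: "z \<in> carrier G" and za: "z \<otimes> a = a \<otimes> z" using Z[OF z] by auto
    have conj_a: "z \<otimes> a \<otimes> inv z = a" using zG aG by (simp add: za m_assoc)
    have "z \<otimes> b n i \<otimes> inv z = b n i" for n i
      unfolding b_def using conj_int_pow[OF zG aG] conj_a by metis
    then have "conj_translate z (x n (delta \<one>)) = x n (delta \<one>)" for n
      unfolding x_def using conj_translate_product[OF zG] b V(2) by simp
    then show ?thesis by (simp add: conj_invariant_def ell2_norm_def)
  qed
  have t_inv: "conj_invariant (\<lambda>n. x n (delta \<one>)) t"
  proof -
    let ?D = "\<lambda>N. dirichlet_mean P (1 / real N)"
    have norm_bound: "ell2_norm (carrier G) (\<lambda>y. x n (delta \<one>) y - conj_translate t (x n (delta \<one>)) y)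
       \<le> sqrt (8 * pi\<^sup>2 / real (Suc n))" for n
    proof -
      define N where "N = Suc n"
      have N0: "real N > 0" by (simp add: N_def)
      define m where "m = 2 * N - 1"
      have m: "Suc m = 2 * N" by (simp add: m_def N_def)
      let ?b = "b (2 * N)" and ?c = "\<lambda>i. V (s N i)"
      define \<eta> where "\<eta> = x n (delta \<one>)"
      have \<eta>: "\<eta> = product_vector (Suc m) ?b ?c" by (simp only: \<eta>_def x_def m N_def)
      \<comment> \<open>the first factor is \<open>V 0 = 1\<close>; without it, conjugation by \<open>t\<close> lowers every index by one\<close>
      have \<eta>': "\<eta> = product_vector m (?b \<circ> Suc) (?c \<circ> Suc)"
        unfolding \<eta> by (rule product_vector_prepend_delta) (simp_all add: b V s_def)
      have shift: "t \<otimes> ?b (Suc i) \<otimes> inv t = ?b i" if "i < m" for i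
      proof -
        define l where "l = (d * p') ^ i * (d * q') ^ (2 * N - Suc i)"
        have "2 * N - i = Suc (2 * N - Suc i)" using that m by simp
        then have k: "\<kappa> (2 * N) (Suc i) = (d * p') * l" "\<kappa> (2 * N) i = (d * q') * l"
          by (simp_all add: \<kappa>_def l_def mult_ac)
        have "t \<otimes> ?b (Suc i) \<otimes> inv t = t \<otimes> (a [^] (d * p')) [^] l \<otimes> inv t"
          using aG by (simp only: b_def k int_pow_pow)
        also have "\<dots> = (t \<otimes> a [^] (d * p') \<otimes> inv t) [^] l"
          using conj_int_pow[OF t] aG by simp
        also have "\<dots> = ?b i"
          using aG by (simp only: rel b_def k int_pow_pow)
        finally show ?thesis .
      qed
      have "conj_translate t \<eta> = product_vector m (\<lambda>i. t \<otimes> (?b \<circ> Suc) i \<otimes> inv t) (?c \<circ> Suc)"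
        unfolding \<eta>' by (rule conj_translate_product[OF t]) (simp_all add: b V)
      also have "product_op m (\<lambda>i. t \<otimes> (?b \<circ> Suc) i \<otimes> inv t) (?c \<circ> Suc) = product_op m ?b (?c \<circ> Suc)"
        by (rule product_op_cong) (simp add: shift)
      \<comment> \<open>the missing last factor is again \<open>V 0 = 1\<close>\<close>
      also have "product_vector m ?b (?c \<circ> Suc) = product_vector (Suc m) ?b (?c \<circ> Suc)"
      proof (rule product_vector_append_delta[symmetric])
        show "(?c \<circ> Suc) m = delta 0" using m V(1) by (simp add: s_def)
      qed (simp_all add: b V)
      finally have conj: "conj_translate t \<eta> = product_vector (2 * N) ?b (\<lambda>i. V (s N (Suc i)))"
        by (simp only: m comp_def)
      have "ell2_inner (carrier G) \<eta> (conj_translate t \<eta>)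
         = (\<Prod>i<2 * N. dirichlet_mean P (s N i - s N (Suc i)))"
        unfolding conj unfolding \<eta> m by (rule inner)
      also have "\<dots> = (\<Prod>i<N. dirichlet_mean P (s N i - s N (Suc i)))
          * (\<Prod>i=N..<N + N. dirichlet_mean P (s N i - s N (Suc i)))"
        using prod.atLeastLessThan_concat[of 0 N "N + N" "\<lambda>i. dirichlet_mean P (s N i - s N (Suc i))"]
        by (simp add: atLeast0LessThan mult_2)
      also have "(\<Prod>i<N. dirichlet_mean P (s N i - s N (Suc i))) = cnj (?D N) ^ N"
      proof -
        have "dirichlet_mean P (s N i - s N (Suc i)) = cnj (?D N)" if "i < N" for i
        proof -
          have "s N i - s N (Suc i) = - (1 / real N)"
            using that by (simp add: s_def field_simps)
          then show ?thesis by (simp only: dirichlet_mean_uminus)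
        qed
        then show ?thesis by simp
      qed
      also have "(\<Prod>i=N..<N + N. dirichlet_mean P (s N i - s N (Suc i))) = ?D N ^ N"
      proof -
        have "s N i - s N (Suc i) = 1 / real N" if "i \<in> {N..<N + N}" for i
        proof (cases "i = N")
          case True
          then show ?thesis by (simp add: s_def N_def field_simps)
        next
          case False
          then have "real (2 * N - i) = real (2 * N - Suc i) + 1" using that by auto
          then show ?thesis using that False by (simp add: s_def field_simps)
        qed
        then show ?thesis by simp
      qed
      also have "cnj (?D N) ^ N * ?D N ^ N = (?D N * cnj (?D N)) ^ N"
        by (simp add: power_mult_distrib)
      also have "\<dots> = of_real (((cmod (?D N))\<^sup>2) ^ N)"
        by (simp only: complex_norm_square[symmetric] of_real_power)
      finally have inner_eq: "Re (ell2_inner (carrier G) \<eta> (conj_translate t \<eta>)) = ((cmod (?D N))\<^sup>2) ^ N"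
        by simp
      have D_ge: "(cmod (?D N))\<^sup>2 \<ge> 1 - 4 * pi\<^sup>2 * (1 / real N)\<^sup>2"
      proof -
        define y where "y = 1 - 2 * pi\<^sup>2 * (1 / real N)\<^sup>2"
        have y: "y \<le> cmod (?D N)"
          using Re_dirichlet_mean_ge[of P "1 / real N"] complex_Re_le_cmod[of "?D N"] P by (simp add: y_def)
        have "2 * y - 1 \<le> (cmod (?D N))\<^sup>2"
          using y sum_squares_bound[of "cmod (?D N)" 1] zero_le_power2[of "cmod (?D N) - 1"]
          by (simp add: power2_diff)
        then show ?thesis by (simp add: y_def)
      qed
      have "1 + real N * ((cmod (?D N))\<^sup>2 - 1) \<le> (1 + ((cmod (?D N))\<^sup>2 - 1)) ^ N"
        by (rule Bernoulli_inequality) simp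
      then have "1 - 4 * pi\<^sup>2 / real N \<le> ((cmod (?D N))\<^sup>2) ^ N"
      proof -
        have "real N * ((cmod (?D N))\<^sup>2 - 1) \<ge> real N * (- 4 * pi\<^sup>2 * (1 / real N)\<^sup>2)"
          using D_ge by (intro mult_left_mono) auto
        moreover have "real N * (- 4 * pi\<^sup>2 * (1 / real N)\<^sup>2) = - (4 * pi\<^sup>2 / real N)"
          using N0 by (simp add: power2_eq_square field_simps)
        ultimately show ?thesis
          using \<open>1 + real N * ((cmod (?D N))\<^sup>2 - 1) \<le> (1 + ((cmod (?D N))\<^sup>2 - 1)) ^ N\<close> by simp
      qed
      moreover have "ell2_norm (carrier G) \<eta> = 1"
        unfolding \<eta>_def x_def
        using unitary_op_norm[OF conjunct2[OF product_op_vN_unitary] delta_ell2[OF one_closed]] b V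
        by (simp add: ell2_norm_delta)
      moreover have "\<eta> \<in> ell2 (carrier G)" unfolding \<eta>_def by (rule x_ell2)
      ultimately have "(ell2_norm (carrier G) (\<lambda>y. \<eta> y - conj_translate t \<eta> y))\<^sup>2 \<le> 8 * pi\<^sup>2 / real N"
        using ell2_norm_diff_square[of \<eta> "carrier G" "conj_translate t \<eta>"] conj_translate_ell2[OF t, of \<eta>]
          conj_translate_norm[OF t, of \<eta>] inner_eq by simp
      then show ?thesis
        unfolding \<eta>_def[symmetric] N_def[symmetric] by (rule real_le_rsqrt)
    qed
    have "(\<lambda>n. sqrt (8 * pi\<^sup>2 / real (Suc n))) \<longlonglongrightarrow> sqrt 0"
      by (intro tendsto_real_sqrt LIMSEQ_Suc[OF lim_const_over_n])
    then have lim: "(\<lambda>n. sqrt (8 * pi\<^sup>2 / real (Suc n))) \<longlonglongrightarrow> 0"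
      by (simp only: real_sqrt_zero)
    show ?thesis
      unfolding conj_invariant_def
    proof (rule Lim_null_comparison[OF always_eventually lim], rule allI)
      fix n
      show "norm (ell2_norm (carrier G) (\<lambda>y. x n (delta \<one>) y - conj_translate t (x n (delta \<one>)) y))
         \<le> sqrt (8 * pi\<^sup>2 / real (Suc n))"
        by (simp only: real_norm_def abs_of_nonneg[OF ell2_norm_nonneg] norm_bound)
    qed
  qed
  show ?thesis
  proof (rule vN_property_GammaI[of x])
    show "x n \<in> group_vN_algebra G" "unitary_op (carrier G) (x n)" for n
      unfolding x_def using product_op_vN_unitary[of _ "b (2 * Suc n)"] b V(2) by auto
    show "x n (delta \<one>) \<one> = 0" for n
    proof -
      let ?N = "2 * Suc n"
      have "x n (delta \<one>) \<one> = ell2_inner (carrier G) (x n (delta \<one>)) (delta \<one>)"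
        using ell2_inner_delta[OF x_ell2 one_closed] by simp
      also have "\<dots> = (\<Prod>i<?N. dirichlet_mean P (s (Suc n) i - 0))"
        using inner[of ?N "s (Suc n)" "\<lambda>i. 0"] product_vector_delta[of ?N "b ?N"] b V(1)
        unfolding x_def by simp
      also have "\<dots> = 0"
      proof (rule prod_zero)
        have "dirichlet_mean P (s (Suc n) (Suc n) - 0) = 0"
          using dirichlet_mean_int[of P 1] P(1) by (simp add: s_def)
        then show "\<exists>i\<in>{..<?N}. dirichlet_mean P (s (Suc n) i - 0) = 0"
          by (intro bexI[of _ "Suc n"]) auto
      qed simp
      finally show ?thesis .
    qed
    show "conj_invariant (\<lambda>n. x n (delta \<one>)) g" if "g \<in> carrier G" for g
      by (rule conj_invariant_generate[OF x_ell2, of "insert t Z"])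
         (use t Z gen Z_inv t_inv that in auto)
  qed
qed

text \<open>
  One of \<open>p' = p / gcd p q\<close> and \<open>q' = q / gcd p q\<close> is not \<open>\<plusminus>1\<close>, and they change roles when \<open>t\<close> is replaced by its
  inverse.
\<close>

theorem vN_property_Gamma_of_Baumslag_Solitar_relation:
  fixes p q :: int
  assumes a: "infinite_order a" and t: "t \<in> carrier G"
    and Z: "\<And>z. z \<in> Z \<Longrightarrow> z \<in> carrier G \<and> z \<otimes> a = a \<otimes> z"
    and gen: "carrier G \<subseteq> generate G (insert t Z)"
    and pq: "p \<noteq> 0" "q \<noteq> 0" "\<bar>p\<bar> \<noteq> \<bar>q\<bar>"
    and rel: "t \<otimes> a [^] p \<otimes> inv t = a [^] q"
  shows "vN_property_Gamma G"
proof -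
  note aG = infinite_order_closed[OF a]
  define d where "d = gcd p q"
  have "gcd p q \<noteq> 0" using pq by simp
  from gcd_coprime_exists[OF this] obtain p' q' where
    "p = p' * d" "q = q' * d" and cop: "coprime p' q'"
    unfolding d_def by blast
  then have p'q': "p = d * p'" "q = d * q'" "coprime p' q'"
    by (simp_all only: mult.commute)
  have nz: "d \<noteq> 0" "p' \<noteq> 0" "q' \<noteq> 0" using p'q' pq by auto
  have ne: "\<bar>p'\<bar> \<noteq> \<bar>q'\<bar>" using pq(3) p'q' by (auto simp: abs_mult)
  show ?thesis
  proof (cases "\<bar>p'\<bar> \<ge> 2")
    case True
    show ?thesis
      by (rule vN_property_Gamma_of_scaling[OF a t Z gen nz(1,3) True p'q'(3) rel[unfolded p'q'(1,2)]])
  next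
    case False
    then have q': "\<bar>q'\<bar> \<ge> 2" using nz ne by auto
    have rel': "inv t \<otimes> a [^] q \<otimes> inv (inv t) = a [^] p"
      using rel conj_eq_iff[OF t, of "a [^] p" "a [^] q"] t aG by simp
    have gen': "carrier G \<subseteq> generate G (insert (inv t) Z)"
    proof -
      have sub: "insert (inv t) Z \<subseteq> carrier G" using t Z by auto
      have "inv (inv t) \<in> generate G (insert (inv t) Z)"
        by (rule generate.inv) simp
      then have "insert t Z \<subseteq> generate G (insert (inv t) Z)"
        using t by (auto intro: generate.incl)
      then show ?thesis
        using gen generate_subgroup_incl[OF _ generate_is_subgroup[OF sub]] by blast
    qed
    show ?thesis
      by (rule vN_property_Gamma_of_scaling[OF a inv_closed[OF t] Z gen' nz(1,2) q' _ rel'[unfolded p'q'(1,2)]])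
         (use coprime_commute[THEN iffD1, OF p'q'(3)] in auto)
  qed
qed

section \<open>Finite conjugacy classes and powers of the stable letter\<close>

text \<open>
  Two of the conjugates of \<open>g\<close> by powers of \<open>x\<close> coincide.
\<close>

lemma commutes_with_power_if_finite_class:
  assumes g: "g \<in> carrier G" and x: "x \<in> carrier G" and fin: "finite (conjugacy_class G g)"
  shows "\<exists>j>0. g \<otimes> x [^] (j::nat) = x [^] j \<otimes> g"
proof -
  define f where "f k = x [^] k \<otimes> g \<otimes> inv (x [^] k)" for k :: nat
  have "range f \<subseteq> conjugacy_class G g"
    using x by (auto simp: f_def conjugacy_class_def)
  then have "\<not> inj f"
    using fin finite_subset finite_imageD infinite_UNIV_nat by blast
  then obtain k l where kl: "k < l" "f k = f l"
    by (metis injI linorder_neqE_nat)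
  define j where "j = l - k"
  have l: "x [^] l = x [^] k \<otimes> x [^] j"
    using kl x by (simp add: j_def nat_pow_mult)
  have c: "x [^] k \<in> carrier G" "x [^] j \<in> carrier G" using x by auto
  have "x [^] k \<otimes> g \<otimes> inv (x [^] k) = x [^] k \<otimes> (x [^] j \<otimes> g \<otimes> inv (x [^] j)) \<otimes> inv (x [^] k)"
    using kl(2) c g by (simp add: f_def l inv_mult_group m_assoc)
  then have "g = x [^] j \<otimes> g \<otimes> inv (x [^] j)"
    using c g by simp
  then have "g \<otimes> x [^] j = x [^] j \<otimes> g \<otimes> inv (x [^] j) \<otimes> x [^] j" by simp
  also have "\<dots> = x [^] j \<otimes> g" using c g by (simp add: m_assoc)
  finally show ?thesis using kl by (intro exI[of _ j]) (simp add: j_def)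
qed

text \<open>
  Conjugation by \<open>t\<^sup>i\<close> carries \<open>a\<close> to the power \<open>p\<^sup>i m\<close> to \<open>a\<close> to the power \<open>q\<^sup>i m\<close>. If it fixes \<open>a\<^sup>m\<close>, the two
  exponents agree.
\<close>

lemma stable_letter_not_periodic:
  fixes p q m :: int and i :: nat
  assumes a: "infinite_order a" and t: "t \<in> carrier G"
    and pq: "\<bar>p\<bar> \<noteq> \<bar>q\<bar>" and rel: "t \<otimes> a [^] p \<otimes> inv t = a [^] q"
    and m: "m \<noteq> 0" and comm: "t [^] i \<otimes> a [^] m = a [^] m \<otimes> t [^] i"
  shows "i = 0"
proof -
  note aG = infinite_order_closed[OF a]
  have conj: "t [^] i \<otimes> a [^] (p ^ i * x) \<otimes> inv (t [^] i) = a [^] (q ^ i * x)" for i :: nat and x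
  proof (induction i arbitrary: x)
    case (Suc i)
    have tp: "t \<otimes> a [^] (p * y) \<otimes> inv t = a [^] (q * y)" for y
      using conj_int_pow[OF t, of "a [^] p" y] aG by (simp add: rel int_pow_pow)
    have "t [^] Suc i \<otimes> a [^] (p ^ Suc i * x) \<otimes> inv (t [^] Suc i)
       = t [^] i \<otimes> (t \<otimes> a [^] (p * (p ^ i * x)) \<otimes> inv t) \<otimes> inv (t [^] i)"
      using t aG by (simp add: inv_mult_group m_assoc mult.assoc)
    also have "\<dots> = t [^] i \<otimes> a [^] (p ^ i * (q * x)) \<otimes> inv (t [^] i)"
      by (simp add: tp mult_ac)
    also have "\<dots> = a [^] (q ^ i * (q * x))"
      by (rule Suc.IH)
    finally show ?case by (simp add: mult_ac)
  qed (use t aG in simp)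
  have "t [^] i \<otimes> a [^] m \<otimes> inv (t [^] i) = a [^] m"
    using comm t aG by (simp add: m_assoc)
  then have "t [^] i \<otimes> a [^] (p ^ i * m) \<otimes> inv (t [^] i) = a [^] (p ^ i * m)"
    using conj_int_pow[of "t [^] i" "a [^] m" "p ^ i"] t aG by (simp add: int_pow_pow mult.commute)
  then have "q ^ i * m = p ^ i * m"
    using conj infinite_order_eq[OF a] by metis
  then have "\<bar>q\<bar> ^ i = \<bar>p\<bar> ^ i" using m by (simp flip: power_abs)
  then show "i = 0" using pq power_eq_imp_eq_base[of "\<bar>q\<bar>" i "\<bar>p\<bar>"] by auto
qed

end


section \<open>Normal forms in the HNN extension\<close>

lemma Inl_Plus_iff [simp]: "Inl x \<in> A <+> B \<longleftrightarrow> x \<in> A"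
  and Inr_Plus_iff [simp]: "Inr y \<in> A <+> B \<longleftrightarrow> y \<in> B"
  by auto

locale hnn_data = E: group E for E :: "('a, 'm) monoid_scheme" (structure) +
  fixes a :: 'a and p q :: int
  assumes a_order: "E.infinite_order a"
    and a_central: "\<And>x. x \<in> carrier E \<Longrightarrow> a \<otimes> x = x \<otimes> a"
    and p_nonzero: "p \<noteq> 0" and q_nonzero: "q \<noteq> 0"
begin

lemma a_closed: "a \<in> carrier E"
  by (rule E.infinite_order_closed[OF a_order])

lemma a_pow_closed: "a [^] (m::int) \<in> carrier E"
  using a_closed by simp

lemma a_pow_add: "a [^] (m + n) = a [^] m \<otimes> a [^] n" for m n :: int
  using a_closed by (rule E.int_pow_mult)

lemma a_pow_eq: "a [^] m = a [^] n \<longleftrightarrow> m = n" for m n :: int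
  by (rule E.infinite_order_eq[OF a_order])

text \<open>
  Representatives of the cosets modulo the powers of \<open>a\<^sup>r\<close> are normalised to \<open>\<one>\<close> on the trivial coset, so
  that cancellation of letters can be read off from them.
\<close>

definition rep :: "int \<Rightarrow> 'a \<Rightarrow> 'a" where
  "rep r e = (if \<exists>m. e = a [^] (r * m) then \<one>
     else SOME x. x \<in> carrier E \<and> (\<exists>m. e = x \<otimes> a [^] (r * m)))"

definition expo :: "int \<Rightarrow> 'a \<Rightarrow> int" where
  "expo r e = (SOME m. e = rep r e \<otimes> a [^] (r * m))"

lemma
  assumes e: "e \<in> carrier E"
  shows rep_closed: "rep r e \<in> carrier E"
    and rep_expo: "rep r e \<otimes> a [^] (r * expo r e) = e"
proof -
  have "rep r e \<in> carrier E \<and> (\<exists>m. e = rep r e \<otimes> a [^] (r * m))"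
  proof (cases "\<exists>m. e = a [^] (r * m)")
    case True
    then obtain m where "e = a [^] (r * m)" by blast
    then have "e = \<one> \<otimes> a [^] (r * m)" using e by simp
    then show ?thesis using True by (auto simp: rep_def)
  next
    case False
    have "\<exists>x. x \<in> carrier E \<and> (\<exists>m. e = x \<otimes> a [^] (r * m))"
      using e by (intro exI[of _ e] conjI exI[of _ 0]) auto
    then have "(SOME x. x \<in> carrier E \<and> (\<exists>m. e = x \<otimes> a [^] (r * m))) \<in> carrier E
       \<and> (\<exists>m. e = (SOME x. x \<in> carrier E \<and> (\<exists>m. e = x \<otimes> a [^] (r * m))) \<otimes> a [^] (r * m))"
      by (rule someI_ex)
    then show ?thesis using False by (simp only: rep_def if_False)
  qed
  then show "rep r e \<in> carrier E" "rep r e \<otimes> a [^] (r * expo r e) = e"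
    unfolding expo_def by (auto intro!: someI_ex[THEN sym])
qed

lemma mult_a_pow_iff:
  fixes k l :: int
  assumes "x \<in> carrier E" "y \<in> carrier E"
  shows "x \<otimes> a [^] k = y \<otimes> a [^] l \<longleftrightarrow> x = y \<otimes> a [^] (l - k)"
proof
  assume "x \<otimes> a [^] k = y \<otimes> a [^] l"
  then have "x \<otimes> a [^] k \<otimes> a [^] (- k) = y \<otimes> a [^] l \<otimes> a [^] (- k)" by simp
  then show "x = y \<otimes> a [^] (l - k)"
    using assms a_pow_closed by (simp add: E.m_assoc flip: a_pow_add)
next
  assume "x = y \<otimes> a [^] (l - k)"
  then show "x \<otimes> a [^] k = y \<otimes> a [^] l"
    using assms a_pow_closed by (simp add: E.m_assoc flip: a_pow_add)
qed

lemma rep_mult: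
  assumes e: "e \<in> carrier E"
  shows "rep r (e \<otimes> a [^] (r * m)) = rep r e"
proof -
  have 1: "(\<exists>n. e \<otimes> a [^] (r * m) = x \<otimes> a [^] (r * n)) \<longleftrightarrow> (\<exists>n. e = x \<otimes> a [^] (r * n))"
    if x: "x \<in> carrier E" for x
  proof
    assume "\<exists>n. e \<otimes> a [^] (r * m) = x \<otimes> a [^] (r * n)"
    then obtain n where "e = x \<otimes> a [^] (r * n - r * m)" using mult_a_pow_iff[OF e x] by auto
    then show "\<exists>n. e = x \<otimes> a [^] (r * n)" by (intro exI[of _ "n - m"]) (simp add: algebra_simps)
  next
    assume "\<exists>n. e = x \<otimes> a [^] (r * n)"
    then obtain n where "e = x \<otimes> a [^] (r * n)" by auto
    then show "\<exists>n. e \<otimes> a [^] (r * m) = x \<otimes> a [^] (r * n)"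
      using x a_pow_closed by (intro exI[of _ "n + m"]) (simp add: E.m_assoc distrib_left a_pow_add)
  qed
  have 2: "(\<exists>n. e \<otimes> a [^] (r * m) = a [^] (r * n)) \<longleftrightarrow> (\<exists>n. e = a [^] (r * n))"
    using 1[of "\<one>"] a_pow_closed by simp
  have 3: "(\<lambda>x. x \<in> carrier E \<and> (\<exists>n. e \<otimes> a [^] (r * m) = x \<otimes> a [^] (r * n)))
     = (\<lambda>x. x \<in> carrier E \<and> (\<exists>n. e = x \<otimes> a [^] (r * n)))"
    using 1 by (intro ext) blast
  show ?thesis unfolding rep_def 2 3 ..
qed

lemma rep_rep: "e \<in> carrier E \<Longrightarrow> rep r (rep r e) = rep r e"
  using rep_mult[OF rep_closed, of e r r "expo r e"] rep_expo[of e r] by simp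

lemma rep_one: "rep r \<one> = \<one>"
  unfolding rep_def using int_pow_0[of E a] by (metis mult_zero_right)

lemma expo_unique:
  assumes "r \<noteq> 0" "e \<in> carrier E" "rep r e \<otimes> a [^] (r * m) = e"
  shows "expo r e = m"
proof -
  have "rep r e \<otimes> a [^] (r * expo r e) = rep r e \<otimes> a [^] (r * m)"
    using rep_expo[OF assms(2)] assms(3) by simp
  then have "a [^] (r * expo r e) = a [^] (r * m)"
    using rep_closed[OF assms(2)] a_pow_closed by simp
  then show ?thesis using a_pow_eq assms(1) by simp
qed

lemma expo_mult:
  assumes r: "r \<noteq> 0" and e: "e \<in> carrier E"
  shows "expo r (e \<otimes> a [^] (r * m)) = expo r e + m"
proof (rule expo_unique[OF r])
  have "rep r e \<otimes> a [^] (r * (expo r e + m)) = (rep r e \<otimes> a [^] (r * expo r e)) \<otimes> a [^] (r * m)"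
    using rep_closed[OF e] a_pow_closed by (simp add: distrib_left a_pow_add E.m_assoc)
  then show "rep r (e \<otimes> a [^] (r * m)) \<otimes> a [^] (r * (expo r e + m)) = e \<otimes> a [^] (r * m)"
    using rep_mult[OF e] rep_expo[OF e] by simp
qed (use e a_pow_closed in simp)

lemma
  assumes r: "r \<noteq> 0" and x: "x \<in> carrier E" "rep r x = x"
  shows rep_of_rep_mult: "rep r (x \<otimes> a [^] (r * m)) = x"
    and expo_of_rep_mult: "expo r (x \<otimes> a [^] (r * m)) = m"
proof -
  show *: "rep r (x \<otimes> a [^] (r * m)) = x" using rep_mult[OF x(1)] x(2) by simp
  show "expo r (x \<otimes> a [^] (r * m)) = m"
    by (rule expo_unique[OF r]) (use * x a_pow_closed in auto)
qed

lemma
  assumes r: "r \<noteq> 0"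
  shows rep_a_pow: "rep r (a [^] (r * m)) = \<one>"
    and expo_a_pow: "expo r (a [^] (r * m)) = m"
  using rep_of_rep_mult[OF r E.one_closed rep_one] expo_of_rep_mult[OF r E.one_closed rep_one]
    a_pow_closed by simp_all

text \<open>
  A sign \<open>b\<close> stands for the letter \<open>t\<close> (\<open>True\<close>) or \<open>t\<^sup>-\<^sup>1\<close> (\<open>False\<close>). Moving a power of \<open>a\<close> from the left of that
  letter to its right consumes multiples of \<open>modulus b\<close> and produces multiples of \<open>modulus (\<not> b)\<close>.
\<close>

definition modulus :: "bool \<Rightarrow> int" where
  "modulus b = (if b then q else p)"

lemma modulus_nonzero: "modulus b \<noteq> 0"
  using p_nonzero q_nonzero by (simp add: modulus_def)

text \<open>
  A normal form \<open>r\<^sub>1 t\<^sup>\<plusminus>\<^sup>1 r\<^sub>2 t\<^sup>\<plusminus>\<^sup>1 \<dots> r\<^sub>n t\<^sup>\<plusminus>\<^sup>1 e\<close> is stored as the list of the pairs \<open>(r\<^sub>i, b\<^sub>i)\<close>, the last one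
  first, together with \<open>e\<close>. The group acts on normal forms from the right, where multiplication by a
  generator affects the head of the list only: \<open>step b\<close> writes \<open>e = r a\<^bsup>modulus b * m\<^esup>\<close>, moves the power of
  \<open>a\<close> past the new letter, and cancels the new letter with the head if \<open>r = \<one>\<close> and the signs are opposite.
\<close>

definition cancels :: "bool \<Rightarrow> ('a \<times> bool) list \<times> 'a \<Rightarrow> bool" where
  "cancels b \<omega> \<longleftrightarrow> rep (modulus b) (snd \<omega>) = \<one> \<and> fst \<omega> \<noteq> [] \<and> snd (hd (fst \<omega>)) \<noteq> b"

definition step :: "bool \<Rightarrow> ('a \<times> bool) list \<times> 'a \<Rightarrow> ('a \<times> bool) list \<times> 'a" where
  "step b \<omega> = (let r = rep (modulus b) (snd \<omega>); m = expo (modulus b) (snd \<omega>) in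
     if cancels b \<omega> then (tl (fst \<omega>), fst (hd (fst \<omega>)) \<otimes> a [^] (modulus (\<not> b) * m))
     else ((r, b) # fst \<omega>, a [^] (modulus (\<not> b) * m)))"

definition append_element :: "'a \<Rightarrow> ('a \<times> bool) list \<times> 'a \<Rightarrow> ('a \<times> bool) list \<times> 'a" where
  "append_element x \<omega> = (fst \<omega>, snd \<omega> \<otimes> x)"

primrec reduced :: "('a \<times> bool) list \<Rightarrow> bool" where
  "reduced [] = True"
| "reduced (x # l) \<longleftrightarrow> fst x \<in> carrier E \<and> rep (modulus (snd x)) (fst x) = fst x
     \<and> (l \<noteq> [] \<longrightarrow> fst x = \<one> \<longrightarrow> snd (hd l) = snd x) \<and> reduced l"

definition normal_forms :: "(('a \<times> bool) list \<times> 'a) set" where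
  "normal_forms = {\<omega>. reduced (fst \<omega>) \<and> snd \<omega> \<in> carrier E}"

lemma append_element_closed:
  "\<omega> \<in> normal_forms \<Longrightarrow> x \<in> carrier E \<Longrightarrow> append_element x \<omega> \<in> normal_forms"
  by (simp add: normal_forms_def append_element_def)

lemma step_closed:
  assumes "\<omega> \<in> normal_forms" shows "step b \<omega> \<in> normal_forms"
proof (cases "cancels b \<omega>")
  case True
  then show ?thesis
    using assms a_pow_closed by (cases "fst \<omega>") (auto simp: normal_forms_def step_def Let_def cancels_def)
next
  case False
  then show ?thesis
    using assms a_pow_closed rep_closed rep_rep
    by (auto simp: normal_forms_def step_def Let_def cancels_def)
qed

text \<open>
  A step that cancels is undone by one that does not, and conversely; reducedness of the list excludes
  a second cancellation.
\<close>

lemma step_inverse: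
  assumes \<omega>: "\<omega> \<in> normal_forms" shows "step (\<not> b) (step b \<omega>) = \<omega>"
proof -
  obtain l e where le: "\<omega> = (l, e)" by (cases \<omega>)
  have l: "reduced l" and e: "e \<in> carrier E" using \<omega> by (simp_all add: normal_forms_def le)
  define m where "m = expo (modulus b) e"
  note nz = modulus_nonzero[of "\<not> b"]
  show ?thesis
  proof (cases "cancels b \<omega>")
    case True
    then obtain s c l' where l': "l = (s, c) # l'" "c \<noteq> b" and r: "rep (modulus b) e = \<one>"
      by (cases l) (auto simp: cancels_def le)
    have c: "c = (\<not> b)" using l' by simp
    have s: "s \<in> carrier E" "rep (modulus (\<not> b)) s = s"
      using l by (simp_all add: l' c)
    have e_eq: "a [^] (modulus b * m) = e"
      using rep_expo[OF e, of "modulus b"] r a_pow_closed by (simp add: m_def)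
    have 1: "step b \<omega> = (l', s \<otimes> a [^] (modulus (\<not> b) * m))"
      using True by (simp add: step_def Let_def le l' m_def)
    have "\<not> cancels (\<not> b) (l', s \<otimes> a [^] (modulus (\<not> b) * m))"
      using l by (auto simp: cancels_def rep_of_rep_mult[OF nz s] l' c)
    then have "step (\<not> b) (l', s \<otimes> a [^] (modulus (\<not> b) * m)) = ((s, \<not> b) # l', a [^] (modulus b * m))"
      by (simp add: step_def Let_def rep_of_rep_mult[OF nz s] expo_of_rep_mult[OF nz s])
    then have "step (\<not> b) (step b \<omega>) = ((s, \<not> b) # l', e)"
      by (simp only: 1 e_eq)
    then show ?thesis by (simp only: le l'(1) c)
  next
    case False
    define r where "r = rep (modulus b) e"
    have 1: "step b \<omega> = ((r, b) # l, a [^] (modulus (\<not> b) * m))"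
      using False by (simp add: step_def Let_def le m_def r_def)
    have "cancels (\<not> b) ((r, b) # l, a [^] (modulus (\<not> b) * m))"
      by (simp add: cancels_def rep_a_pow[OF nz])
    then have "step (\<not> b) ((r, b) # l, a [^] (modulus (\<not> b) * m)) = (l, r \<otimes> a [^] (modulus b * m))"
      by (simp add: step_def Let_def expo_a_pow[OF nz])
    then have "step (\<not> b) (step b \<omega>) = (l, r \<otimes> a [^] (modulus b * m))"
      by (simp only: 1)
    then show ?thesis
      using rep_expo[OF e, of "modulus b"] by (simp add: le r_def m_def)
  qed
qed

text \<open>
  The defining relation of the extension, as an identity between actions.
\<close>

lemma step_append:
  assumes \<omega>: "\<omega> \<in> normal_forms"
  shows "step b (append_element (a [^] modulus b) \<omega>) = append_element (a [^] modulus (\<not> b)) (step b \<omega>)"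
proof -
  obtain l e where le: "\<omega> = (l, e)" by (cases \<omega>)
  have l: "reduced l" and e: "e \<in> carrier E" using \<omega> by (simp_all add: normal_forms_def le)
  have r: "rep (modulus b) (e \<otimes> a [^] modulus b) = rep (modulus b) e"
    using rep_mult[OF e, of "modulus b" 1] by simp
  have x: "expo (modulus b) (e \<otimes> a [^] modulus b) = expo (modulus b) e + 1"
    using expo_mult[OF modulus_nonzero e, of b 1] by simp
  have c: "cancels b (l, e \<otimes> a [^] modulus b) \<longleftrightarrow> cancels b (l, e)"
    by (simp add: cancels_def r)
  show ?thesis
  proof (cases "cancels b (l, e)")
    case True
    then have "fst (hd l) \<in> carrier E" using l by (cases l) (auto simp: cancels_def)
    then show ?thesis
      using True a_pow_closed
      by (simp add: step_def Let_def append_element_def le c x distrib_left a_pow_add E.m_assoc)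
  next
    case False
    then show ?thesis
      using a_pow_closed
      by (simp add: step_def Let_def append_element_def le c r x distrib_left a_pow_add)
  qed
qed

definition act_letter :: "'a + int \<Rightarrow> ('a \<times> bool) list \<times> 'a \<Rightarrow> ('a \<times> bool) list \<times> 'a" where
  "act_letter x = (case x of Inl e \<Rightarrow> append_element e
     | Inr n \<Rightarrow> if n \<ge> 0 then step True ^^ nat n else step False ^^ nat (- n))"

definition act :: "('a + int) list \<Rightarrow> ('a \<times> bool) list \<times> 'a \<Rightarrow> ('a \<times> bool) list \<times> 'a" where
  "act w = fold act_letter w"

abbreviation words :: "('a + int) list set" where
  "words \<equiv> lists (carrier E <+> carrier integer_group)"

lemma funpow_step_closed: "\<omega> \<in> normal_forms \<Longrightarrow> (step b ^^ k) \<omega> \<in> normal_forms"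
  by (induction k) (auto simp: step_closed)

lemma act_letter_closed:
  assumes "x \<in> carrier E <+> carrier integer_group" "\<omega> \<in> normal_forms"
  shows "act_letter x \<omega> \<in> normal_forms"
  using assms by (auto simp: act_letter_def append_element_closed funpow_step_closed)

lemma act_closed: "w \<in> words \<Longrightarrow> \<omega> \<in> normal_forms \<Longrightarrow> act w \<omega> \<in> normal_forms"
  unfolding act_def by (induction w arbitrary: \<omega>) (auto simp: act_letter_closed)

lemma act_append: "act (u @ v) \<omega> = act v (act u \<omega>)"
  by (simp add: act_def)

lemma act_Inr_Suc:
  assumes "\<omega> \<in> normal_forms"
  shows "act_letter (Inr (n + 1)) \<omega> = step True (act_letter (Inr n) \<omega>)"
    and "act_letter (Inr (n - 1)) \<omega> = step False (act_letter (Inr n) \<omega>)"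
proof -
  have inv: "step True (step False \<omega>) = \<omega>" "step False (step True \<omega>) = \<omega>" if "\<omega> \<in> normal_forms" for \<omega>
    using step_inverse[OF that, of False] step_inverse[OF that, of True] by simp_all
  show "act_letter (Inr (n + 1)) \<omega> = step True (act_letter (Inr n) \<omega>)"
  proof (cases "n \<ge> 0")
    case True
    then show ?thesis by (simp add: act_letter_def nat_add_distrib)
  next
    case False
    then obtain k where k: "n = - int (Suc k)" by (metis nat_int int_cases not_le of_nat_0_le_iff)
    then have "act_letter (Inr (n + 1)) \<omega> = (step False ^^ k) \<omega>" by (auto simp: act_letter_def)
    moreover have "act_letter (Inr n) \<omega> = step False ((step False ^^ k) \<omega>)"
      using k by (simp add: act_letter_def nat_add_distrib)
    ultimately show ?thesis using inv(1) funpow_step_closed[OF assms] by simp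
  qed
  show "act_letter (Inr (n - 1)) \<omega> = step False (act_letter (Inr n) \<omega>)"
  proof (cases "n > 0")
    case True
    then obtain k where k: "n = int (Suc k)" by (metis gr0_implies_Suc zero_less_imp_eq_int)
    then have "act_letter (Inr (n - 1)) \<omega> = (step True ^^ k) \<omega>" by (auto simp: act_letter_def)
    moreover have "act_letter (Inr n) \<omega> = step True ((step True ^^ k) \<omega>)"
      using k by (simp add: act_letter_def nat_add_distrib)
    ultimately show ?thesis using inv(2) funpow_step_closed[OF assms] by simp
  next
    case False
    then obtain k where k: "n = - int k" by (metis int_cases2 not_le of_nat_0_less_iff order.order_iff_strict neg_0_equal_iff_equal of_nat_0 not_gr_zero)
    then have "act_letter (Inr (n - 1)) \<omega> = step False ((step False ^^ k) \<omega>)"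
      by (simp add: act_letter_def nat_add_distrib)
    moreover have "act_letter (Inr n) \<omega> = (step False ^^ k) \<omega>"
      using k by (auto simp: act_letter_def)
    ultimately show ?thesis by simp
  qed
qed

lemma act_Inr_zero: "act_letter (Inr 0) \<omega> = \<omega>"
  by (simp add: act_letter_def)

lemma act_Inr_add:
  assumes \<omega>: "\<omega> \<in> normal_forms"
  shows "act_letter (Inr (m + n)) \<omega> = act_letter (Inr n) (act_letter (Inr m) \<omega>)"
proof -
  have cl: "act_letter (Inr m) \<omega> \<in> normal_forms"
    by (rule act_letter_closed) (use \<omega> in auto)
  show ?thesis
  proof (induction n rule: int_induct[where k = 0])
    case base
    then show ?case by (simp add: act_Inr_zero)
  next
    case (step1 i)
    then show ?case using act_Inr_Suc(1)[OF \<omega>, of "m + i"] act_Inr_Suc(1)[OF cl, of i] by (simp add: add.assoc)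
  next
    case (step2 i)
    then show ?case using act_Inr_Suc(2)[OF \<omega>, of "m + i"] act_Inr_Suc(2)[OF cl, of i] by (simp add: algebra_simps)
  qed
qed

lemma act_rel:
  assumes "(u, v) \<in> free_product_rel E integer_group" "\<omega> \<in> normal_forms"
  shows "act u \<omega> = act v \<omega>"
  using assms
proof (induction arbitrary: \<omega>)
  case (fp_cong u u' v v')
  have "u \<in> words"
    using free_product_rel_words[OF E.group_axioms group_integer_group fp_cong.hyps(1)] by simp
  then have "act v (act u \<omega>) = act v' (act u \<omega>)"
    by (rule fp_cong.IH(2)[OF act_closed[OF _ fp_cong.prems]])
  then show ?case unfolding act_append fp_cong.IH(1)[OF fp_cong.prems] .
next
  case fp_one_left
  then show ?case
    by (cases \<omega>) (simp add: act_def act_letter_def append_element_def normal_forms_def)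
next
  case (fp_mult_left x y)
  then show ?case
    by (cases \<omega>) (simp add: act_def act_letter_def append_element_def normal_forms_def E.m_assoc)
next
  case fp_one_right
  then show ?case by (simp add: act_def act_Inr_zero)
next
  case (fp_mult_right x y)
  then show ?case by (simp add: act_def act_Inr_add)
qed auto

abbreviation F :: "('a + int) list set monoid" where
  "F \<equiv> free_product E integer_group"

abbreviation cls :: "('a + int) list \<Rightarrow> ('a + int) list set" where
  "cls w \<equiv> free_product_rel E integer_group `` {w}"

abbreviation N :: "('a + int) list set set" where
  "N \<equiv> normal_closure F {hnn_relator E a p q}"

abbreviation \<Gamma> :: "('a + int) list set set monoid" where
  "\<Gamma> \<equiv> hnn_group E a p q"

lemma F_group: "group F"
  by (rule free_product_group[OF E.group_axioms group_integer_group])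

lemma \<Gamma>_group: "group \<Gamma>"
  by (rule hnn_group_group[OF E.group_axioms a_closed])

lemma cls_closed: "w \<in> words \<Longrightarrow> cls w \<in> carrier F"
  by (simp add: free_product_def quotientI)

lemma carrier_F: "A \<in> carrier F \<Longrightarrow> \<exists>w\<in>words. A = cls w"
  unfolding free_product_def by (auto elim: quotientE)

lemma cls_mult: "u \<in> words \<Longrightarrow> v \<in> words \<Longrightarrow> cls u \<otimes>\<^bsub>F\<^esub> cls v = cls (u @ v)"
  by (rule free_product_mult_class[OF E.group_axioms group_integer_group])

lemma cls_eq_iff:
  assumes "u \<in> words" "v \<in> words"
  shows "cls u = cls v \<longleftrightarrow> (u, v) \<in> free_product_rel E integer_group"
  by (rule eq_equiv_class_iff[OF free_product_rel_equiv[OF E.group_axioms group_integer_group] assms])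

lemma cls_Nil: "\<one>\<^bsub>F\<^esub> = cls []"
  by (simp add: free_product_def)

lemma cls_hom_E: "(\<lambda>x. cls [Inl x]) \<in> hom E F"
proof (rule homI)
  fix x y assume xy: "x \<in> carrier E" "y \<in> carrier E"
  have "cls [Inl x] \<otimes>\<^bsub>F\<^esub> cls [Inl y] = cls [Inl x, Inl y]"
    using xy cls_mult[of "[Inl x]" "[Inl y]"] by simp
  also have "\<dots> = cls [Inl (x \<otimes> y)]"
    using xy by (subst cls_eq_iff) (auto intro: fp_mult_left)
  finally show "cls [Inl (x \<otimes> y)] = cls [Inl x] \<otimes>\<^bsub>F\<^esub> cls [Inl y]" by simp
qed (simp add: cls_closed)

lemma cls_inv_t: "inv\<^bsub>F\<^esub> (cls [Inr 1]) = cls [Inr (- 1)]"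
proof -
  interpret F: group F by (rule F_group)
  have "cls [Inr (- 1)] \<otimes>\<^bsub>F\<^esub> cls [Inr 1] = cls [Inr (-1), Inr 1]"
    by (subst cls_mult) auto
  also have "\<dots> = cls [Inr 0]"
    using fp_mult_right[of "-1" integer_group 1 E] by (subst cls_eq_iff) auto
  also have "\<dots> = \<one>\<^bsub>F\<^esub>"
    using fp_one_right[of integer_group E] by (subst cls_Nil, subst cls_eq_iff) auto
  finally show ?thesis by (intro F.inv_equality) (auto intro: cls_closed)
qed

lemma relator_word: "hnn_relator E a p q = cls [Inr 1, Inl (a [^] p), Inr (- 1), Inl (a [^] (- q))]"
proof -
  have pow: "cls [Inl a] [^]\<^bsub>F\<^esub> (m::int) = cls [Inl (a [^] m)]" for m
    using hom_int_pow[OF cls_hom_E a_closed E.group_axioms F_group, of m] by simp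
  show ?thesis
    unfolding hnn_relator_def Let_def fp_inl_def fp_inr_def pow cls_inv_t
    using a_pow_closed by (simp add: cls_mult)
qed

lemma act_relator:
  assumes \<omega>: "\<omega> \<in> normal_forms"
  shows "act [Inr 1, Inl (a [^] p), Inr (- 1), Inl (a [^] (- q))] \<omega> = \<omega>"
proof -
  note q_closed = append_element_closed[OF \<omega> a_pow_closed, of q]
  have "append_element (a [^] p) (step True \<omega>) = step True (append_element (a [^] q) \<omega>)"
    using step_append[OF \<omega>, of True] by (simp add: modulus_def)
  then have "step False (append_element (a [^] p) (step True \<omega>)) = append_element (a [^] q) \<omega>"
    using step_inverse[OF q_closed, of True] by simp
  then show ?thesis
    using \<omega> a_pow_closed
    by (simp add: act_def act_letter_def) (simp add: append_element_def normal_forms_def E.m_assoc flip: a_pow_add)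
qed

text \<open>
  The classes of words that act trivially form a subgroup \<open>K\<close> of the free product that is invariant under
  conjugation and contains the relator.
\<close>

lemma act_normal_closure:
  assumes "A \<in> N"
  shows "A \<in> carrier F \<and> (\<forall>w\<in>A. \<forall>\<omega>\<in>normal_forms. act w \<omega> = \<omega>)"
proof -
  interpret F: group F by (rule F_group)
  define K where "K = {A \<in> carrier F. \<forall>w\<in>A. \<forall>\<omega>\<in>normal_forms. act w \<omega> = \<omega>}"
  have K_iff: "cls w \<in> K \<longleftrightarrow> (\<forall>\<omega>\<in>normal_forms. act w \<omega> = \<omega>)" if "w \<in> words" for w
  proof
    assume "cls w \<in> K"
    moreover have "w \<in> cls w" using fp_refl[OF that] by simp
    ultimately show "\<forall>\<omega>\<in>normal_forms. act w \<omega> = \<omega>" unfolding K_def by blast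
  next
    assume w: "\<forall>\<omega>\<in>normal_forms. act w \<omega> = \<omega>"
    have "act v \<omega> = \<omega>" if "v \<in> cls w" "\<omega> \<in> normal_forms" for v \<omega>
      using act_rel[of w v \<omega>] that w by simp
    then show "cls w \<in> K" unfolding K_def using cls_closed[OF that] by blast
  qed
  have inv_word: "\<exists>v\<in>words. inv\<^bsub>F\<^esub> (cls u) = cls v \<and> (\<forall>\<omega>\<in>normal_forms. act v (act u \<omega>) = \<omega>)"
    if u: "u \<in> words" for u
  proof -
    obtain v where v: "v \<in> words" "inv\<^bsub>F\<^esub> (cls u) = cls v"
      using carrier_F[OF F.inv_closed[OF cls_closed[OF u]]] by blast
    then have "cls (u @ v) = cls []"
      using cls_mult[OF u v(1)] F.r_inv[OF cls_closed[OF u]] by (simp add: cls_Nil)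
    then have "(u @ v, []) \<in> free_product_rel E integer_group"
      using u v by (subst (asm) cls_eq_iff) auto
    then have "act v (act u \<omega>) = \<omega>" if "\<omega> \<in> normal_forms" for \<omega>
      using act_rel[of "u @ v" "[]", OF _ that] by (simp add: act_def)
    then show ?thesis using v by blast
  qed
  have K_word: "\<exists>w\<in>words. A = cls w" if "A \<in> K" for A
    using that carrier_F unfolding K_def by simp
  have K_mult: "A \<otimes>\<^bsub>F\<^esub> B \<in> K" if "A \<in> K" "B \<in> K" for A B
  proof -
    obtain u v where uv: "u \<in> words" "v \<in> words" "A = cls u" "B = cls v"
      using K_word[OF \<open>A \<in> K\<close>] K_word[OF \<open>B \<in> K\<close>] by auto
    then show ?thesis using that K_iff[of u] K_iff[of v] K_iff[of "u @ v"] by (simp add: cls_mult act_append)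
  qed
  have K_inv: "inv\<^bsub>F\<^esub> A \<in> K" if "A \<in> K" for A
  proof -
    obtain u where u: "u \<in> words" "A = cls u" using K_word[OF \<open>A \<in> K\<close>] by auto
    obtain v where v: "v \<in> words" "inv\<^bsub>F\<^esub> (cls u) = cls v" "\<forall>\<omega>\<in>normal_forms. act v (act u \<omega>) = \<omega>"
      using inv_word[OF u(1)] by blast
    then show ?thesis using that u K_iff by simp
  qed
  have K_conj: "g \<otimes>\<^bsub>F\<^esub> r \<otimes>\<^bsub>F\<^esub> inv\<^bsub>F\<^esub> g \<in> K" if g: "g \<in> carrier F" and r: "r \<in> K" for g r
  proof -
    obtain u where u: "u \<in> words" "g = cls u" using carrier_F[OF g] by blast
    obtain w where w: "w \<in> words" "r = cls w" using K_word[OF r] by auto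
    obtain v where v: "v \<in> words" "inv\<^bsub>F\<^esub> (cls u) = cls v" "\<forall>\<omega>\<in>normal_forms. act v (act u \<omega>) = \<omega>"
      using inv_word[OF u(1)] by blast
    have "g \<otimes>\<^bsub>F\<^esub> r \<otimes>\<^bsub>F\<^esub> inv\<^bsub>F\<^esub> g = cls (u @ w @ v)"
      using u w v by (simp add: cls_mult)
    moreover have "\<forall>\<omega>\<in>normal_forms. act w \<omega> = \<omega>" using r w K_iff by simp
    ultimately show ?thesis
      using u w v K_iff[of "u @ w @ v"] by (simp add: act_append act_closed)
  qed
  have relator: "hnn_relator E a p q \<in> K"
    unfolding relator_word using a_pow_closed act_relator by (subst K_iff) auto
  have "A \<in> K"
    using assms unfolding normal_closure_def
  proof (induction rule: generate.induct)
    case one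
    show ?case using K_iff[of "[]"] by (simp add: cls_Nil act_def)
  next
    case (incl h)
    then show ?case using K_conj relator by auto
  next
    case (inv h)
    then show ?case using K_conj relator K_inv by auto
  next
    case (eng h1 h2)
    then show ?case using K_mult by simp
  qed
  then show ?thesis by (simp add: K_def)
qed

definition proj :: "('a + int) list \<Rightarrow> ('a + int) list set set" where
  "proj w = N #>\<^bsub>F\<^esub> cls w"

lemma N_normal: "N \<lhd> F"
proof -
  have "hnn_relator E a p q \<in> carrier F"
    unfolding relator_word using a_pow_closed by (intro cls_closed) simp
  then show ?thesis by (intro normal_closure_normal F_group) simp
qed

lemma proj_closed: "w \<in> words \<Longrightarrow> proj w \<in> carrier \<Gamma>"
  unfolding hnn_group_def FactGroup_def proj_def RCOSETS_def using cls_closed by auto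

lemma carrier_\<Gamma>: "g \<in> carrier \<Gamma> \<Longrightarrow> \<exists>w\<in>words. g = proj w"
  unfolding hnn_group_def FactGroup_def proj_def RCOSETS_def using carrier_F by auto

lemma proj_mult: "u \<in> words \<Longrightarrow> v \<in> words \<Longrightarrow> proj u \<otimes>\<^bsub>\<Gamma>\<^esub> proj v = proj (u @ v)"
  unfolding hnn_group_def FactGroup_def proj_def
  using normal.rcos_sum[OF N_normal cls_closed cls_closed] by (simp add: cls_mult)

lemma proj_eq_cls: "cls u = cls v \<Longrightarrow> proj u = proj v"
  by (simp add: proj_def)

lemma act_proj:
  assumes u: "u \<in> words" and v: "v \<in> words" and eq: "proj u = proj v" and \<omega>: "\<omega> \<in> normal_forms"
  shows "act u \<omega> = act v \<omega>"
proof -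
  interpret F: group F by (rule F_group)
  have "cls u \<in> N #>\<^bsub>F\<^esub> cls v"
    using F.rcos_self[OF cls_closed[OF u] normal_imp_subgroup[OF N_normal]] eq by (simp add: proj_def)
  then obtain n where n: "n \<in> N" "cls u = n \<otimes>\<^bsub>F\<^esub> cls v"
    by (auto simp: r_coset_def)
  obtain w where w: "w \<in> words" "n = cls w"
    using act_normal_closure[OF n(1)] carrier_F by blast
  have "act w \<omega> = \<omega>"
    using act_normal_closure[OF n(1)] w fp_refl[OF w(1)] \<omega> by blast
  moreover have "(u, w @ v) \<in> free_product_rel E integer_group"
    using n w u v by (simp add: cls_mult cls_eq_iff)
  ultimately show ?thesis using act_rel[OF _ \<omega>] by (metis act_append)
qed

text \<open>
  The normal form of \<open>g\<close> is the image of the empty one under \<open>g\<close>; by \<open>act_proj\<close> the choice of the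
  word does not matter.
\<close>

definition nf :: "('a + int) list set set \<Rightarrow> ('a \<times> bool) list \<times> 'a" where
  "nf g = act (SOME w. w \<in> words \<and> proj w = g) ([], \<one>)"

lemma empty_normal_form: "([], \<one>) \<in> normal_forms"
  by (simp add: normal_forms_def)

lemma nf_proj:
  assumes w: "w \<in> words" shows "nf (proj w) = act w ([], \<one>)"
proof -
  let ?v = "SOME v. v \<in> words \<and> proj v = proj w"
  have "?v \<in> words \<and> proj ?v = proj w"
    by (rule someI[of "\<lambda>v. v \<in> words \<and> proj v = proj w", OF conjI[OF w refl]])
  then show ?thesis
    unfolding nf_def using act_proj[OF _ w _ empty_normal_form] by simp
qed

definition \<iota> :: "'a \<Rightarrow> ('a + int) list set set" where
  "\<iota> x = proj [Inl x]"

text \<open>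
  The stable letter is \<open>\<tau> True\<close>, and \<open>\<tau> False\<close> is its inverse.
\<close>

definition \<tau> :: "bool \<Rightarrow> ('a + int) list set set" where
  "\<tau> b = proj [Inr (if b then 1 else - 1)]"

lemma \<iota>_closed: "x \<in> carrier E \<Longrightarrow> \<iota> x \<in> carrier \<Gamma>"
  by (simp add: \<iota>_def proj_closed)

lemma \<tau>_closed: "\<tau> b \<in> carrier \<Gamma>"
  by (simp add: \<tau>_def proj_closed)

lemma \<iota>_hom: "\<iota> \<in> hom E \<Gamma>"
proof (rule homI)
  fix x y assume xy: "x \<in> carrier E" "y \<in> carrier E"
  then have "cls [Inl (x \<otimes> y)] = cls [Inl x, Inl y]"
    using hom_mult[OF cls_hom_E xy] by (simp add: cls_mult)
  then show "\<iota> (x \<otimes> y) = \<iota> x \<otimes>\<^bsub>\<Gamma>\<^esub> \<iota> y"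
    using xy proj_eq_cls[of "[Inl (x \<otimes> y)]" "[Inl x, Inl y]"] by (simp add: \<iota>_def proj_mult)
qed (rule \<iota>_closed)

lemma one_\<Gamma>: "\<one>\<^bsub>\<Gamma>\<^esub> = proj []"
  unfolding hnn_group_def FactGroup_def proj_def
  using group.coset_mult_one[OF F_group] normal_imp_subgroup[OF N_normal] subgroup.subset
  by (simp add: cls_Nil[symmetric])  blast

lemma \<tau>_inverse: "\<tau> (\<not> b) = inv\<^bsub>\<Gamma>\<^esub> \<tau> b"
proof -
  interpret G: group \<Gamma> by (rule \<Gamma>_group)
  have "cls [Inr (- n), Inr n] = cls []" for n
  proof -
    have "cls [Inr (- n), Inr n] = cls [Inr 0]"
      using fp_mult_right[of "-n" integer_group n E] by (subst cls_eq_iff) auto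
    also have "\<dots> = cls []"
      using fp_one_right[of integer_group E] by (subst cls_eq_iff) auto
    finally show ?thesis .
  qed
  from proj_eq_cls[OF this, of 1] proj_eq_cls[OF this, of "-1"]
  have "\<tau> (\<not> b) \<otimes>\<^bsub>\<Gamma>\<^esub> \<tau> b = \<one>\<^bsub>\<Gamma>\<^esub>"
    by (simp add: \<tau>_def proj_mult one_\<Gamma>)
  then show ?thesis using G.inv_equality[OF _ \<tau>_closed \<tau>_closed] by simp
qed

lemma relation_\<Gamma>: "\<tau> True \<otimes>\<^bsub>\<Gamma>\<^esub> (\<iota> a [^]\<^bsub>\<Gamma>\<^esub> p) \<otimes>\<^bsub>\<Gamma>\<^esub> inv\<^bsub>\<Gamma>\<^esub> \<tau> True = \<iota> a [^]\<^bsub>\<Gamma>\<^esub> q"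
proof -
  interpret G: group \<Gamma> by (rule \<Gamma>_group)
  interpret F: group F by (rule F_group)
  have pow: "\<iota> a [^]\<^bsub>\<Gamma>\<^esub> (m::int) = \<iota> (a [^] m)" for m
    using hom_int_pow[OF \<iota>_hom a_closed E.group_axioms \<Gamma>_group, of m] by simp
  have "proj [Inr 1, Inl (a [^] p), Inr (- 1), Inl (a [^] (- q))] = \<one>\<^bsub>\<Gamma>\<^esub>"
  proof -
    have "hnn_relator E a p q \<in> carrier F"
      unfolding relator_word using a_pow_closed by (intro cls_closed) simp
    then have "\<one>\<^bsub>F\<^esub> \<otimes>\<^bsub>F\<^esub> hnn_relator E a p q \<otimes>\<^bsub>F\<^esub> inv\<^bsub>F\<^esub> \<one>\<^bsub>F\<^esub> \<in> N"
      unfolding normal_closure_def by (intro generate.incl) blast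
    then have "hnn_relator E a p q \<in> N"
      using \<open>hnn_relator E a p q \<in> carrier F\<close> by simp
    then have "N #>\<^bsub>F\<^esub> hnn_relator E a p q = N"
      using F.coset_join2[OF \<open>hnn_relator E a p q \<in> carrier F\<close> normal_imp_subgroup[OF N_normal]] by simp
    then show ?thesis
      unfolding proj_def relator_word[symmetric] by (simp add: hnn_group_def FactGroup_def)
  qed
  moreover have "proj [Inr 1, Inl (a [^] p), Inr (- 1), Inl (a [^] (- q))]
     = \<tau> True \<otimes>\<^bsub>\<Gamma>\<^esub> \<iota> (a [^] p) \<otimes>\<^bsub>\<Gamma>\<^esub> \<tau> False \<otimes>\<^bsub>\<Gamma>\<^esub> \<iota> (a [^] (- q))"
    using a_pow_closed by (simp add: \<tau>_def \<iota>_def proj_mult)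
  ultimately have "(\<tau> True \<otimes>\<^bsub>\<Gamma>\<^esub> (\<iota> a [^]\<^bsub>\<Gamma>\<^esub> p) \<otimes>\<^bsub>\<Gamma>\<^esub> inv\<^bsub>\<Gamma>\<^esub> \<tau> True) \<otimes>\<^bsub>\<Gamma>\<^esub> inv\<^bsub>\<Gamma>\<^esub> (\<iota> a [^]\<^bsub>\<Gamma>\<^esub> q) = \<one>\<^bsub>\<Gamma>\<^esub>"
    using \<tau>_inverse[of True] \<iota>_closed[OF a_closed] by (simp add: pow[symmetric] G.int_pow_neg)
  then show ?thesis
    using \<tau>_closed[of True] \<iota>_closed[OF a_closed] by (simp add: G.mult_inv_eq_iff)
qed

lemma nf_one: "nf \<one>\<^bsub>\<Gamma>\<^esub> = ([], \<one>)"
  by (simp add: one_\<Gamma> nf_proj act_def)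

lemma nf_closed: "g \<in> carrier \<Gamma> \<Longrightarrow> nf g \<in> normal_forms"
  using carrier_\<Gamma> nf_proj act_closed empty_normal_form by metis

lemma nf_mult_proj:
  assumes "g \<in> carrier \<Gamma>" "w \<in> words"
  shows "nf (g \<otimes>\<^bsub>\<Gamma>\<^esub> proj w) = act w (nf g)"
proof -
  obtain v where v: "v \<in> words" "g = proj v" using carrier_\<Gamma>[OF assms(1)] by blast
  then have "v @ w \<in> words" using assms(2) by simp
  then show ?thesis using v assms(2) by (simp only: proj_mult nf_proj act_append)
qed

lemma nf_mult_\<iota>: "g \<in> carrier \<Gamma> \<Longrightarrow> x \<in> carrier E \<Longrightarrow> nf (g \<otimes>\<^bsub>\<Gamma>\<^esub> \<iota> x) = append_element x (nf g)"
  unfolding \<iota>_def by (subst nf_mult_proj) (auto simp: act_def act_letter_def)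

lemma nf_mult_\<tau>: "g \<in> carrier \<Gamma> \<Longrightarrow> nf (g \<otimes>\<^bsub>\<Gamma>\<^esub> \<tau> b) = step b (nf g)"
  unfolding \<tau>_def by (subst nf_mult_proj) (auto simp: act_def act_letter_def)

lemma generate_\<Gamma>: "carrier \<Gamma> \<subseteq> generate \<Gamma> (insert (\<tau> True) (\<iota> ` carrier E))"
proof
  interpret G: group \<Gamma> by (rule \<Gamma>_group)
  let ?S = "insert (\<tau> True) (\<iota> ` carrier E)"
  let ?H = "generate \<Gamma> ?S"
  have S: "?S \<subseteq> carrier \<Gamma>" using \<tau>_closed \<iota>_closed by auto
  note H = G.generate_is_subgroup[OF S]
  have Inr_power: "proj [Inr n] \<in> ?H" for n
  proof (induction n rule: int_induct[where k = 0])
    case base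
    have "cls [Inr 0] = cls []"
      using fp_one_right[of integer_group E] by (subst cls_eq_iff) auto
    then have "proj [Inr 0] = \<one>\<^bsub>\<Gamma>\<^esub>" unfolding one_\<Gamma> by (rule proj_eq_cls)
    then show ?case using generate.one[of \<Gamma> ?S] by simp
  next
    case (step1 i)
    have "cls [Inr (i + 1)] = cls ([Inr i] @ [Inr 1])"
      using fp_mult_right[of i integer_group 1 E] by (subst cls_eq_iff) (auto intro: fp_sym)
    from proj_eq_cls[OF this] have "proj [Inr (i + 1)] = proj [Inr i] \<otimes>\<^bsub>\<Gamma>\<^esub> \<tau> True"
      by (simp add: \<tau>_def proj_mult)
    then show ?case using step1 by (simp add: generate.eng generate.incl)
  next
    case (step2 i)
    have "cls [Inr (i - 1)] = cls ([Inr i] @ [Inr (- 1)])"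
      using fp_mult_right[of i integer_group "- 1" E] by (subst cls_eq_iff) (auto intro: fp_sym)
    from proj_eq_cls[OF this] have "proj [Inr (i - 1)] = proj [Inr i] \<otimes>\<^bsub>\<Gamma>\<^esub> \<tau> False"
      by (simp add: \<tau>_def proj_mult)
    then show ?case using step2 \<tau>_inverse[of True] by (simp add: generate.eng generate.inv)
  qed
  have "proj w \<in> ?H" if "w \<in> words" for w
    using that
  proof induction
    case Nil
    then show ?case using generate.one[of \<Gamma> ?S] by (simp add: one_\<Gamma>)
  next
    case (Cons x w)
    have "proj [x] \<in> ?H"
    proof (cases x)
      case (Inl e)
      then show ?thesis using Cons.hyps by (auto simp: \<iota>_def[symmetric] intro: generate.incl)
    next
      case (Inr n)
      then show ?thesis using Inr_power by simp
    qed
    moreover have "proj (x # w) = proj [x] \<otimes>\<^bsub>\<Gamma>\<^esub> proj w"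
      using Cons.hyps by (simp add: proj_mult)
    ultimately show ?case using Cons by (simp add: generate.eng)
  qed
  then show "g \<in> ?H" if "g \<in> carrier \<Gamma>" for g using carrier_\<Gamma>[OF that] by auto
qed

end


context hnn_data
begin

section \<open>Infinite conjugacy classes in the HNN extension\<close>

lemma \<Gamma>_induct [consumes 1, case_names one base stable mult]:
  assumes g: "g \<in> carrier \<Gamma>"
    and one: "P \<one>\<^bsub>\<Gamma>\<^esub>" and base: "\<And>x. x \<in> carrier E \<Longrightarrow> P (\<iota> x)" and stable: "\<And>b. P (\<tau> b)"
    and mult: "\<And>g h. g \<in> carrier \<Gamma> \<Longrightarrow> h \<in> carrier \<Gamma> \<Longrightarrow> P g \<Longrightarrow> P h \<Longrightarrow> P (g \<otimes>\<^bsub>\<Gamma>\<^esub> h)"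
  shows "P g"
proof -
  interpret G: group \<Gamma> by (rule \<Gamma>_group)
  have S: "insert (\<tau> True) (\<iota> ` carrier E) \<subseteq> carrier \<Gamma>" using \<tau>_closed \<iota>_closed by auto
  have "g \<in> generate \<Gamma> (insert (\<tau> True) (\<iota> ` carrier E))" using g generate_\<Gamma> by blast
  then show ?thesis
  proof induction
    case (inv h)
    have "inv\<^bsub>\<Gamma>\<^esub> \<iota> x = \<iota> (inv x)" if "x \<in> carrier E" for x
    proof -
      have "\<iota> (inv x) \<otimes>\<^bsub>\<Gamma>\<^esub> \<iota> x = \<one>\<^bsub>\<Gamma>\<^esub>"
        using hom_mult[OF \<iota>_hom, of "inv x" x] hom_one[OF \<iota>_hom E.group_axioms \<Gamma>_group] that by simp
      then show ?thesis using G.inv_equality that \<iota>_closed by simp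
    qed
    then show ?case using inv base stable[of False] \<tau>_inverse[of True] by auto
  next
    case (eng h1 h2)
    then show ?case using mult G.generate_in_carrier[OF S] by blast
  qed (use one base stable in auto)
qed

primrec eval_stack :: "('a \<times> bool) list \<Rightarrow> ('a + int) list set set" where
  "eval_stack [] = \<one>\<^bsub>\<Gamma>\<^esub>"
| "eval_stack (x # l) = eval_stack l \<otimes>\<^bsub>\<Gamma>\<^esub> \<iota> (fst x) \<otimes>\<^bsub>\<Gamma>\<^esub> \<tau> (snd x)"

definition eval_nf :: "('a \<times> bool) list \<times> 'a \<Rightarrow> ('a + int) list set set" where
  "eval_nf \<omega> = eval_stack (fst \<omega>) \<otimes>\<^bsub>\<Gamma>\<^esub> \<iota> (snd \<omega>)"

lemma \<iota>_pow: "\<iota> a [^]\<^bsub>\<Gamma>\<^esub> (m::int) = \<iota> (a [^] m)"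
  using hom_int_pow[OF \<iota>_hom a_closed E.group_axioms \<Gamma>_group, of m] by simp

lemma \<iota>_mult: "x \<in> carrier E \<Longrightarrow> y \<in> carrier E \<Longrightarrow> \<iota> (x \<otimes> y) = \<iota> x \<otimes>\<^bsub>\<Gamma>\<^esub> \<iota> y"
  by (rule hom_mult[OF \<iota>_hom])

lemma \<iota>_one: "\<iota> \<one> = \<one>\<^bsub>\<Gamma>\<^esub>"
  by (rule hom_one[OF \<iota>_hom E.group_axioms \<Gamma>_group])

lemma relation_bool:
  "\<tau> b \<otimes>\<^bsub>\<Gamma>\<^esub> (\<iota> a [^]\<^bsub>\<Gamma>\<^esub> modulus (\<not> b)) \<otimes>\<^bsub>\<Gamma>\<^esub> inv\<^bsub>\<Gamma>\<^esub> \<tau> b = \<iota> a [^]\<^bsub>\<Gamma>\<^esub> modulus b"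
proof -
  interpret G: group \<Gamma> by (rule \<Gamma>_group)
  have c: "\<iota> a [^]\<^bsub>\<Gamma>\<^esub> (m::int) \<in> carrier \<Gamma>" for m using \<iota>_closed[OF a_closed] by simp
  show ?thesis
  proof (cases b)
    case True
    then show ?thesis using relation_\<Gamma> by (simp add: modulus_def)
  next
    case False
    then show ?thesis
      using G.conj_eq_iff[OF \<tau>_closed c c, of True q p] relation_\<Gamma> \<tau>_inverse[of True] \<tau>_closed
      by (simp add: modulus_def)
  qed
qed

lemma commute_stable:
  "\<tau> b \<otimes>\<^bsub>\<Gamma>\<^esub> \<iota> (a [^] (modulus (\<not> b) * m)) = \<iota> (a [^] (modulus b * m)) \<otimes>\<^bsub>\<Gamma>\<^esub> \<tau> b"
proof -
  interpret G: group \<Gamma> by (rule \<Gamma>_group)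
  note t = \<tau>_closed[of b] and \<alpha> = \<iota>_closed[OF a_closed]
  have "\<tau> b \<otimes>\<^bsub>\<Gamma>\<^esub> (\<iota> a [^]\<^bsub>\<Gamma>\<^esub> (modulus (\<not> b) * m)) \<otimes>\<^bsub>\<Gamma>\<^esub> inv\<^bsub>\<Gamma>\<^esub> \<tau> b = \<iota> a [^]\<^bsub>\<Gamma>\<^esub> (modulus b * m)"
    using G.conj_int_pow[OF t, of "\<iota> a [^]\<^bsub>\<Gamma>\<^esub> modulus (\<not> b)" m] \<alpha> by (simp add: relation_bool G.int_pow_pow)
  then show ?thesis
    unfolding \<iota>_pow using t \<iota>_closed[OF a_pow_closed]
    by (metis G.inv_solve_right' G.m_closed)
qed

lemma eval_stack_closed: "reduced l \<Longrightarrow> eval_stack l \<in> carrier \<Gamma>"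
proof (induction l)
  case Nil
  interpret G: group \<Gamma> by (rule \<Gamma>_group)
  show ?case by simp
next
  case (Cons x l)
  interpret G: group \<Gamma> by (rule \<Gamma>_group)
  show ?case using Cons by (auto intro!: G.m_closed \<iota>_closed \<tau>_closed)
qed

lemma eval_append_element:
  assumes "\<omega> \<in> normal_forms" "x \<in> carrier E"
  shows "eval_nf (append_element x \<omega>) = eval_nf \<omega> \<otimes>\<^bsub>\<Gamma>\<^esub> \<iota> x"
proof -
  interpret G: group \<Gamma> by (rule \<Gamma>_group)
  show ?thesis
    using assms eval_stack_closed[of "fst \<omega>"]
    by (simp add: eval_nf_def append_element_def normal_forms_def \<iota>_mult G.m_assoc \<iota>_closed)
qed

lemma eval_step:
  assumes \<omega>: "\<omega> \<in> normal_forms"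
  shows "eval_nf (step b \<omega>) = eval_nf \<omega> \<otimes>\<^bsub>\<Gamma>\<^esub> \<tau> b"
proof -
  interpret G: group \<Gamma> by (rule \<Gamma>_group)
  obtain l e where le: "\<omega> = (l, e)" by (cases \<omega>)
  have l: "reduced l" and e: "e \<in> carrier E" using \<omega> by (simp_all add: normal_forms_def le)
  define m where "m = expo (modulus b) e"
  define r where "r = rep (modulus b) e"
  have r: "r \<in> carrier E" and re: "r \<otimes> a [^] (modulus b * m) = e"
    using rep_closed[OF e] rep_expo[OF e] by (simp_all add: r_def m_def)
  note cl = \<iota>_closed \<tau>_closed a_pow_closed
  show ?thesis
  proof (cases "cancels b \<omega>")
    case True
    then obtain s c l' where l': "l = (s, c) # l'" "c \<noteq> b" and r1: "r = \<one>"
      by (cases l) (auto simp: cancels_def le r_def)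
    have c: "c = (\<not> b)" using l' by simp
    have s: "s \<in> carrier E" and l'_red: "reduced l'" using l by (simp_all add: l')
    note el = eval_stack_closed[OF l'_red]
    have e_eq: "e = a [^] (modulus b * m)" using re r1 a_pow_closed by simp
    have "eval_nf \<omega> \<otimes>\<^bsub>\<Gamma>\<^esub> \<tau> b
       = eval_stack l' \<otimes>\<^bsub>\<Gamma>\<^esub> \<iota> s \<otimes>\<^bsub>\<Gamma>\<^esub> \<tau> (\<not> b) \<otimes>\<^bsub>\<Gamma>\<^esub> (\<iota> (a [^] (modulus b * m)) \<otimes>\<^bsub>\<Gamma>\<^esub> \<tau> b)"
      using el s by (simp add: eval_nf_def le l' c e_eq G.m_assoc cl)
    also have "\<dots> = eval_stack l' \<otimes>\<^bsub>\<Gamma>\<^esub> \<iota> s \<otimes>\<^bsub>\<Gamma>\<^esub> (\<tau> (\<not> b) \<otimes>\<^bsub>\<Gamma>\<^esub> \<tau> b) \<otimes>\<^bsub>\<Gamma>\<^esub> \<iota> (a [^] (modulus (\<not> b) * m))"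
      using el s by (simp add: commute_stable[symmetric] G.m_assoc cl)
    also have "\<dots> = eval_stack l' \<otimes>\<^bsub>\<Gamma>\<^esub> \<iota> (s \<otimes> a [^] (modulus (\<not> b) * m))"
      using el s by (simp add: \<tau>_inverse \<iota>_mult G.m_assoc cl)
    also have "\<dots> = eval_nf (step b \<omega>)"
      using True by (simp add: eval_nf_def step_def Let_def le l' m_def)
    finally show ?thesis by simp
  next
    case False
    note el = eval_stack_closed[OF l]
    have "eval_nf (step b \<omega>) = eval_stack l \<otimes>\<^bsub>\<Gamma>\<^esub> \<iota> r \<otimes>\<^bsub>\<Gamma>\<^esub> (\<tau> b \<otimes>\<^bsub>\<Gamma>\<^esub> \<iota> (a [^] (modulus (\<not> b) * m)))"
      using False el r by (simp add: eval_nf_def step_def Let_def le m_def r_def G.m_assoc cl)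
    also have "\<dots> = eval_stack l \<otimes>\<^bsub>\<Gamma>\<^esub> (\<iota> r \<otimes>\<^bsub>\<Gamma>\<^esub> \<iota> (a [^] (modulus b * m))) \<otimes>\<^bsub>\<Gamma>\<^esub> \<tau> b"
      using el r by (simp add: commute_stable G.m_assoc cl)
    also have "\<dots> = eval_nf \<omega> \<otimes>\<^bsub>\<Gamma>\<^esub> \<tau> b"
      using r re by (simp add: eval_nf_def le cl flip: \<iota>_mult)
    finally show ?thesis .
  qed
qed

text \<open>
  Evaluation is equivariant on generators, so the normal form determines the element.
\<close>

lemma eval_nf_nf:
  assumes g: "g \<in> carrier \<Gamma>"
  shows "eval_nf (nf g) = g"
proof -
  interpret G: group \<Gamma> by (rule \<Gamma>_group)
  have "\<forall>h\<in>carrier \<Gamma>. eval_nf (nf h) = h \<longrightarrow> eval_nf (nf (h \<otimes>\<^bsub>\<Gamma>\<^esub> g)) = h \<otimes>\<^bsub>\<Gamma>\<^esub> g"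
    using g
  proof (induction rule: \<Gamma>_induct)
    case (base x)
    then show ?case by (simp add: nf_mult_\<iota> eval_append_element nf_closed)
  next
    case (stable b)
    then show ?case by (simp add: nf_mult_\<tau> eval_step nf_closed)
  next
    case (mult g h)
    show ?case
    proof (intro ballI impI)
      fix k assume k: "k \<in> carrier \<Gamma>" "eval_nf (nf k) = k"
      then have "eval_nf (nf (k \<otimes>\<^bsub>\<Gamma>\<^esub> g)) = k \<otimes>\<^bsub>\<Gamma>\<^esub> g" using mult.IH(1) by blast
      then have "eval_nf (nf (k \<otimes>\<^bsub>\<Gamma>\<^esub> g \<otimes>\<^bsub>\<Gamma>\<^esub> h)) = k \<otimes>\<^bsub>\<Gamma>\<^esub> g \<otimes>\<^bsub>\<Gamma>\<^esub> h"
        using mult.IH(2) G.m_closed[OF k(1) mult.hyps(1)] by blast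
      then show "eval_nf (nf (k \<otimes>\<^bsub>\<Gamma>\<^esub> (g \<otimes>\<^bsub>\<Gamma>\<^esub> h))) = k \<otimes>\<^bsub>\<Gamma>\<^esub> (g \<otimes>\<^bsub>\<Gamma>\<^esub> h)"
        using k(1) mult.hyps by (simp add: G.m_assoc)
    qed
  qed simp
  moreover have "eval_nf (nf \<one>\<^bsub>\<Gamma>\<^esub>) = \<one>\<^bsub>\<Gamma>\<^esub>"
    by (simp add: nf_one eval_nf_def \<iota>_one)
  ultimately have "eval_nf (nf (\<one>\<^bsub>\<Gamma>\<^esub> \<otimes>\<^bsub>\<Gamma>\<^esub> g)) = \<one>\<^bsub>\<Gamma>\<^esub> \<otimes>\<^bsub>\<Gamma>\<^esub> g"
    using G.one_closed by blast
  then show ?thesis using g by simp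
qed

lemma nf_\<iota>: "x \<in> carrier E \<Longrightarrow> nf (\<iota> x) = ([], x)"
proof -
  interpret G: group \<Gamma> by (rule \<Gamma>_group)
  show "nf (\<iota> x) = ([], x)" if "x \<in> carrier E"
    using nf_mult_\<iota>[OF G.one_closed that] that \<iota>_closed[OF that]
    by (simp add: nf_one append_element_def)
qed

text \<open>
  Elements of \<open>E\<close> can be read off from their normal forms, so that \<open>E\<close> embeds in the extension.
\<close>

lemma \<iota>_infinite_order: "group.infinite_order \<Gamma> (\<iota> a)"
proof -
  interpret G: group \<Gamma> by (rule \<Gamma>_group)
  have "m = n" if "\<iota> a [^]\<^bsub>\<Gamma>\<^esub> m = \<iota> a [^]\<^bsub>\<Gamma>\<^esub> n" for m n :: int
  proof -
    have "nf (\<iota> (a [^] m)) = nf (\<iota> (a [^] n))" using that by (simp only: \<iota>_pow)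
    then show ?thesis by (simp only: nf_\<iota>[OF a_pow_closed] prod.inject a_pow_eq)
  qed
  then show ?thesis
    using \<iota>_closed[OF a_closed] by (auto simp: G.infinite_order_def intro: injI)
qed

lemma nf_mult_\<tau>_pow:
  assumes "g \<in> carrier \<Gamma>"
  shows "nf (g \<otimes>\<^bsub>\<Gamma>\<^esub> \<tau> b [^]\<^bsub>\<Gamma>\<^esub> (k::nat)) = (step b ^^ k) (nf g)"
proof -
  interpret G: group \<Gamma> by (rule \<Gamma>_group)
  show ?thesis
  proof (induction k)
    case (Suc k)
    have "g \<otimes>\<^bsub>\<Gamma>\<^esub> \<tau> b [^]\<^bsub>\<Gamma>\<^esub> Suc k = (g \<otimes>\<^bsub>\<Gamma>\<^esub> \<tau> b [^]\<^bsub>\<Gamma>\<^esub> k) \<otimes>\<^bsub>\<Gamma>\<^esub> \<tau> b"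
      using assms \<tau>_closed by (simp add: G.m_assoc)
    then show ?case using Suc assms \<tau>_closed by (simp add: nf_mult_\<tau>)
  qed (use assms in simp)
qed

text \<open>
  Once the head of the list has the sign \<open>b\<close>, further letters of this sign only pile up on it.
\<close>

lemma funpow_step_top:
  assumes "fst \<omega> \<noteq> []" "snd (hd (fst \<omega>)) = b"
  shows "\<exists>u. fst ((step b ^^ k) \<omega>) = u @ fst \<omega> \<and> (\<forall>x\<in>set u. snd x = b)"
proof (induction k)
  case (Suc k)
  then obtain u where u: "fst ((step b ^^ k) \<omega>) = u @ fst \<omega>" "\<forall>x\<in>set u. snd x = b" by blast
  have "\<not> cancels b ((step b ^^ k) \<omega>)"
    using u assms by (cases u) (auto simp: cancels_def)
  then have "fst ((step b ^^ Suc k) \<omega>) = (rep (modulus b) (snd ((step b ^^ k) \<omega>)), b) # u @ fst \<omega>"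
    using u by (simp add: step_def Let_def)
  then show ?case using u(2) by (intro exI[of _ "(rep (modulus b) (snd ((step b ^^ k) \<omega>)), b) # u"]) auto
qed auto

text \<open>
  Multiplication by a power of \<open>t\<^sup>\<plusminus>\<^sup>1\<close> first removes some entries of the opposite sign and then adds entries.
\<close>

lemma funpow_step_shape:
  "\<exists>l1 l0 l2. fst \<omega> = l1 @ l0 \<and> fst ((step b ^^ k) \<omega>) = l2 @ l0
     \<and> (\<forall>x\<in>set l1. snd x = (\<not> b)) \<and> (\<forall>x\<in>set l2. snd x = b)"
proof (induction k arbitrary: \<omega>)
  case (Suc k)
  show ?case
  proof (cases "cancels b \<omega>")
    case True
    then obtain s l' where l': "fst \<omega> = (s, \<not> b) # l'" by (cases "fst \<omega>") (auto simp: cancels_def)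
    then have "fst (step b \<omega>) = l'" using True by (simp add: step_def Let_def)
    then obtain l1 l0 l2 where "l' = l1 @ l0" "fst ((step b ^^ k) (step b \<omega>)) = l2 @ l0"
      "\<forall>x\<in>set l1. snd x = (\<not> b)" "\<forall>x\<in>set l2. snd x = b"
      using Suc[of "step b \<omega>"] by auto
    then show ?thesis
      using l' by (intro exI[of _ "(s, \<not> b) # l1"] exI[of _ l0] exI[of _ l2])
        (auto simp: funpow_Suc_right simp del: funpow.simps)
  next
    case False
    then have s: "fst (step b \<omega>) = (rep (modulus b) (snd \<omega>), b) # fst \<omega>"
      by (simp add: step_def Let_def)
    then obtain u where "fst ((step b ^^ k) (step b \<omega>)) = u @ fst (step b \<omega>)" "\<forall>x\<in>set u. snd x = b"
      using funpow_step_top[where \<omega> = "step b \<omega>" and b = b and k = k] by auto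
    then show ?thesis
      using s by (intro exI[of _ "[]"] exI[of _ "fst \<omega>"] exI[of _ "u @ [(rep (modulus b) (snd \<omega>), b)]"])
        (auto simp: funpow_Suc_right simp del: funpow.simps)
  qed
next
  case 0
  show ?case by (intro exI[of _ "[]"] exI[of _ "fst \<omega>"]) simp
qed

lemma nf_\<tau>_pow: "nf (\<tau> b [^]\<^bsub>\<Gamma>\<^esub> (k::nat)) = (replicate k (\<one>, b), \<one>)"
proof -
  interpret G: group \<Gamma> by (rule \<Gamma>_group)
  have e: "expo (modulus b) \<one> = 0"
    using expo_a_pow[OF modulus_nonzero, of b 0] by simp
  have "(step b ^^ k) ([], \<one>) = (replicate k (\<one>, b), \<one>)"
  proof (induction k)
    case (Suc k)
    have "\<not> cancels b (replicate k (\<one>, b), \<one>)" by (cases k) (auto simp: cancels_def)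
    then show ?case using Suc by (simp add: step_def Let_def rep_one e)
  qed simp
  then show ?thesis
    using nf_mult_\<tau>_pow[OF G.one_closed, of b k] \<tau>_closed by (simp add: nf_one)
qed

text \<open>
  One may take for \<open>n\<close> the number of letters \<open>t\<^sup>\<plusminus>\<^sup>1\<close> in a word for \<open>g\<close>: each removes at most one entry, at
  the head.
\<close>

lemma nf_mult_keeps_bottom:
  assumes g: "g \<in> carrier \<Gamma>"
  shows "\<exists>n. \<forall>h\<in>carrier \<Gamma>. \<forall>u l. fst (nf h) = u @ l \<longrightarrow> n \<le> length u
    \<longrightarrow> (\<exists>u'. fst (nf (h \<otimes>\<^bsub>\<Gamma>\<^esub> g)) = u' @ l \<and> length u \<le> length u' + n)"
  using g
proof (induction rule: \<Gamma>_induct)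
  interpret G: group \<Gamma> by (rule \<Gamma>_group)
  case one
  show ?case by (intro exI[of _ 0]) auto
next
  case (base x)
  then show ?case by (intro exI[of _ 0]) (auto simp: nf_mult_\<iota> append_element_def)
next
  case (stable b)
  have "\<exists>u'. fst (step b \<omega>) = u' @ l \<and> length u \<le> length u' + 1"
    if "fst \<omega> = u @ l" "1 \<le> length u" for \<omega> u l
  proof (cases "cancels b \<omega>")
    case True
    then show ?thesis using that by (cases u) (auto simp: step_def Let_def)
  next
    case False
    then show ?thesis
      using that by (intro exI[of _ "(rep (modulus b) (snd \<omega>), b) # u"]) (auto simp: step_def Let_def)
  qed
  then show ?case by (intro exI[of _ 1]) (simp add: nf_mult_\<tau>)
next
  interpret G: group \<Gamma> by (rule \<Gamma>_group)
  case (mult g h)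
  from mult.IH(1) obtain m where
    m: "\<And>k u l. k \<in> carrier \<Gamma> \<Longrightarrow> fst (nf k) = u @ l \<Longrightarrow> m \<le> length u
      \<Longrightarrow> \<exists>u'. fst (nf (k \<otimes>\<^bsub>\<Gamma>\<^esub> g)) = u' @ l \<and> length u \<le> length u' + m"
    by blast
  from mult.IH(2) obtain n where
    n: "\<And>k u l. k \<in> carrier \<Gamma> \<Longrightarrow> fst (nf k) = u @ l \<Longrightarrow> n \<le> length u
      \<Longrightarrow> \<exists>u'. fst (nf (k \<otimes>\<^bsub>\<Gamma>\<^esub> h)) = u' @ l \<and> length u \<le> length u' + n"
    by blast
  show ?case
  proof (intro exI[of _ "m + n"] ballI allI impI)
    fix k u l assume k: "k \<in> carrier \<Gamma>" "fst (nf k) = u @ l" "m + n \<le> length u"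
    obtain u' where u': "fst (nf (k \<otimes>\<^bsub>\<Gamma>\<^esub> g)) = u' @ l" "length u \<le> length u' + m"
      using m[OF k(1,2)] k(3) by auto
    obtain u'' where "fst (nf (k \<otimes>\<^bsub>\<Gamma>\<^esub> g \<otimes>\<^bsub>\<Gamma>\<^esub> h)) = u'' @ l" "length u' \<le> length u'' + n"
      using n[OF G.m_closed[OF k(1) mult.hyps(1)] u'(1)] k(3) u'(2) by auto
    then show "\<exists>u'. fst (nf (k \<otimes>\<^bsub>\<Gamma>\<^esub> (g \<otimes>\<^bsub>\<Gamma>\<^esub> h))) = u' @ l \<and> length u \<le> length u' + (m + n)"
      using u'(2) k(1) mult.hyps by (intro exI[of _ u'']) (simp add: G.m_assoc)
  qed
qed

text \<open>
  For \<open>b = True\<close>, compare the normal forms of \<open>g t\<^sup>K\<close> and \<open>t\<^sup>K g\<close> for a large multiple \<open>K\<close> of \<open>j\<close>. The second one begins, that is,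
  has at the bottom of its list, with many letters \<open>t\<close> and trivial representatives. The first one begins
  with what is left of \<open>g\<close> after some letters \<open>t\<^sup>-\<^sup>1\<close> at its end are removed.
\<close>

lemma commuting_with_stable_power_shape:
  assumes g: "g \<in> carrier \<Gamma>" and j: "j > 0"
    and comm: "g \<otimes>\<^bsub>\<Gamma>\<^esub> \<tau> b [^]\<^bsub>\<Gamma>\<^esub> (j::nat) = \<tau> b [^]\<^bsub>\<Gamma>\<^esub> j \<otimes>\<^bsub>\<Gamma>\<^esub> g"
  shows "\<exists>l1 l0. fst (nf g) = l1 @ l0 \<and> (\<forall>x\<in>set l1. snd x = (\<not> b)) \<and> (\<forall>x\<in>set l0. x = (\<one>, b))"
proof -
  interpret G: group \<Gamma> by (rule \<Gamma>_group)
  let ?t = "\<tau> b"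
  note t = \<tau>_closed[of b]
  obtain n where n: "\<And>h u l. h \<in> carrier \<Gamma> \<Longrightarrow> fst (nf h) = u @ l \<Longrightarrow> n \<le> length u
    \<Longrightarrow> \<exists>u'. fst (nf (h \<otimes>\<^bsub>\<Gamma>\<^esub> g)) = u' @ l \<and> length u \<le> length u' + n"
    using nf_mult_keeps_bottom[OF g] by blast
  \<comment> \<open>long enough for the bottom of \<open>t\<^sup>K\<close> to survive multiplication by \<open>g\<close> and still cover the list of \<open>g\<close>\<close>
  define d where "d = n + length (fst (nf g))"
  define K where "K = j * d"
  have K: "d \<le> K" using j by (cases j) (auto simp: K_def)
  have comm_pow: "g \<otimes>\<^bsub>\<Gamma>\<^esub> ?t [^]\<^bsub>\<Gamma>\<^esub> (j * i) = ?t [^]\<^bsub>\<Gamma>\<^esub> (j * i) \<otimes>\<^bsub>\<Gamma>\<^esub> g" for i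
  proof (induction i)
    case (Suc i)
    let ?s = "?t [^]\<^bsub>\<Gamma>\<^esub> j" and ?r = "?t [^]\<^bsub>\<Gamma>\<^esub> (j * i)"
    have c: "?s \<in> carrier \<Gamma>" "?r \<in> carrier \<Gamma>" using t by auto
    have "?t [^]\<^bsub>\<Gamma>\<^esub> (j * Suc i) = ?s \<otimes>\<^bsub>\<Gamma>\<^esub> ?r" using t by (simp add: G.nat_pow_mult)
    moreover have "g \<otimes>\<^bsub>\<Gamma>\<^esub> (?s \<otimes>\<^bsub>\<Gamma>\<^esub> ?r) = ?s \<otimes>\<^bsub>\<Gamma>\<^esub> (g \<otimes>\<^bsub>\<Gamma>\<^esub> ?r)"
      using c g comm by (simp add: G.m_assoc[symmetric])
    ultimately show ?case using Suc c g by (simp add: G.m_assoc)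
  qed (use g in simp)
  obtain l1 l0 l2 where l: "fst (nf g) = l1 @ l0" "fst (nf (g \<otimes>\<^bsub>\<Gamma>\<^esub> ?t [^]\<^bsub>\<Gamma>\<^esub> K)) = l2 @ l0"
    "\<forall>x\<in>set l1. snd x = (\<not> b)"
    using funpow_step_shape[where \<omega> = "nf g" and b = b and k = K] by (auto simp: nf_mult_\<tau>_pow[OF g])
  have rep_split: "fst (nf (?t [^]\<^bsub>\<Gamma>\<^esub> K)) = replicate n (\<one>, b) @ replicate (K - n) (\<one>, b)"
    using K by (simp add: nf_\<tau>_pow d_def flip: replicate_add)
  obtain u' where "fst (nf (?t [^]\<^bsub>\<Gamma>\<^esub> K \<otimes>\<^bsub>\<Gamma>\<^esub> g)) = u' @ replicate (K - n) (\<one>, b)"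
    using n[OF _ rep_split] t by auto
  then have "l2 @ l0 = u' @ replicate (K - n) (\<one>, b)"
    using l(2) comm_pow[of d] by (simp add: K_def)
  moreover have len: "length l0 \<le> K - n"
    using l(1) K by (simp add: d_def)
  ultimately obtain us where "l0 = us @ replicate (K - n) (\<one>, b) \<or> us @ l0 = replicate (K - n) (\<one>, b)"
    by (auto simp: append_eq_append_conv2)
  then have "\<forall>x\<in>set l0. x = (\<one>, b)"
  proof
    assume "l0 = us @ replicate (K - n) (\<one>, b)"
    then have "us = []" using len by simp
    then show ?thesis using \<open>l0 = us @ replicate (K - n) (\<one>, b)\<close> by simp
  next
    assume "us @ l0 = replicate (K - n) (\<one>, b)"
    then have "set (us @ l0) \<subseteq> {(\<one>, b)}" by (metis set_replicate_conv_if subset_refl empty_subsetI)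
    then show ?thesis by auto
  qed
  then show ?thesis using l by blast
qed

lemma eval_replicate: "eval_stack (replicate i (\<one>, b)) = \<tau> b [^]\<^bsub>\<Gamma>\<^esub> i"
proof -
  interpret G: group \<Gamma> by (rule \<Gamma>_group)
  show ?thesis
    by (induction i) (simp_all add: \<iota>_one \<tau>_closed)
qed

lemma stable_letter_not_periodic_\<Gamma>:
  assumes pq: "\<bar>p\<bar> \<noteq> \<bar>q\<bar>" and m: "m \<noteq> 0"
    and comm: "\<tau> b [^]\<^bsub>\<Gamma>\<^esub> (i::nat) \<otimes>\<^bsub>\<Gamma>\<^esub> \<iota> (a [^] m) = \<iota> (a [^] (m::int)) \<otimes>\<^bsub>\<Gamma>\<^esub> \<tau> b [^]\<^bsub>\<Gamma>\<^esub> i"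
  shows "i = 0"
proof -
  interpret G: group \<Gamma> by (rule \<Gamma>_group)
  have "\<bar>modulus (\<not> b)\<bar> \<noteq> \<bar>modulus b\<bar>" using pq by (auto simp: modulus_def)
  then show ?thesis
    using G.stable_letter_not_periodic[OF \<iota>_infinite_order \<tau>_closed _ relation_bool m] comm
    by (simp add: \<iota>_pow)
qed

text \<open>
  The shapes obtained from commutation with powers of \<open>t\<close> and of \<open>t\<^sup>-\<^sup>1\<close> are compatible only if the list of \<open>g\<close>
  is constant, so \<open>g = t\<^sup>\<plusminus>\<^sup>i e\<close> for some \<open>i \<ge> 0\<close>. As \<open>e\<close> commutes with \<open>a\<close>, commutation of \<open>g\<close> with a power of \<open>a\<close>
  gives \<open>i = 0\<close>. Then the first entry of the normal form of \<open>e t\<^sup>j = t\<^sup>j e\<close> shows that \<open>e\<close> is a power of \<open>a\<^sup>q\<close>,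
  and a non-trivial power of \<open>a\<close> commutes with no positive power of \<open>t\<close>.
\<close>

theorem icc_hnn_group:
  assumes pq: "\<bar>p\<bar> \<noteq> \<bar>q\<bar>"
  shows "icc_group \<Gamma>"
proof -
  interpret G: group \<Gamma> by (rule \<Gamma>_group)
  have "g = \<one>\<^bsub>\<Gamma>\<^esub>" if g: "g \<in> carrier \<Gamma>" and fin: "finite (conjugacy_class \<Gamma> g)" for g
  proof -
    note comm = G.commutes_with_power_if_finite_class[OF g _ fin]
    have shape: "\<exists>l1 l0. fst (nf g) = l1 @ l0 \<and> (\<forall>x\<in>set l1. snd x = (\<not> b)) \<and> (\<forall>x\<in>set l0. x = (\<one>, b))" for b
      using comm[OF \<tau>_closed[of b]] commuting_with_stable_power_shape[OF g] by blast
    obtain l1 l0 where l: "fst (nf g) = l1 @ l0" "\<forall>x\<in>set l1. \<not> snd x" "\<forall>x\<in>set l0. x = (\<one>, True)"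
      using shape[of True] by auto
    obtain l1' l0' where l': "fst (nf g) = l1' @ l0'" "\<forall>x\<in>set l1'. snd x" "\<forall>x\<in>set l0'. x = (\<one>, False)"
      using shape[of False] by auto
    have "\<exists>b. \<forall>x\<in>set (fst (nf g)). x = (\<one>, b)"
    proof (cases "l0 = []")
      case True
      then have "l1' = []" using l l' by (cases l1') auto
      then show ?thesis using l' by auto
    next
      case False
      then have "last (fst (nf g)) = (\<one>, True)" using l by simp
      then have "l0' = []" using l' last_in_set[of l0'] by (cases "l0' = []") auto
      then have "l1 = []" using l l' by (cases l1) auto
      then show ?thesis using l by auto
    qed
    then obtain b i where b: "fst (nf g) = replicate i (\<one>, b)"
      using replicate_eqI[of "fst (nf g)" _ ] by (metis replicate_eqI)
    define e where "e = snd (nf g)"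
    have e: "e \<in> carrier E" using nf_closed[OF g] by (simp add: normal_forms_def e_def)
    have g_eq: "g = \<tau> b [^]\<^bsub>\<Gamma>\<^esub> i \<otimes>\<^bsub>\<Gamma>\<^esub> \<iota> e"
      using eval_nf_nf[OF g] by (simp add: eval_nf_def b eval_replicate e_def)
    note cl = \<iota>_closed[OF e] \<iota>_closed[OF a_closed] \<tau>_closed
    have "i = 0"
    proof -
      obtain m :: nat where m: "m > 0" "g \<otimes>\<^bsub>\<Gamma>\<^esub> \<iota> a [^]\<^bsub>\<Gamma>\<^esub> m = \<iota> a [^]\<^bsub>\<Gamma>\<^esub> m \<otimes>\<^bsub>\<Gamma>\<^esub> g"
        using comm[OF cl(2)] by blast
      have pow: "\<iota> a [^]\<^bsub>\<Gamma>\<^esub> m = \<iota> (a [^] int m)"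
        using \<iota>_pow[of "int m"] by (simp add: int_pow_int)
      have "e \<otimes> a [^] int m = a [^] int m \<otimes> e"
      proof -
        have "e \<otimes> a \<otimes> inv e = a"
          using e a_closed a_central[OF e] by (simp add: E.mult_inv_eq_iff)
        then have "e \<otimes> a [^] int m \<otimes> inv e = a [^] int m"
          using E.conj_int_pow[OF e a_closed, of "int m"] by simp
        then show ?thesis using e a_pow_closed by (simp only: E.mult_inv_eq_iff E.m_closed)
      qed
      then have c: "\<iota> e \<otimes>\<^bsub>\<Gamma>\<^esub> \<iota> (a [^] int m) = \<iota> (a [^] int m) \<otimes>\<^bsub>\<Gamma>\<^esub> \<iota> e"
        using e a_pow_closed by (simp flip: \<iota>_mult)
      let ?t = "\<tau> b [^]\<^bsub>\<Gamma>\<^esub> i" and ?\<alpha> = "\<iota> (a [^] int m)"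
      have t: "?t \<in> carrier \<Gamma>" "?\<alpha> \<in> carrier \<Gamma>" using cl \<iota>_closed[OF a_pow_closed] by auto
      have "?t \<otimes>\<^bsub>\<Gamma>\<^esub> ?\<alpha> \<otimes>\<^bsub>\<Gamma>\<^esub> \<iota> e = ?\<alpha> \<otimes>\<^bsub>\<Gamma>\<^esub> ?t \<otimes>\<^bsub>\<Gamma>\<^esub> \<iota> e"
        using m(2) t cl c unfolding pow g_eq by (simp add: G.m_assoc)
      then have "?t \<otimes>\<^bsub>\<Gamma>\<^esub> ?\<alpha> = ?\<alpha> \<otimes>\<^bsub>\<Gamma>\<^esub> ?t" using t cl by simp
      then show "i = 0" using m(1) by (intro stable_letter_not_periodic_\<Gamma>[OF pq, of "int m"]) auto
    qed
    then have g_e: "g = \<iota> e" using g_eq cl by simp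
    obtain j :: nat where j: "j > 0" "g \<otimes>\<^bsub>\<Gamma>\<^esub> \<tau> True [^]\<^bsub>\<Gamma>\<^esub> j = \<tau> True [^]\<^bsub>\<Gamma>\<^esub> j \<otimes>\<^bsub>\<Gamma>\<^esub> g"
      using comm[OF \<tau>_closed] by blast
    obtain k where k: "j = Suc k" using j(1) gr0_implies_Suc by blast
    have "nf (g \<otimes>\<^bsub>\<Gamma>\<^esub> \<tau> True [^]\<^bsub>\<Gamma>\<^esub> j) = (step True ^^ k) (step True ([], e))"
    proof -
      have "nf g = ([], e)" unfolding g_e by (rule nf_\<iota>[OF e])
      then show ?thesis by (simp only: nf_mult_\<tau>_pow[OF g] k funpow_Suc_right o_apply)
    qed
    moreover have "fst (step True ([], e)) = [(rep q e, True)]"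
      by (simp add: step_def Let_def cancels_def modulus_def)
    ultimately obtain u where "fst (nf (g \<otimes>\<^bsub>\<Gamma>\<^esub> \<tau> True [^]\<^bsub>\<Gamma>\<^esub> j)) = u @ [(rep q e, True)]"
      using funpow_step_top[where \<omega> = "step True ([], e)" and b = True and k = k] by auto
    moreover have "fst (nf (\<tau> True [^]\<^bsub>\<Gamma>\<^esub> j \<otimes>\<^bsub>\<Gamma>\<^esub> g)) = replicate j (\<one>, True)"
      using \<tau>_closed e by (simp add: g_e nf_mult_\<iota> nf_\<tau>_pow append_element_def)
    ultimately have "u @ [(rep q e, True)] = replicate j (\<one>, True)" using j(2) by simp
    then have "(rep q e, True) \<in> set (replicate j (\<one>, True))" by (metis in_set_conv_decomp)
    then have "rep q e = \<one>" by simp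
    then have e_pow: "e = a [^] (q * expo q e)"
      using rep_expo[OF e, of q] a_pow_closed by simp
    have "q * expo q e = 0"
    proof (rule ccontr)
      assume "q * expo q e \<noteq> 0"
      moreover have "\<tau> True [^]\<^bsub>\<Gamma>\<^esub> j \<otimes>\<^bsub>\<Gamma>\<^esub> \<iota> (a [^] (q * expo q e))
         = \<iota> (a [^] (q * expo q e)) \<otimes>\<^bsub>\<Gamma>\<^esub> \<tau> True [^]\<^bsub>\<Gamma>\<^esub> j"
        unfolding e_pow[symmetric] using j(2) unfolding g_e by (rule sym)
      ultimately have "j = 0"
        by (rule stable_letter_not_periodic_\<Gamma>[OF pq])
      then show False using j(1) by simp
    qed
    then have "e = a [^] (0::int)" using e_pow by (simp only:)
    then have "e = \<one>" by simp
    then show "g = \<one>\<^bsub>\<Gamma>\<^esub>" by (simp add: g_e \<iota>_one)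
  qed
  then show ?thesis
    using \<Gamma>_group by (auto simp: icc_group_def)
qed

theorem vN_property_Gamma_hnn_group:
  assumes pq: "\<bar>p\<bar> \<noteq> \<bar>q\<bar>"
  shows "vN_property_Gamma \<Gamma>"
proof -
  interpret G: group \<Gamma> by (rule \<Gamma>_group)
  have "z \<in> carrier \<Gamma> \<and> z \<otimes>\<^bsub>\<Gamma>\<^esub> \<iota> a = \<iota> a \<otimes>\<^bsub>\<Gamma>\<^esub> z" if z: "z \<in> \<iota> ` carrier E" for z
  proof -
    obtain x where x: "x \<in> carrier E" "z = \<iota> x" using z by blast
    then show ?thesis
      using \<iota>_closed \<iota>_mult[OF x(1) a_closed] \<iota>_mult[OF a_closed x(1)] a_central[OF x(1)] by simp
  qed
  then show ?thesis
    by (intro G.vN_property_Gamma_of_Baumslag_Solitar_relation[OF \<iota>_infinite_order \<tau>_closed _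
          generate_\<Gamma> p_nonzero q_nonzero pq relation_\<Gamma>])
qed

end

theorem theorem1p4:
  fixes E :: "('a, 'm) monoid_scheme" and a :: 'a and p q :: int
  assumes "group E" and "countable (carrier E)"
    and "a \<in> carrier E"
    and "\<And>x. x \<in> carrier E \<Longrightarrow> a \<otimes>\<^bsub>E\<^esub> x = x \<otimes>\<^bsub>E\<^esub> a"
    and "group.ord E a = 0"
    and "p \<noteq> 0" and "q \<noteq> 0" and "\<bar>p\<bar> \<noteq> \<bar>q\<bar>"
  shows "icc_group (hnn_group E a p q) \<and> vN_property_Gamma (hnn_group E a p q)"
proof -
  interpret E: group E by fact
  have "E.infinite_order a"
    unfolding E.infinite_order_def inj_def using assms(3,5) E.int_pow_eq by simp
  then interpret hnn_data E a p q
    using assms by unfold_locales auto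
  show ?thesis
    using icc_hnn_group vN_property_Gamma_hnn_group assms(8) by simp
qed

end
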